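(* Let $\mathrm{GF}(\kappa)=\prod_{s\in S}\mathbb{F}_{q_s}/\mathcal{D}$ be an ultra-finite field with $\kappa=\mathrm{ulim}_{s\in S}q_s$, let $\mathbb{A}=\mathrm{GF}(\kappa)[t]$, and let $n\in\mathbb{N}^{\#}$ be a hypernatural number dividing $\kappa-1$ in $\mathbb{Z}^{\#}$. Let $\alpha,\beta$ be relatively prime nonzero elements of $\mathbb{A}$. Then $$\left(\frac{\alpha}{\beta}\right)_n\left(\frac{\beta}{\alpha}\right)_n^{-1}=(-1)^{\frac{\kappa-1}{n}\deg(\alpha)\deg(\beta)}\,\mathrm{sign}_n(\alpha)^{\deg(\beta)}\,\mathrm{sign}_n(\beta)^{-\deg(\alpha)} .$$
   Context: Fix an infinite set $S$ and a nonprincipal ultrafilter $\mathcal{D}$ on $S$. $\prod_{s\in S}A_s/\mathcal{D}$ denotes the ultraproduct of sets $A_s$, and $\mathrm{ulim}_{s\in S}a_s$ the class of $(a_s)_{s\in S}$. $\mathbb{Z}^{\#}=\prod_{s\in S}\mathbb{Z}/\mathcal{D}$ (hyperintegers), $\mathbb{N}^{\#}=\prod_{s\in S}\mathbb{N}/\mathcal{D}$ with $\mathbb{N}=\{1,2,\ldots\}$ (hypernaturals); $\mathbb{Z}\subset\mathbb{Z}^{\#}$ diagonally; $a$ divides $b$ in $\mathbb{Z}^{\#}$ if $b=ac$ with $c\in\mathbb{Z}^{\#}$. Here $\mathbb{F}_{q_s}$ is the finite field with $q_s$ elements, $q_s$ a prime power, for all $s$ in a set of $\mathcal{D}$. Let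 $\mathcal{U}(\mathbb{A})=\prod_{s\in S}\mathbb{F}_{q_s}[t]/\mathcal{D}$; $\mathbb{A}$ is a subring of $\mathcal{U}(\mathbb{A})$ by sending $\sum_{i\le m}a_it^i$, $a_i=\mathrm{ulim}_s a_{i,s}$, to $\mathrm{ulim}_s\sum_{i\le m}a_{i,s}t^i$. For $a=\mathrm{ulim}_s a_s$ in an ultraproduct of rings and a hyperinteger $e=\mathrm{ulim}_s e_s\ge 0$, put $a^e:=\mathrm{ulim}_s a_s^{e_s}$ (negative hyperinteger exponents are also allowed for $a\in\mathrm{GF}(\kappa)^\times$). Power residue symbol: for $P\in\mathbb{A}$ irreducible of degree $d\ge1$ and $\alpha\in\mathbb{A}$ not divisible by $P$, $\left(\frac{\alpha}{P}\right)_n$ is the unique element of $\mathrm{GF}(\kappa)^{\times}$ with $\alpha^{\frac{\kappa^d-1}{n}}\equiv\left(\frac{\alpha}{P}\right)_n\pmod{P\,\mathcal{U}(\mathbb{A})}$; if $P$ divides $\alpha$, $\left(\frac{\alpha}{P}\right)_n:=0$. For $\beta\in\mathbb{A}$ of positive degree with prime factorization $\beta=aP_1^{d_1}\cdots P_m^{d_m}$ ($a\in\mathrm{GF}(\kappa)^\times$, $P_i$ distinct monic irreducible, $d_i\geq 1$), $\left(\frac{\alpha}{\beta}\right)_n:=\prod_{i=1}^m\left(\frac{\alpha}{P_i}\right)_n^{d_i}$; for $\beta\in\mathrm{GF}(\kappa)^\times$, $\left(\frac{\alpha}{\beta}\right)_n:=1$. For nonzero $f\in\mathbb{A}$ with leading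 coefficient $a\in\mathrm{GF}(\kappa)^\times$, $\mathrm{sign}_n(f):=a^{\frac{\kappa-1}{n}}$. *)

theory Defs
  imports "HOL-Algebra.Polynomial_Divisibility" "HOL-Algebra.IntRing"
begin

definition nonprincipal_ultrafilter :: "'s filter \<Rightarrow> bool" where
  "nonprincipal_ultrafilter D \<longleftrightarrow>
     D \<noteq> bot \<and>
     (\<forall>P. eventually P D \<or> eventually (\<lambda>s. \<not> P s) D) \<and>
     (\<forall>s\<^sub>0. \<not> eventually (\<lambda>s. s = s\<^sub>0) D)"

text \<open>
  The index set is the type \<open>'s\<close>, and \<open>\<forall>\<^sub>F s in D\<close> reads ``for all \<open>s\<close> in a set of \<open>D\<close>''.
  The class of a family consists of all families that agree with it on a set of \<open>D\<close>. A family
  represents an element of the ultraproduct as soon as it takes values in the factors on a set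
  of \<open>D\<close>. When the factors are nonempty this is the same as requiring it for all \<open>s\<close>;
  factors outside a set of \<open>D\<close> play no role.
\<close>

definition ulim :: "'s filter \<Rightarrow> ('s \<Rightarrow> 'a) \<Rightarrow> ('s \<Rightarrow> 'a) set" where
  "ulim D a = {b. \<forall>\<^sub>F s in D. b s = a s}"

definition ultraproduct :: "'s filter \<Rightarrow> ('s \<Rightarrow> 'a set) \<Rightarrow> ('s \<Rightarrow> 'a) set set" where
  "ultraproduct D A = {ulim D a | a. \<forall>\<^sub>F s in D. a s \<in> A s}"

definition rep :: "('s \<Rightarrow> 'a) set \<Rightarrow> 's \<Rightarrow> 'a" where
  "rep x = (SOME a. a \<in> x)"

definition ultraring ::
  "'s filter \<Rightarrow> ('s \<Rightarrow> ('a, 'b) ring_scheme) \<Rightarrow> ('s \<Rightarrow> 'a) set ring" where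
  "ultraring D R =
     \<lparr> carrier = ultraproduct D (\<lambda>s. carrier (R s)),
       mult = (\<lambda>x y. ulim D (\<lambda>s. rep x s \<otimes>\<^bsub>R s\<^esub> rep y s)),
       one = ulim D (\<lambda>s. \<one>\<^bsub>R s\<^esub>),
       zero = ulim D (\<lambda>s. \<zero>\<^bsub>R s\<^esub>),
       add = (\<lambda>x y. ulim D (\<lambda>s. rep x s \<oplus>\<^bsub>R s\<^esub> rep y s)) \<rparr>"

type_synonym 's hyperint = "('s \<Rightarrow> int) set"

abbreviation hyperints :: "'s filter \<Rightarrow> 's hyperint ring" where
  "hyperints D \<equiv> ultraring D (\<lambda>_. \<Z>)"

text \<open>Hypernaturals, starting from \<open>1\<close>, as a subset of the hyperintegers.\<close>

definition hypernats :: "'s filter \<Rightarrow> 's hyperint set" where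
  "hypernats D = ultraproduct D (\<lambda>_. {1..})"

definition hyper_of_int :: "'s filter \<Rightarrow> int \<Rightarrow> 's hyperint" where
  "hyper_of_int D k = ulim D (\<lambda>_. k)"

text \<open>The quotient \<open>a/b\<close> of hyperintegers, for \<open>b \<noteq> 0\<close> dividing \<open>a\<close>.\<close>

definition hyper_quot :: "'s filter \<Rightarrow> 's hyperint \<Rightarrow> 's hyperint \<Rightarrow> 's hyperint" where
  "hyper_quot D a b = (THE c. c \<in> carrier (hyperints D) \<and> a = b \<otimes>\<^bsub>hyperints D\<^esub> c)"

text \<open>
  Negative exponents go through the inverse in the factors, so they are meaningful only for
  units.
\<close>

definition hyper_pow ::
  "'s filter \<Rightarrow> ('s \<Rightarrow> ('a, 'b) ring_scheme) \<Rightarrow> ('s \<Rightarrow> 'a) set \<Rightarrow> 's hyperint \<Rightarrow> ('s \<Rightarrow> 'a) set"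
  where "hyper_pow D R x e = ulim D (\<lambda>s. rep x s [^]\<^bsub>R s\<^esub> rep e s)"

text \<open>
  In all that follows \<open>F\<close> is a family of rings that are finite fields on a set of \<open>D\<close>;
  \<open>GF D F\<close> is their ultraproduct, \<open>kappa D F\<close> its internal cardinality,
  \<open>GF_poly D F\<close> is \<open>GF(\<kappa>)[t]\<close> and \<open>ultra_poly D F\<close> is the ultraproduct of
  the rings \<open>F s [t]\<close>. Polynomials are lists of coefficients, leading coefficient first.
\<close>

abbreviation (input) GF :: "'s filter \<Rightarrow> ('s \<Rightarrow> ('a, 'b) ring_scheme) \<Rightarrow> ('s \<Rightarrow> 'a) set ring" where
  "GF D F \<equiv> ultraring D F"

definition kappa :: "'s filter \<Rightarrow> ('s \<Rightarrow> ('a, 'b) ring_scheme) \<Rightarrow> 's hyperint" where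
  "kappa D F = ulim D (\<lambda>s. int (order (F s)))"

abbreviation GF_poly ::
  "'s filter \<Rightarrow> ('s \<Rightarrow> ('a, 'b) ring_scheme) \<Rightarrow> ('s \<Rightarrow> 'a) set list ring" where
  "GF_poly D F \<equiv> univ_poly (GF D F) (carrier (GF D F))"

abbreviation ultra_poly ::
  "'s filter \<Rightarrow> ('s \<Rightarrow> ('a, 'b) ring_scheme) \<Rightarrow> ('s \<Rightarrow> 'a list) set ring" where
  "ultra_poly D F \<equiv> ultraring D (\<lambda>s. univ_poly (F s) (carrier (F s)))"

text \<open>
  The embedding of \<open>GF(\<kappa>)[t]\<close> into the ultraproduct of the \<open>F s [t]\<close>, coefficient by
  coefficient; \<open>normalize\<close> strips leading zeros.
\<close>

definition embed ::
  "'s filter \<Rightarrow> ('s \<Rightarrow> ('a, 'b) ring_scheme) \<Rightarrow> ('s \<Rightarrow> 'a) set list \<Rightarrow> ('s \<Rightarrow> 'a list) set" where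
  "embed D F p = ulim D (\<lambda>s. ring.normalize (F s) (map (\<lambda>c. rep c s) p))"

abbreviation const_poly ::
  "'s filter \<Rightarrow> ('s \<Rightarrow> ('a, 'b) ring_scheme) \<Rightarrow> ('s \<Rightarrow> 'a) set \<Rightarrow> ('s \<Rightarrow> 'a) set list" where
  "const_poly D F c \<equiv> ring.poly_of_const (GF D F) c"

text \<open>The symbol with irreducible denominator \<open>P\<close> (not necessarily monic).\<close>

definition prime_symbol ::
  "'s filter \<Rightarrow> ('s \<Rightarrow> ('a, 'b) ring_scheme) \<Rightarrow> 's hyperint \<Rightarrow>
   ('s \<Rightarrow> 'a) set list \<Rightarrow> ('s \<Rightarrow> 'a) set list \<Rightarrow> ('s \<Rightarrow> 'a) set" where
  "prime_symbol D F n \<alpha> P =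
     (if P divides\<^bsub>GF_poly D F\<^esub> \<alpha> then \<zero>\<^bsub>GF D F\<^esub>
      else THE c. c \<in> Units (GF D F) \<and>
        hyper_pow D (\<lambda>s. univ_poly (F s) (carrier (F s))) (embed D F \<alpha>)
          (hyper_quot D
             (kappa D F [^]\<^bsub>hyperints D\<^esub> degree P \<ominus>\<^bsub>hyperints D\<^esub> \<one>\<^bsub>hyperints D\<^esub>) n)
          \<ominus>\<^bsub>ultra_poly D F\<^esub> embed D F (const_poly D F c)
        \<in> PIdl\<^bsub>ultra_poly D F\<^esub> (embed D F P))"

definition power_residue_symbol ::
  "'s filter \<Rightarrow> ('s \<Rightarrow> ('a, 'b) ring_scheme) \<Rightarrow> 's hyperint \<Rightarrow>
   ('s \<Rightarrow> 'a) set list \<Rightarrow> ('s \<Rightarrow> 'a) set list \<Rightarrow> ('s \<Rightarrow> 'a) set" where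
  "power_residue_symbol D F n \<alpha> \<beta> =
     (if degree \<beta> = 0 then \<one>\<^bsub>GF D F\<^esub>
      else THE v. \<exists>a Ps d.
        a \<in> Units (GF D F) \<and> finite Ps \<and>
        (\<forall>P\<in>Ps. P \<in> carrier (GF_poly D F) \<and> pirreducible\<^bsub>GF D F\<^esub> (carrier (GF D F)) P \<and>
           lead_coeff P = \<one>\<^bsub>GF D F\<^esub> \<and> (d P :: nat) \<ge> 1) \<and>
        \<beta> = const_poly D F a \<otimes>\<^bsub>GF_poly D F\<^esub>
              finprod (GF_poly D F) (\<lambda>P. P [^]\<^bsub>GF_poly D F\<^esub> d P) Ps \<and>
        v = finprod (GF D F) (\<lambda>P. prime_symbol D F n \<alpha> P [^]\<^bsub>GF D F\<^esub> d P) Ps)"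

abbreviation kappa_quot ::
  "'s filter \<Rightarrow> ('s \<Rightarrow> ('a, 'b) ring_scheme) \<Rightarrow> 's hyperint \<Rightarrow> 's hyperint" where
  "kappa_quot D F n \<equiv> hyper_quot D (kappa D F \<ominus>\<^bsub>hyperints D\<^esub> \<one>\<^bsub>hyperints D\<^esub>) n"

definition poly_sign ::
  "'s filter \<Rightarrow> ('s \<Rightarrow> ('a, 'b) ring_scheme) \<Rightarrow> 's hyperint \<Rightarrow>
   ('s \<Rightarrow> 'a) set list \<Rightarrow> ('s \<Rightarrow> 'a) set" where
  "poly_sign D F n f = hyper_pow D F (lead_coeff f) (kappa_quot D F n)"

end

theory Submission
  imports Defs
begin

text \<open>
  Over a finite field with \<open>q\<close> elements, the proof is a version of Gauss's lemma. If \<open>P\<close> is irreducible and does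
  not divide \<open>\<alpha>\<close>, then multiplication by \<open>\<alpha>\<close> modulo \<open>P\<close> permutes the monic polynomials \<open>M\<close> of degree less
  than \<open>deg P\<close> up to scalars: \<open>\<alpha> M\<close> is congruent to \<open>c\<^sub>M M'\<close>. Multiplying over all \<open>M\<close> and cancelling shows
  that the power of \<open>\<alpha>\<close> with exponent \<open>(q^(deg P) - 1)/(q - 1)\<close> is congruent to the product of the scalars
  \<open>c\<^sub>M\<close>, called \<open>gauss_symbol \<alpha> P\<close> below (\<open>gauss_symbol_cong\<close>). So the \<open>n\<close>-th power residue symbol is the power
  of the Gauss symbol with exponent \<open>(q - 1)/n\<close>. Since constants are determined by their residue modulo \<open>P\<close>, the
  Gauss symbol is multiplicative in \<open>\<alpha>\<close>, and it equals \<open>a^(deg P)\<close> for a nonzero constant \<open>\<alpha> = a\<close>.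

  Reciprocity for monic irreducible \<open>P \<noteq> Q\<close> (\<open>gauss_symbol_reciprocity\<close>) only needs division with remainder.
  The scalars are the leading coefficients of the remainders of \<open>Q M\<close> modulo \<open>P\<close> and of \<open>P N\<close> modulo \<open>Q\<close>. Let
  \<open>deg Q \<le> deg P\<close>. If \<open>M\<close> is the quotient of \<open>P N\<close> by \<open>Q\<close>, then these two remainders are negatives of each other.
  The other \<open>M\<close> together contribute a power of the product of all nonzero elements of the field, which is \<open>-1\<close>
  by Wilson's theorem. Counting the signs gives \<open>(-1)^(deg P deg Q)\<close>.

  Everything passes to the ultraproduct. A polynomial over \<open>GF(\<kappa>)\<close> is a family of polynomials of constant
  degree over the factors, and conversely every family of bounded degree arises in this way (\<open>lift_surj\<close>). Hence
  divisibility and irreducibility pass to the factors on a set of \<open>D\<close>, and the symbol with irreducible denominator is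
  the class of the symbols over the factors (\<open>prime_symbol_eq\<close>). Finally, unique factorization over \<open>GF(\<kappa>)\<close>
  extends reciprocity from monic irreducible polynomials to all nonzero polynomials
  (\<open>extend_primes_reciprocity\<close>).
\<close>

section \<open>Products in commutative monoids and finite fields\<close>

lemma (in abelian_group) add_eq_imp_minus_eq:
  "x = y \<oplus> z \<Longrightarrow> y \<in> carrier G \<Longrightarrow> z \<in> carrier G \<Longrightarrow> x \<ominus> z = y"
  by (simp add: minus_eq a_assoc r_neg)

lemma (in comm_monoid) finprod_nat_pow:
  "f \<in> A \<rightarrow> carrier G \<Longrightarrow> finprod G (\<lambda>x. f x [^] (k :: nat)) A = finprod G f A [^] k"
proof (induction A rule: infinite_finite_induct)
  case (insert x A)
  then have "f x \<in> carrier G" "f \<in> A \<rightarrow> carrier G" by auto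
  moreover from this have "(\<lambda>x. f x [^] k) \<in> A \<rightarrow> carrier G" by auto
  ultimately show ?case using insert by (simp add: nat_pow_distrib)
qed auto

lemma (in comm_monoid) finprod_scale:
  "w \<in> carrier G \<Longrightarrow> f \<in> A \<rightarrow> carrier G \<Longrightarrow>
    finprod G (\<lambda>x. w \<otimes> f x) A = w [^] card A \<otimes> finprod G f A"
  by (simp add: finprod_const)

text \<open>Raising one exponent, possibly from zero, multiplies the product by the corresponding base.\<close>

lemma (in comm_monoid) finprod_pow_update:
  fixes d :: "'c \<Rightarrow> nat"
  assumes "finite A" and "f \<in> insert x A \<rightarrow> carrier G"
  shows "finprod G (\<lambda>y. f y [^] (d(x := if x \<in> A then Suc (d x) else 1)) y) (insert x A) =
    f x \<otimes> finprod G (\<lambda>y. f y [^] d y) A"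
proof -
  let ?d = "d(x := if x \<in> A then Suc (d x) else 1)"
  let ?B = "A - {x}"
  have fx: "f x \<in> carrier G" and fB: "\<And>y. y \<in> ?B \<Longrightarrow> f y \<in> carrier G" using assms(2) by auto
  have "finprod G (\<lambda>y. f y [^] ?d y) (insert x ?B) = f x [^] ?d x \<otimes> finprod G (\<lambda>y. f y [^] ?d y) ?B"
    by (rule finprod_insert) (use assms(1) fx fB in auto)
  also have "finprod G (\<lambda>y. f y [^] ?d y) ?B = finprod G (\<lambda>y. f y [^] d y) ?B"
    by (rule finprod_cong') (use fB in auto)
  finally have *: "finprod G (\<lambda>y. f y [^] ?d y) (insert x A) = f x [^] ?d x \<otimes> finprod G (\<lambda>y. f y [^] d y) ?B"
    by simp
  have B: "finprod G (\<lambda>y. f y [^] d y) ?B \<in> carrier G" using fB by (intro finprod_closed) auto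
  show ?thesis
  proof (cases "x \<in> A")
    case True
    have "finprod G (\<lambda>y. f y [^] d y) (insert x ?B) = f x [^] d x \<otimes> finprod G (\<lambda>y. f y [^] d y) ?B"
      by (rule finprod_insert) (use assms(1) fx fB in auto)
    then show ?thesis using * True fx B by (simp add: insert_absorb m_ac)
  next
    case False
    then show ?thesis using * fx by simp
  qed
qed

lemma (in comm_monoid) mult_inv_eq_mult_inv:
  assumes "x \<in> carrier G" "y \<in> carrier G" "u \<in> Units G" "v \<in> Units G" and eq: "x \<otimes> u = y \<otimes> v"
  shows "x \<otimes> inv v = y \<otimes> inv u"
proof -
  have c: "u \<in> carrier G" "v \<in> carrier G" "inv u \<in> carrier G" "inv v \<in> carrier G" using assms by auto
  have "x \<otimes> inv v = (x \<otimes> u) \<otimes> (inv u \<otimes> inv v)"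
    using assms(1,3) c Units_r_inv[of u] by (metis m_assoc m_closed r_one)
  also have "\<dots> = (y \<otimes> inv u) \<otimes> (v \<otimes> inv v)"
    unfolding eq using assms(2) c by (simp add: m_ac del: Units_r_inv Units_l_inv)
  also have "\<dots> = y \<otimes> inv u" using assms(2,4) c by simp
  finally show ?thesis .
qed

text \<open>Elements cancel in pairs under a fixed point free involution that sends \<open>x\<close> to its inverse.\<close>

lemma (in comm_monoid) finprod_involution:
  assumes "finite A" and "A \<subseteq> carrier G" and "\<And>x. x \<in> A \<Longrightarrow> f x \<in> A"
    and "\<And>x. x \<in> A \<Longrightarrow> f x \<noteq> x" and "\<And>x. x \<in> A \<Longrightarrow> f (f x) = x"
    and "\<And>x. x \<in> A \<Longrightarrow> x \<otimes> f x = \<one>"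
  shows "finprod G (\<lambda>x. x) A = \<one>"
  using assms
proof (induction "card A" arbitrary: A rule: less_induct)
  case less
  show ?case
  proof (cases "A = {}")
    case False
    then obtain x where x: "x \<in> A" by blast
    define B where "B = A - {x, f x}"
    have fx: "f x \<in> A" "f x \<noteq> x" using less.prems x by auto
    have A: "A = insert x (insert (f x) B)" and nB: "x \<notin> B" "f x \<notin> B"
      using x fx by (auto simp: B_def)
    have finB: "finite B" and carr: "B \<subseteq> carrier G" "x \<in> carrier G" "f x \<in> carrier G"
      using less.prems x fx by (auto simp: B_def)
    have fB: "f y \<in> B" if "y \<in> B" for y
    proof -
      have "y \<in> A" "y \<noteq> x" "y \<noteq> f x" using that by (auto simp: B_def)
      then have "f y \<in> A" "f (f y) = y" "f (f x) = x" using less.prems x by auto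
      then have "f y \<noteq> x" "f y \<noteq> f x" using \<open>y \<noteq> x\<close> \<open>y \<noteq> f x\<close> by metis+
      then show ?thesis using \<open>f y \<in> A\<close> by (simp add: B_def)
    qed
    have "card B < card A"
      by (rule psubset_card_mono) (use less.prems x in \<open>auto simp: B_def\<close>)
    then have "finprod G (\<lambda>x. x) B = \<one>"
      using less.prems fB finB carr by (intro less.hyps) (auto simp: B_def)
    moreover have "finprod G (\<lambda>x. x) A = x \<otimes> (f x \<otimes> finprod G (\<lambda>x. x) B)"
      unfolding A using finB carr nB fx by (subst finprod_insert; (subst finprod_insert)?) auto
    ultimately show ?thesis
      using less.prems(6)[OF x] carr by simp
  qed simp
qed

context field
begin

lemma nonzero_pow: "a \<in> carrier R - {\<zero>} \<Longrightarrow> a [^] (k :: nat) \<in> carrier R - {\<zero>}"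
  using Units_pow_closed[of a k] field_Units by auto

lemma nonzero_finprod:
  "f \<in> A \<rightarrow> carrier R - {\<zero>} \<Longrightarrow> finprod R f A \<in> carrier R - {\<zero>}"
proof (induction A rule: infinite_finite_induct)
  case (insert x A)
  then show ?case
    by (subst finprod_insert) (auto simp: Pi_def integral_iff)
qed auto

lemma minus_one_nonzero: "\<ominus> \<one> \<in> carrier R - {\<zero>}"
  using add.inv_eq_1_iff by fastforce

lemma minus_one_square: "\<ominus> \<one> \<otimes> \<ominus> \<one> = \<one>"
  by (simp add: l_minus)

lemma minus_one_pow: "(\<ominus> \<one>) [^] (k :: nat) = (if even k then \<one> else \<ominus> \<one>)"
  by (induction k) (auto simp: l_minus)

text \<open>Wilson's theorem for an arbitrary finite field.\<close>

lemma finprod_nonzero_elements: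
  assumes "finite (carrier R)"
  shows "finprod R (\<lambda>c. c) (carrier R - {\<zero>}) = \<ominus> \<one>"
proof -
  define A where "A = carrier R - {\<zero>, \<one>, \<ominus> \<one>}"
  have AU: "x \<in> Units R" if "x \<in> A" for x using that by (auto simp: A_def field_Units)
  have inv_neq: "x = \<one> \<or> x = \<ominus> \<one>" if "x \<in> carrier R" "x \<noteq> \<zero>" "inv x = x" for x
  proof -
    have "x \<otimes> x = \<one>" using that field_Units Units_r_inv[of x] by auto
    then show ?thesis using square_eq_one that by blast
  qed
  \<comment> \<open>Only \<open>1\<close> and \<open>-1\<close> are their own inverses; all other elements cancel in pairs.\<close>
  have A1: "finprod R (\<lambda>x. x) A = \<one>"
  proof (rule finprod_involution)
    fix x assume x: "x \<in> A"
    have xU: "x \<in> Units R" and ix: "inv x \<in> Units R" using AU[OF x] by auto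
    have i1: "inv \<one> = \<one>" and i2: "inv (\<ominus> \<one>) = \<ominus> \<one>"
      using minus_one_square by (auto intro: comm_inv_char)
    show "inv (inv x) = x" using xU by simp
    then show "inv x \<in> A" using x ix i1 i2
      unfolding A_def field_Units by (metis DiffE DiffI Units_inv_Units ix insertE insertI1 insertI2 field_Units Units_closed)
    show "inv x \<noteq> x" using inv_neq x by (auto simp: A_def)
    show "x \<otimes> inv x = \<one>" using xU by simp
  qed (use assms in \<open>auto simp: A_def\<close>)
  have finA: "finite A" and sub: "A \<subseteq> carrier R" using assms by (auto simp: A_def)
  show ?thesis
  proof (cases "\<ominus> \<one> = \<one>")
    case True
    have "carrier R - {\<zero>} = insert \<one> A" "\<one> \<notin> A" using True by (auto simp: A_def)
    then show ?thesis using A1 finA sub True by (simp add: finprod_insert subset_iff)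
  next
    case False
    have "carrier R - {\<zero>} = insert \<one> (insert (\<ominus> \<one>) A)" "\<one> \<notin> insert (\<ominus> \<one>) A" "\<ominus> \<one> \<notin> A"
      using False minus_one_nonzero by (auto simp: A_def)
    then show ?thesis using A1 finA sub by (simp add: finprod_insert subset_iff Pi_def)
  qed
qed

lemma pow_card_eq:
  assumes "finite (carrier R)" and "a \<in> carrier R"
  shows "a [^] card (carrier R) = a"
proof (cases "a = \<zero>")
  case True
  have "card (carrier R) > 0" using assms card_gt_0_iff by blast
  then show ?thesis using True by (cases "card (carrier R)") simp_all
next
  case False
  have "a \<in> Units R" using False assms field_Units by simp
  then have "a [^] card (Units R) = \<one>"
    using units_power_order_eq_one assms(1) field_Units by simp
  moreover have "card (carrier R) = Suc (card (Units R))"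
    unfolding field_Units using assms(1) card_Suc_Diff1[of "carrier R" \<zero>] by simp
  ultimately show ?thesis using assms by simp
qed

lemma pow_card_pow_eq:
  assumes "finite (carrier R)" and "a \<in> carrier R"
  shows "a [^] (card (carrier R) ^ i) = a"
proof (induction i)
  case (Suc i)
  have "a [^] (card (carrier R) ^ Suc i) = (a [^] card (carrier R)) [^] (card (carrier R) ^ i)"
    by (simp add: nat_pow_pow assms)
  then show ?case using pow_card_eq[OF assms] Suc.IH by simp
qed (use assms in simp)

text \<open>All powers \<open>q^i\<close> act trivially, so the exponent \<open>1 + q + \<dots> + q^(d-1)\<close> acts like \<open>d\<close>.\<close>

lemma pow_geometric_eq:
  assumes "finite (carrier R)" and "a \<in> carrier R"
  shows "a [^] (\<Sum>i<d. card (carrier R) ^ i) = a [^] d"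
proof (induction d)
  case (Suc d)
  have "a [^] (\<Sum>i<Suc d. card (carrier R) ^ i) = a [^] (\<Sum>i<d. card (carrier R) ^ i) \<otimes> a [^] (card (carrier R) ^ d)"
    using assms by (simp add: nat_pow_mult)
  then show ?case using Suc.IH pow_card_pow_eq[OF assms] by simp
qed simp

end

section \<open>Monic residues and Gauss's lemma\<close>

text \<open>
  For \<open>c \<noteq> 0\<close>, the nonzero polynomials of degree less than \<open>d\<close> with leading coefficient \<open>c\<close>. Polynomials are
  lists with the leading coefficient first, so the coefficients after the first one are arbitrary.
\<close>

definition (in ring) polys_with_lead :: "'a \<Rightarrow> nat \<Rightarrow> 'a list set" where
  "polys_with_lead c d = {c # xs | xs. set xs \<subseteq> carrier R \<and> length xs < d}"

abbreviation (in ring) monics :: "nat \<Rightarrow> 'a list set" where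
  "monics \<equiv> polys_with_lead \<one>"

text \<open>
  The product in Gauss's lemma: for \<open>P\<close> irreducible and not dividing \<open>\<alpha>\<close>, multiplication by \<open>\<alpha>\<close> modulo \<open>P\<close>
  permutes the monic residues up to scalars, and these scalars are multiplied together.
\<close>

definition (in ring) gauss_symbol :: "'a list \<Rightarrow> 'a list \<Rightarrow> 'a" where
  "gauss_symbol \<alpha> P = finprod R (\<lambda>M. lead_coeff ((\<alpha> \<otimes>\<^bsub>poly_ring R\<^esub> M) pmod P)) (monics (degree P))"

lemma (in ring) polys_with_lead_Suc:
  "polys_with_lead c (Suc d) = polys_with_lead c d \<union> (Cons c) ` {xs. set xs \<subseteq> carrier R \<and> length xs = d}"
  unfolding polys_with_lead_def by (auto simp: less_Suc_eq)

lemma (in ring) finite_polys_with_lead: 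
  assumes "finite (carrier R)" shows "finite (polys_with_lead c d)"
proof (induction d)
  case 0 then show ?case by (simp add: polys_with_lead_def)
next
  case (Suc d) then show ?case
    unfolding polys_with_lead_Suc using finite_lists_length_eq[OF assms] by simp
qed

lemma (in ring) card_polys_with_lead:
  assumes "finite (carrier R)"
  shows "card (polys_with_lead c d) = (\<Sum>i<d. card (carrier R) ^ i)"
proof (induction d)
  case 0 then show ?case by (simp add: polys_with_lead_def)
next
  case (Suc d)
  have "card (polys_with_lead c (Suc d)) = card (polys_with_lead c d) + card ((Cons c) ` {xs. set xs \<subseteq> carrier R \<and> length xs = d})"
    unfolding polys_with_lead_Suc
    by (rule card_Un_disjoint) (use finite_polys_with_lead[OF assms] finite_lists_length_eq[OF assms] in \<open>auto simp: polys_with_lead_def\<close>)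
  then show ?case using Suc.IH card_lists_length_eq[OF assms] by (simp add: card_image)
qed

context field
begin

lemma polys_with_lead_iff:
  assumes "c \<in> carrier R - {\<zero>}"
  shows "M \<in> polys_with_lead c d \<longleftrightarrow>
    M \<in> carrier (poly_ring R) \<and> M \<noteq> [] \<and> lead_coeff M = c \<and> degree M < d"
proof (cases M)
  case (Cons a xs)
  then show ?thesis using assms
    by (auto simp: polys_with_lead_def univ_poly_carrier[symmetric] polynomial_def)
qed (auto simp: polys_with_lead_def)

lemmas monics_iff = polys_with_lead_iff[of \<one>, simplified]

lemma pmult_degree:
  assumes "p \<in> carrier (poly_ring R)" "q \<in> carrier (poly_ring R)" "p \<noteq> []" "q \<noteq> []"
  shows "p \<otimes>\<^bsub>poly_ring R\<^esub> q \<noteq> []" "degree (p \<otimes>\<^bsub>poly_ring R\<^esub> q) = degree p + degree q"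
    "lead_coeff (p \<otimes>\<^bsub>poly_ring R\<^esub> q) = lead_coeff p \<otimes> lead_coeff q"
proof -
  have "polynomial (carrier R) p" "polynomial (carrier R) q" using assms by (auto simp: univ_poly_carrier)
  note pol = this
  show "p \<otimes>\<^bsub>poly_ring R\<^esub> q \<noteq> []"
    using poly_mult_integral[OF carrier_is_subring pol] assms by (auto simp: univ_poly_mult)
  show "degree (p \<otimes>\<^bsub>poly_ring R\<^esub> q) = degree p + degree q"
    using poly_mult_degree_eq[OF carrier_is_subring pol] assms by (simp add: univ_poly_mult)
  show "lead_coeff (p \<otimes>\<^bsub>poly_ring R\<^esub> q) = lead_coeff p \<otimes> lead_coeff q"
    using poly_mult_lead_coeff[OF carrier_is_subring pol] assms by (simp add: univ_poly_mult)
qed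

lemma padd_degree:
  assumes "p \<in> carrier (poly_ring R)" "q \<in> carrier (poly_ring R)" "p \<noteq> []" "q = [] \<or> degree q < degree p"
  shows "p \<oplus>\<^bsub>poly_ring R\<^esub> q \<noteq> []" "degree (p \<oplus>\<^bsub>poly_ring R\<^esub> q) = degree p"
    "lead_coeff (p \<oplus>\<^bsub>poly_ring R\<^esub> q) = lead_coeff p"
proof -
  let ?s = "p \<oplus>\<^bsub>poly_ring R\<^esub> q"
  have pol: "polynomial (carrier R) p" "polynomial (carrier R) q"
    using assms by (auto simp: univ_poly_carrier)
  have len: "length q < length p" using assms by (cases q; cases p) auto
  then have l: "length ?s = length p"
    using poly_add_length_eq[OF carrier_is_subring pol] by (simp add: univ_poly_add)
  then show "?s \<noteq> []" "degree ?s = degree p" using assms by auto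
  have "lead_coeff ?s = coeff ?s (degree ?s)" using lead_coeff_simp[OF \<open>?s \<noteq> []\<close>] by (rule sym)
  also have "\<dots> = coeff p (degree p) \<oplus> coeff q (degree p)"
    using poly_add_coeff[of p q] pol polynomial_in_carrier[OF carrier_is_subring] l
    by (simp add: univ_poly_add)
  also have "\<dots> = lead_coeff p"
  proof -
    have "coeff q (degree p) = \<zero>" using len by (intro coeff_length) simp
    moreover have "lead_coeff p \<in> carrier R"
      using pol(1) assms(3) by (cases p) (auto simp: polynomial_def)
    ultimately show ?thesis using lead_coeff_simp[OF assms(3)] by simp
  qed
  finally show "lead_coeff ?s = lead_coeff p" .
qed

lemma lead_coeff_nonzero: "p \<in> carrier (poly_ring R) \<Longrightarrow> p \<noteq> [] \<Longrightarrow> lead_coeff p \<in> carrier R - {\<zero>}"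
  by (cases p) (auto simp: univ_poly_carrier[symmetric] polynomial_def)

lemma pminus_degree:
  assumes "p \<in> carrier (poly_ring R)"
  shows "degree (\<ominus>\<^bsub>poly_ring R\<^esub> p) = degree p" "\<ominus>\<^bsub>poly_ring R\<^esub> p = [] \<longleftrightarrow> p = []"
    "p \<noteq> [] \<Longrightarrow> lead_coeff (\<ominus>\<^bsub>poly_ring R\<^esub> p) = \<ominus> lead_coeff p"
  using univ_poly_a_inv_def'[OF carrier_is_subring assms]
  by (auto simp: hd_map)

lemma pconst:
  assumes "c \<in> carrier R - {\<zero>}"
  shows "poly_of_const c = [c]" "[c] \<in> carrier (poly_ring R)"
  using assms by (auto simp: poly_of_const_def univ_poly_carrier[symmetric] polynomial_def)

lemma pconst_closed: "c \<in> carrier R \<Longrightarrow> poly_of_const c \<in> carrier (poly_ring R)"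
  using canonical_embedding_is_hom[OF carrier_is_subring] by (auto simp: ring_hom_def)

lemma pconst_hom: "ring_hom_ring R (poly_ring R) poly_of_const"
  using canonical_embedding_ring_hom[OF carrier_is_subring] by simp

text \<open>Constants are determined by their residue modulo a polynomial of positive degree.\<close>

lemma pconst_cong_imp_eq:
  assumes P: "P \<in> carrier (poly_ring R)" "degree P > 0"
    and ab: "a \<in> carrier R" "b \<in> carrier R"
    and "P pdivides (poly_of_const a \<ominus>\<^bsub>poly_ring R\<^esub> poly_of_const b)"
  shows "a = b"
proof (rule ccontr)
  assume "a \<noteq> b"
  interpret h: ring_hom_ring R "poly_ring R" poly_of_const by (rule pconst_hom)
  have "poly_of_const a \<ominus>\<^bsub>poly_ring R\<^esub> poly_of_const b = poly_of_const (a \<ominus> b)"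
    using ab by (simp add: a_minus_def)
  moreover have "a \<ominus> b \<in> carrier R - {\<zero>}" using ab \<open>a \<noteq> b\<close> by auto
  ultimately have "P pdivides [a \<ominus> b]" "[a \<ominus> b] \<in> carrier (poly_ring R)"
    using pconst assms(5) by auto
  then have "degree P \<le> degree [a \<ominus> b]"
    using pdivides_imp_degree_le[OF carrier_is_subring P(1)] by blast
  then show False using P(2) by simp
qed

lemma rupture_eq_iff:
  assumes "P \<in> carrier (poly_ring R)" "a \<in> carrier (poly_ring R)" "b \<in> carrier (poly_ring R)"
  shows "rupture_surj (carrier R) P a = rupture_surj (carrier R) P b \<longleftrightarrow>
    P pdivides (a \<ominus>\<^bsub>poly_ring R\<^esub> b)"
proof -
  interpret UP: domain "poly_ring R" by (rule univ_poly_is_domain[OF carrier_is_subring])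
  have I: "ideal (PIdl\<^bsub>poly_ring R\<^esub> P) (poly_ring R)" by (rule UP.cgenideal_ideal[OF assms(1)])
  have "rupture_surj (carrier R) P a = rupture_surj (carrier R) P b \<longleftrightarrow>
    a \<ominus>\<^bsub>poly_ring R\<^esub> b \<in> PIdl\<^bsub>poly_ring R\<^esub> P"
    using UP.quotient_eq_iff_same_a_r_cos[OF I assms(2,3)] by simp
  also have "\<dots> \<longleftrightarrow> P pdivides (a \<ominus>\<^bsub>poly_ring R\<^esub> b)"
    unfolding pdivides_def factor_def cgenideal_def mem_Collect_eq
    using UP.m_comm[OF _ assms(1)] by metis
  finally show ?thesis .
qed

lemma pprime_mult:
  assumes "P \<in> carrier (poly_ring R)" "pirreducible (carrier R) P"
    and "a \<in> carrier (poly_ring R)" "b \<in> carrier (poly_ring R)"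
  shows "P pdivides (a \<otimes>\<^bsub>poly_ring R\<^esub> b) \<longleftrightarrow> P pdivides a \<or> P pdivides b"
proof
  assume "P pdivides (a \<otimes>\<^bsub>poly_ring R\<^esub> b)"
  then show "P pdivides a \<or> P pdivides b"
    using pprimeE(3)[OF carrier_is_subfield assms(1)] pprime_iff_pirreducible[OF carrier_is_subfield assms(1)] assms by blast
next
  interpret UP: domain "poly_ring R" by (rule univ_poly_is_domain[OF carrier_is_subring])
  assume "P pdivides a \<or> P pdivides b"
  then show "P pdivides (a \<otimes>\<^bsub>poly_ring R\<^esub> b)"
    unfolding pdivides_def using assms UP.divides_prod_r UP.divides_prod_l UP.m_comm by metis
qed

lemma not_pdivides_small:
  assumes "P \<in> carrier (poly_ring R)" "M \<in> carrier (poly_ring R)" "M \<noteq> []" "degree M < degree P"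
  shows "\<not> P pdivides M"
  using pdivides_imp_degree_le[OF carrier_is_subring assms(1,2,3)] assms(4) by auto

text \<open>Multiplying a monic residue by \<open>\<alpha>\<close> modulo \<open>P\<close> gives a scalar times a monic residue.\<close>

lemma monic_residueE:
  assumes P: "P \<in> carrier (poly_ring R)" "pirreducible (carrier R) P"
    and \<alpha>: "\<alpha> \<in> carrier (poly_ring R)" "\<not> P pdivides \<alpha>"
    and M: "M \<in> monics (degree P)"
  defines "r \<equiv> (\<alpha> \<otimes>\<^bsub>poly_ring R\<^esub> M) pmod P"
  shows "r \<in> carrier (poly_ring R)" "r \<noteq> []" "degree r < degree P"
    "lead_coeff r \<in> carrier R - {\<zero>}"
    "P pdivides ((\<alpha> \<otimes>\<^bsub>poly_ring R\<^esub> M) \<ominus>\<^bsub>poly_ring R\<^esub> r)"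
proof -
  interpret UP: domain "poly_ring R" by (rule univ_poly_is_domain[OF carrier_is_subring])
  have M': "M \<in> carrier (poly_ring R)" "M \<noteq> []" "degree M < degree P" using M monics_iff by auto
  have aM: "\<alpha> \<otimes>\<^bsub>poly_ring R\<^esub> M \<in> carrier (poly_ring R)" using M' \<alpha> by simp
  show rc: "r \<in> carrier (poly_ring R)" unfolding r_def
    by (rule long_division_closed[OF carrier_is_subfield aM P(1)])
  have "\<not> P pdivides (\<alpha> \<otimes>\<^bsub>poly_ring R\<^esub> M)"
    using pprime_mult[OF P \<alpha>(1) M'(1)] not_pdivides_small[OF P(1) M'] \<alpha>(2) by blast
  then show "r \<noteq> []"
    unfolding r_def using pmod_zero_iff_pdivides[OF carrier_is_subfield aM P(1)] by simp
  have "P \<noteq> []" using pirreducibleE(1)[OF carrier_is_subring P] .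
  then show "degree r < degree P" using \<open>r \<noteq> []\<close> pmod_degree[OF carrier_is_subfield aM P(1)]
    unfolding r_def by auto
  show "lead_coeff r \<in> carrier R - {\<zero>}" by (rule lead_coeff_nonzero[OF rc \<open>r \<noteq> []\<close>])
  define q where "q = (\<alpha> \<otimes>\<^bsub>poly_ring R\<^esub> M) pdiv P"
  have q: "q \<in> carrier (poly_ring R)"
    unfolding q_def by (rule long_division_closed[OF carrier_is_subfield aM P(1)])
  have eq: "\<alpha> \<otimes>\<^bsub>poly_ring R\<^esub> M = (P \<otimes>\<^bsub>poly_ring R\<^esub> q) \<oplus>\<^bsub>poly_ring R\<^esub> r"
    unfolding r_def q_def by (rule pdiv_pmod[OF carrier_is_subfield aM P(1)])
  have "(x \<oplus>\<^bsub>poly_ring R\<^esub> r) \<ominus>\<^bsub>poly_ring R\<^esub> r = x" if "x \<in> carrier (poly_ring R)" for x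
    using that rc by (simp add: UP.minus_eq UP.a_assoc UP.r_neg)
  then have "(\<alpha> \<otimes>\<^bsub>poly_ring R\<^esub> M) \<ominus>\<^bsub>poly_ring R\<^esub> r = P \<otimes>\<^bsub>poly_ring R\<^esub> q"
    using eq q P by simp
  then show "P pdivides ((\<alpha> \<otimes>\<^bsub>poly_ring R\<^esub> M) \<ominus>\<^bsub>poly_ring R\<^esub> r)"
    unfolding pdivides_def factor_def using q by auto
qed

lemma gauss_symbol_nonzero:
  assumes "P \<in> carrier (poly_ring R)" "pirreducible (carrier R) P"
    and "\<alpha> \<in> carrier (poly_ring R)" "\<not> P pdivides \<alpha>"
  shows "gauss_symbol \<alpha> P \<in> carrier R - {\<zero>}"
  unfolding gauss_symbol_def
  by (rule nonzero_finprod) (use monic_residueE(4)[OF assms] in auto)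

text \<open>
  Gauss's lemma. The exponent of \<open>\<alpha>\<close> is the number of monic residues. The proof takes place in the residue field
  modulo \<open>P\<close>, where the product of the monic residues is nonzero and can be cancelled.
\<close>

lemma gauss_symbol_cong:
  assumes fin: "finite (carrier R)"
    and P: "P \<in> carrier (poly_ring R)" "pirreducible (carrier R) P"
    and \<alpha>: "\<alpha> \<in> carrier (poly_ring R)" "\<not> P pdivides \<alpha>"
  shows "P pdivides (\<alpha> [^]\<^bsub>poly_ring R\<^esub> (\<Sum>i<degree P. card (carrier R) ^ i)
           \<ominus>\<^bsub>poly_ring R\<^esub> poly_of_const (gauss_symbol \<alpha> P))"
proof -
  interpret UP: domain "poly_ring R" by (rule univ_poly_is_domain[OF carrier_is_subring])
  let ?K = "Rupt (carrier R) P"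
  interpret K: field ?K using rupture_is_field_iff_pirreducible[OF carrier_is_subfield P(1)] P(2) by simp
  let ?h = "rupture_surj (carrier R) P"
  interpret h: ring_hom_cring "poly_ring R" ?K ?h
    using rupture_surj_hom(1)[OF carrier_is_subring P(1)] by unfold_locales
  interpret c: ring_hom_ring R "poly_ring R" poly_of_const by (rule pconst_hom)
  interpret c: ring_hom_cring R "poly_ring R" poly_of_const by unfold_locales (rule c.homh)
  let ?A = "monics (degree P)"
  define r where "r M = (\<alpha> \<otimes>\<^bsub>poly_ring R\<^esub> M) pmod P" for M
  define l where "l M = lead_coeff (r M)" for M
  \<comment> \<open>The monic residue \<open>\<sigma> M\<close> with \<open>\<alpha> M \<equiv> l M \<cdot> \<sigma> M\<close>.\<close>
  define \<sigma> where "\<sigma> M = [inv (l M)] \<otimes>\<^bsub>poly_ring R\<^esub> r M" for M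
  note res = monic_residueE[OF P \<alpha>, folded r_def, folded l_def]
  have finA: "finite ?A" by (rule finite_polys_with_lead[OF fin])
  have MA: "M \<in> carrier (poly_ring R)" "M \<noteq> []" "lead_coeff M = \<one>" "degree M < degree P" if "M \<in> ?A" for M
    using that monics_iff by auto
  have linv: "inv (l M) \<in> carrier R - {\<zero>}" "l M \<otimes> inv (l M) = \<one>" "inv (l M) \<otimes> l M = \<one>" if "M \<in> ?A" for M
    using res(4)[OF that] field_Units Units_inv_Units[of "l M"] by auto
  have \<sigma>: "\<sigma> M \<in> ?A" if "M \<in> ?A" for M
    using pmult_degree[OF pconst(2)[OF linv(1)[OF that]] res(1)[OF that] _ res(2)[OF that]]
      res(1,3,4)[OF that] linv[OF that] pconst(2)[OF linv(1)[OF that]]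
    unfolding monics_iff \<sigma>_def l_def by simp
  have r\<sigma>: "r M = [l M] \<otimes>\<^bsub>poly_ring R\<^esub> \<sigma> M" if "M \<in> ?A" for M
  proof -
    have "[l M] \<otimes>\<^bsub>poly_ring R\<^esub> [inv (l M)] = poly_of_const (l M \<otimes> inv (l M))"
      using pconst(1)[OF linv(1)[OF that]] pconst(1)[OF res(4)[OF that]] linv(1)[OF that] res(4)[OF that]
        c.hom_mult[of "l M" "inv (l M)"] by auto
    also have "\<dots> = \<one>\<^bsub>poly_ring R\<^esub>" using linv(2)[OF that] by simp
    finally show ?thesis
      using res(1)[OF that] pconst(2)[OF linv(1)[OF that]] pconst(2)[OF res(4)[OF that]]
      unfolding \<sigma>_def by (simp add: UP.m_assoc[symmetric])
  qed
  have hM: "?h \<alpha> \<otimes>\<^bsub>?K\<^esub> ?h M = ?h (poly_of_const (l M)) \<otimes>\<^bsub>?K\<^esub> ?h (\<sigma> M)" if "M \<in> ?A" for M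
  proof -
    have "?h (\<alpha> \<otimes>\<^bsub>poly_ring R\<^esub> M) = ?h (r M)"
      using rupture_eq_iff[OF P(1), of "\<alpha> \<otimes>\<^bsub>poly_ring R\<^esub> M" "r M"] res(1,5)[OF that] \<alpha>(1) MA[OF that] by simp
    then show ?thesis
      using \<alpha>(1) MA[OF that] MA[OF \<sigma>[OF that]] r\<sigma>[OF that] pconst[OF res(4)[OF that]] by simp
  qed
  have h_nz: "?h a \<noteq> \<zero>\<^bsub>?K\<^esub>" if "a \<in> carrier (poly_ring R)" "\<not> P pdivides a" for a
    using rupture_eq_iff[OF P(1), of a "\<zero>\<^bsub>poly_ring R\<^esub>"] that by (simp add: UP.minus_eq)
  have hM_nz: "?h M \<noteq> \<zero>\<^bsub>?K\<^esub>" if "M \<in> ?A" for M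
    using h_nz not_pdivides_small[OF P(1)] MA[OF that] by blast
  have inj: "inj_on \<sigma> ?A"
  proof (rule inj_onI)
    fix M N assume MN: "M \<in> ?A" "N \<in> ?A" and eq: "\<sigma> M = \<sigma> N"
    let ?p = "[l N] \<otimes>\<^bsub>poly_ring R\<^esub> M" and ?q = "[l M] \<otimes>\<^bsub>poly_ring R\<^esub> N"
    have carr: "[l N] \<in> carrier (poly_ring R)" "[l M] \<in> carrier (poly_ring R)" 
      "M \<in> carrier (poly_ring R)" "N \<in> carrier (poly_ring R)"
      using pconst res(4) MN MA by auto
    have pc: "poly_of_const (l M) = [l M]" "poly_of_const (l N) = [l N]"
      using pconst res(4) MN by auto
    have "?h \<alpha> \<otimes>\<^bsub>?K\<^esub> ?h ?p = ?h [l N] \<otimes>\<^bsub>?K\<^esub> (?h \<alpha> \<otimes>\<^bsub>?K\<^esub> ?h M)"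
      using carr \<alpha>(1) by (simp add: K.m_lcomm)
    also have "\<dots> = ?h [l N] \<otimes>\<^bsub>?K\<^esub> (?h [l M] \<otimes>\<^bsub>?K\<^esub> ?h (\<sigma> M))" using hM[OF MN(1)] pc by simp
    also have "\<dots> = ?h [l M] \<otimes>\<^bsub>?K\<^esub> (?h [l N] \<otimes>\<^bsub>?K\<^esub> ?h (\<sigma> N))"
      using carr MA[OF \<sigma>[OF MN(2)]] eq by (simp add: K.m_lcomm)
    also have "\<dots> = ?h [l M] \<otimes>\<^bsub>?K\<^esub> (?h \<alpha> \<otimes>\<^bsub>?K\<^esub> ?h N)" using hM[OF MN(2)] pc by simp
    also have "\<dots> = ?h \<alpha> \<otimes>\<^bsub>?K\<^esub> ?h ?q" using carr \<alpha>(1) by (simp add: K.m_lcomm)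
    finally have "?h ?p = ?h ?q"
      using K.m_lcancel[OF h_nz[OF \<alpha>]] \<alpha>(1) carr by simp
    then have div: "P pdivides (?p \<ominus>\<^bsub>poly_ring R\<^esub> ?q)"
      using rupture_eq_iff[OF P(1), of ?p ?q] UP.m_closed carr by blast
    have dp: "degree ?p < degree P" "degree ?q < degree P" "lead_coeff ?p = l N" "lead_coeff ?q = l M"
      using pmult_degree[OF carr(1,3)] pmult_degree[OF carr(2,4)] MA MN res(4) by auto
    have "?p pmod P = ?q pmod P"
      using same_pmod_iff_pdivides[OF carrier_is_subfield _ _ P(1)] div carr by simp
    then have pq: "?p = ?q"
      using pmod_const(2)[OF carrier_is_subfield _ P(1)] dp carr by simp
    then have "l N = l M" using dp by simp
    then have "[l M] \<otimes>\<^bsub>poly_ring R\<^esub> M = [l M] \<otimes>\<^bsub>poly_ring R\<^esub> N" using pq by simp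
    then show "M = N" using UP.m_lcancel[of "[l M]" M N] carr by (simp add: univ_poly_zero)
  qed
  have img: "\<sigma> ` ?A = ?A" by (rule endo_inj_surj[OF finA _ inj]) (use \<sigma> in auto)
  let ?H = "finprod ?K ?h ?A"
  have Hc: "?H \<in> carrier ?K" "?H \<noteq> \<zero>\<^bsub>?K\<^esub>"
    using K.nonzero_finprod[of ?h ?A] hM_nz MA by auto
  have "?h (\<alpha> [^]\<^bsub>poly_ring R\<^esub> card ?A) \<otimes>\<^bsub>?K\<^esub> ?H = finprod ?K (\<lambda>M. ?h \<alpha> \<otimes>\<^bsub>?K\<^esub> ?h M) ?A"
    using \<alpha>(1) MA by (subst K.finprod_multf) (auto simp: K.finprod_const)
  also have "\<dots> = finprod ?K (\<lambda>M. ?h (poly_of_const (l M)) \<otimes>\<^bsub>?K\<^esub> ?h (\<sigma> M)) ?A"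
    by (rule K.finprod_cong') (use hM \<sigma> MA res(4) pconst_closed in auto)
  also have "\<dots> = finprod ?K (\<lambda>M. ?h (poly_of_const (l M))) ?A \<otimes>\<^bsub>?K\<^esub> finprod ?K (\<lambda>M. ?h (\<sigma> M)) ?A"
    by (rule K.finprod_multf) (use \<sigma> MA res(4) pconst_closed in auto)
  also have "finprod ?K (\<lambda>M. ?h (\<sigma> M)) ?A = ?H"
  proof -
    have "finprod ?K ?h (\<sigma> ` ?A) = finprod ?K (\<lambda>M. ?h (\<sigma> M)) ?A"
      by (rule K.finprod_reindex[OF _ inj]) (use MA \<sigma> in auto)
    then show ?thesis unfolding img by (rule sym)
  qed
  also have "finprod ?K (\<lambda>M. ?h (poly_of_const (l M))) ?A = ?h (poly_of_const (gauss_symbol \<alpha> P))"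
  proof -
    have "gauss_symbol \<alpha> P = finprod R l ?A" unfolding gauss_symbol_def l_def r_def ..
    moreover have "l \<in> ?A \<rightarrow> carrier R" "poly_of_const \<circ> l \<in> ?A \<rightarrow> carrier (poly_ring R)"
      using res(4) pconst_closed by auto
    ultimately show ?thesis
      using c.hom_finprod[of l ?A] h.hom_finprod[of "poly_of_const \<circ> l" ?A] by (simp add: o_def)
  qed
  finally have "?h (\<alpha> [^]\<^bsub>poly_ring R\<^esub> card ?A) = ?h (poly_of_const (gauss_symbol \<alpha> P))"
    using K.m_rcancel[OF Hc(2,1)] \<alpha>(1) pconst_closed gauss_symbol_nonzero[OF P \<alpha>] by simp
  then have "P pdivides (\<alpha> [^]\<^bsub>poly_ring R\<^esub> card ?A \<ominus>\<^bsub>poly_ring R\<^esub> poly_of_const (gauss_symbol \<alpha> P))"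
    using rupture_eq_iff[OF P(1)] UP.nat_pow_closed[OF \<alpha>(1)] pconst_closed gauss_symbol_nonzero[OF P \<alpha>]
    by blast
  then show ?thesis unfolding card_polys_with_lead[OF fin] .
qed

lemma gauss_symbol_pow_cong:
  assumes fin: "finite (carrier R)"
    and P: "P \<in> carrier (poly_ring R)" "pirreducible (carrier R) P"
    and \<alpha>: "\<alpha> \<in> carrier (poly_ring R)" "\<not> P pdivides \<alpha>"
  shows "P pdivides (\<alpha> [^]\<^bsub>poly_ring R\<^esub> ((\<Sum>i<degree P. card (carrier R) ^ i) * k)
           \<ominus>\<^bsub>poly_ring R\<^esub> poly_of_const (gauss_symbol \<alpha> P [^] k))"
proof -
  interpret UP: domain "poly_ring R" by (rule univ_poly_is_domain[OF carrier_is_subring])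
  let ?h = "rupture_surj (carrier R) P"
  interpret h: ring_hom_ring "poly_ring R" "Rupt (carrier R) P" ?h
    by (rule rupture_surj_hom(2)[OF carrier_is_subring P(1)])
  interpret c: ring_hom_ring R "poly_ring R" poly_of_const by (rule pconst_hom)
  define m where "m = (\<Sum>i<degree P. card (carrier R) ^ i)"
  note G = gauss_symbol_nonzero[OF P \<alpha>]
  have cG: "poly_of_const (gauss_symbol \<alpha> P) \<in> carrier (poly_ring R)" using G pconst_closed by simp
  have "?h (\<alpha> [^]\<^bsub>poly_ring R\<^esub> m) = ?h (poly_of_const (gauss_symbol \<alpha> P))"
    using rupture_eq_iff[OF P(1)] gauss_symbol_cong[OF fin P \<alpha>] \<alpha>(1) cG UP.nat_pow_closed
    unfolding m_def by blast
  then have "?h ((\<alpha> [^]\<^bsub>poly_ring R\<^esub> m) [^]\<^bsub>poly_ring R\<^esub> k) =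
      ?h (poly_of_const (gauss_symbol \<alpha> P) [^]\<^bsub>poly_ring R\<^esub> k)"
    using \<alpha>(1) cG UP.nat_pow_closed by (metis h.hom_nat_pow)
  moreover have "(\<alpha> [^]\<^bsub>poly_ring R\<^esub> m) [^]\<^bsub>poly_ring R\<^esub> k = \<alpha> [^]\<^bsub>poly_ring R\<^esub> (m * k)"
    using \<alpha>(1) by (rule UP.nat_pow_pow)
  moreover have "poly_of_const (gauss_symbol \<alpha> P) [^]\<^bsub>poly_ring R\<^esub> k = poly_of_const (gauss_symbol \<alpha> P [^] k)"
    using G by (simp add: c.hom_nat_pow)
  ultimately have "?h (\<alpha> [^]\<^bsub>poly_ring R\<^esub> (m * k)) = ?h (poly_of_const (gauss_symbol \<alpha> P [^] k))" by simp
  then show ?thesis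
    using rupture_eq_iff[OF P(1)] UP.nat_pow_closed[OF \<alpha>(1)] pconst_closed G nat_pow_closed
    unfolding m_def by blast
qed

lemma pconst_cong_unique:
  assumes P: "P \<in> carrier (poly_ring R)" "degree P > 0" and x: "x \<in> carrier (poly_ring R)"
    and ab: "a \<in> carrier R" "b \<in> carrier R"
    and "P pdivides (x \<ominus>\<^bsub>poly_ring R\<^esub> poly_of_const a)" "P pdivides (x \<ominus>\<^bsub>poly_ring R\<^esub> poly_of_const b)"
  shows "a = b"
proof (rule pconst_cong_imp_eq[OF P ab])
  show "P pdivides (poly_of_const a \<ominus>\<^bsub>poly_ring R\<^esub> poly_of_const b)"
    using assms rupture_eq_iff[OF P(1)] pconst_closed by metis
qed

end

section \<open>Reciprocity over a finite field\<close>

context field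
begin

lemma small_nonzero_eq_UN:
  "{E \<in> carrier (poly_ring R). length E \<le> k} - {[]} = (\<Union>c\<in>carrier R - {\<zero>}. polys_with_lead c k)"
proof -
  have "E \<in> carrier (poly_ring R) \<and> length E \<le> k \<and> E \<noteq> [] \<longleftrightarrow> (\<exists>c\<in>carrier R - {\<zero>}. E \<in> polys_with_lead c k)" for E
  proof (cases E)
    case (Cons a xs)
    then show ?thesis
      by (auto simp: polys_with_lead_def univ_poly_carrier[symmetric] polynomial_def)
  qed (auto simp: polys_with_lead_def)
  then show ?thesis by blast
qed

text \<open>
  Grouped by leading coefficient \<open>c\<close>, the product is that of the powers of \<open>c\<close> with exponent
  \<open>1 + q + \<dots> + q^(k-1)\<close>, which Wilson's theorem evaluates.
\<close>

lemma finprod_lead_coeff_small: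
  assumes "finite (carrier R)"
  shows "finprod R lead_coeff ({E \<in> carrier (poly_ring R). length E \<le> k} - {[]}) = (\<ominus> \<one>) [^] k"
proof -
  let ?m = "\<Sum>i<k. card (carrier R) ^ i"
  have lc: "lead_coeff E = c" if "E \<in> polys_with_lead c k" for E c
    using that by (auto simp: polys_with_lead_def)
  have "finprod R lead_coeff (\<Union>c\<in>carrier R - {\<zero>}. polys_with_lead c k) =
    finprod R (\<lambda>c. finprod R lead_coeff (polys_with_lead c k)) (carrier R - {\<zero>})"
  proof (rule finprod_UN_disjoint)
    show "pairwise (\<lambda>c c'. disjnt (polys_with_lead c k) (polys_with_lead c' k)) (carrier R - {\<zero>})"
      unfolding pairwise_def disjnt_iff using lc by metis
    show "lead_coeff E \<in> carrier R" if "c \<in> carrier R - {\<zero>}" "E \<in> polys_with_lead c k" for c E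
      using that lc by auto
  qed (use assms finite_polys_with_lead in auto)
  also have "\<dots> = finprod R (\<lambda>c. c [^] ?m) (carrier R - {\<zero>})"
  proof (rule finprod_cong')
    fix c assume c: "c \<in> carrier R - {\<zero>}"
    have "finprod R lead_coeff (polys_with_lead c k) = finprod R (\<lambda>_. c) (polys_with_lead c k)"
      by (rule finprod_cong') (use lc c in auto)
    then show "finprod R lead_coeff (polys_with_lead c k) = c [^] ?m"
      using c by (simp add: finprod_const card_polys_with_lead[OF assms])
  qed auto
  also have "\<dots> = finprod R (\<lambda>c. c [^] k) (carrier R - {\<zero>})"
    by (rule finprod_cong') (use pow_geometric_eq[OF assms] in auto)
  also have "\<dots> = finprod R (\<lambda>c. c) (carrier R - {\<zero>}) [^] k"
    using finprod_nat_pow[of "\<lambda>c. c" "carrier R - {\<zero>}" k] by (simp add: Pi_def)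
  finally show ?thesis using finprod_nonzero_elements[OF assms] by (simp add: small_nonzero_eq_UN)
qed

text \<open>
  The monic \<open>M\<close> with \<open>deg P - deg Q \<le> deg M < deg P\<close> are the polynomials \<open>t + E\<close>, where \<open>t\<close> is the
  quotient of \<open>P N\<close> by \<open>Q\<close> for some monic \<open>N\<close> with \<open>deg N < deg Q\<close> and \<open>deg E < deg P - deg Q\<close>. The
  remainder of \<open>Q M\<close> modulo \<open>P\<close> is then \<open>Q E\<close> minus the remainder of \<open>P N\<close> modulo \<open>Q\<close>, so its leading
  coefficient is that of \<open>E\<close>, except for \<open>E = 0\<close>.
\<close>

lemma gauss_symbol_reciprocity_aux:
  assumes fin: "finite (carrier R)"
    and P: "P \<in> carrier (poly_ring R)" "pirreducible (carrier R) P" "lead_coeff P = \<one>"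
    and Q: "Q \<in> carrier (poly_ring R)" "pirreducible (carrier R) Q" "lead_coeff Q = \<one>"
    and nPQ: "\<not> P pdivides Q" and nQP: "\<not> Q pdivides P" and le: "degree Q \<le> degree P"
  shows "gauss_symbol Q P = (\<ominus> \<one>) [^] (degree P * degree Q) \<otimes> gauss_symbol P Q"
proof -
  interpret UP: domain "poly_ring R" by (rule univ_poly_is_domain[OF carrier_is_subring])
  let ?C = "carrier (poly_ring R)"
  let ?d = "degree P" and ?e = "degree Q"
  define k where "k = ?d - ?e"
  have kde: "?d = k + ?e" using le unfolding k_def by simp
  define r where "r N = (P \<otimes>\<^bsub>poly_ring R\<^esub> N) pmod Q" for N
  define t where "t N = (P \<otimes>\<^bsub>poly_ring R\<^esub> N) pdiv Q" for N
  define g where "g M = lead_coeff ((Q \<otimes>\<^bsub>poly_ring R\<^esub> M) pmod P)" for M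
  \<comment> \<open>The parametrization \<open>(N, E) \<mapsto> t N + E\<close> of the monic \<open>M\<close> with \<open>k \<le> deg M < deg P\<close>.\<close>
  define \<phi> where "\<phi> N E = t N \<oplus>\<^bsub>poly_ring R\<^esub> E" for N E
  let ?small = "{E \<in> ?C. length E \<le> k}"
  note rN = monic_residueE[OF Q(1,2) P(1) nQP, folded r_def]
  note gN = monic_residueE[OF P(1,2) Q(1) nPQ, folded g_def]
  have ne: "P \<noteq> []" "Q \<noteq> []"
    using pirreducibleE(1)[OF carrier_is_subring P(1,2)] pirreducibleE(1)[OF carrier_is_subring Q(1,2)] .
  have mon: "N \<in> ?C" "N \<noteq> []" "lead_coeff N = \<one>" "degree N < m" if "N \<in> monics m" for N m
    using that monics_iff by auto
  have tC: "t N \<in> ?C" if "N \<in> ?C" for N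
    unfolding t_def using long_division_closed(1)[OF carrier_is_subfield _ Q(1)] that P(1) by simp
  have rC: "r N \<in> ?C" if "N \<in> ?C" for N
    unfolding r_def using long_division_closed(2)[OF carrier_is_subfield _ Q(1)] that P(1) by simp
  have PN: "P \<otimes>\<^bsub>poly_ring R\<^esub> N = Q \<otimes>\<^bsub>poly_ring R\<^esub> t N \<oplus>\<^bsub>poly_ring R\<^esub> r N" if "N \<in> ?C" for N
    unfolding t_def r_def using pdiv_pmod[OF carrier_is_subfield _ Q(1)] that P(1) by simp
  have Qt: "P \<otimes>\<^bsub>poly_ring R\<^esub> N \<ominus>\<^bsub>poly_ring R\<^esub> r N = Q \<otimes>\<^bsub>poly_ring R\<^esub> t N" if "N \<in> ?C" for N
    by (rule UP.add_eq_imp_minus_eq[OF PN]) (use that tC rC Q in auto)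
  have tN: "t N \<noteq> []" "lead_coeff (t N) = \<one>" "degree (t N) = k + degree N" if N: "N \<in> monics ?e" for N
  proof -
    note m = mon[OF N]
    note PNd = pmult_degree[OF P(1) m(1) ne(1) m(2)]
    have "\<ominus>\<^bsub>poly_ring R\<^esub> r N \<in> ?C" "degree (\<ominus>\<^bsub>poly_ring R\<^esub> r N) < degree (P \<otimes>\<^bsub>poly_ring R\<^esub> N)"
      using pminus_degree(1)[OF rC[OF m(1)]] rC[OF m(1)] rN(3)[OF N] PNd le by auto
    then have Qtd: "Q \<otimes>\<^bsub>poly_ring R\<^esub> t N \<noteq> []" "degree (Q \<otimes>\<^bsub>poly_ring R\<^esub> t N) = ?d + degree N"
      "lead_coeff (Q \<otimes>\<^bsub>poly_ring R\<^esub> t N) = \<one>"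
      using padd_degree[of "P \<otimes>\<^bsub>poly_ring R\<^esub> N" "\<ominus>\<^bsub>poly_ring R\<^esub> r N"] PNd P m Qt[OF m(1)]
      by (auto simp: UP.minus_eq)
    show tne: "t N \<noteq> []"
    proof
      assume "t N = []"
      then have "Q \<otimes>\<^bsub>poly_ring R\<^esub> t N = \<zero>\<^bsub>poly_ring R\<^esub>" using Q by (simp add: univ_poly_zero[symmetric, of R "carrier R"])
      then show False using Qtd(1) by (simp add: univ_poly_zero)
    qed
    note Qtd' = pmult_degree[OF Q(1) tC[OF m(1)] ne(2) tne]
    show "lead_coeff (t N) = \<one>" using Qtd' Qtd Q(3) lead_coeff_nonzero[OF tC[OF m(1)] tne] by simp
    show "degree (t N) = k + degree N" using Qtd'(2) Qtd(2) le unfolding k_def by linarith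
  qed
  have \<phi>: "\<phi> N E \<in> monics ?d" "k \<le> degree (\<phi> N E)" if N: "N \<in> monics ?e" and E: "E \<in> ?small" for N E
  proof -
    have *: "E = [] \<or> degree E < degree (t N)" using E tN[OF N] by (cases E) auto
    then show "\<phi> N E \<in> monics ?d" "k \<le> degree (\<phi> N E)"
      using padd_degree[OF tC[OF mon(1)[OF N]] _ tN(1)[OF N] *] E tN[OF N] mon[OF N] tC[OF mon(1)[OF N]]
      unfolding \<phi>_def monics_iff kde by auto
  qed
  \<comment> \<open>\<open>N\<close> is recovered from \<open>M = \<phi> N E\<close> as the quotient of \<open>Q M\<close> by \<open>P\<close>, so the parametrization is injective.\<close>
  have div\<phi>: "(Q \<otimes>\<^bsub>poly_ring R\<^esub> \<phi> N E) pdiv P = N \<and> g (\<phi> N E) = (if E = [] then \<ominus> lead_coeff (r N) else lead_coeff E)"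
    if N: "N \<in> monics ?e" and E: "E \<in> ?small" for N E
  proof -
    note m = mon[OF N]
    have EC: "E \<in> ?C" using E by simp
    let ?s = "Q \<otimes>\<^bsub>poly_ring R\<^esub> E \<ominus>\<^bsub>poly_ring R\<^esub> r N"
    have nr: "\<ominus>\<^bsub>poly_ring R\<^esub> r N \<in> ?C" "\<ominus>\<^bsub>poly_ring R\<^esub> r N \<noteq> []" "degree (\<ominus>\<^bsub>poly_ring R\<^esub> r N) < ?e"
      "lead_coeff (\<ominus>\<^bsub>poly_ring R\<^esub> r N) = \<ominus> lead_coeff (r N)"
      using pminus_degree[OF rC[OF m(1)]] rC[OF m(1)] rN[OF N] by auto
    have s: "?s \<in> ?C" "degree ?s < ?d" "lead_coeff ?s = (if E = [] then \<ominus> lead_coeff (r N) else lead_coeff E)"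
    proof -
      show "?s \<in> ?C" using Q EC rC m by simp
      have "degree ?s < ?d \<and> lead_coeff ?s = (if E = [] then \<ominus> lead_coeff (r N) else lead_coeff E)"
      proof (cases "E = []")
        case True
        then have "Q \<otimes>\<^bsub>poly_ring R\<^esub> E = \<zero>\<^bsub>poly_ring R\<^esub>" using Q by (simp add: univ_poly_zero[symmetric, of R "carrier R"])
        then have "?s = \<ominus>\<^bsub>poly_ring R\<^esub> r N" using nr by (simp add: UP.minus_eq)
        then show ?thesis using nr le True by simp
      next
        case False
        note QEd = pmult_degree[OF Q(1) EC ne(2) False]
        have "degree E < k" using E False by (cases E) auto
        then show ?thesis
          using padd_degree[of "Q \<otimes>\<^bsub>poly_ring R\<^esub> E" "\<ominus>\<^bsub>poly_ring R\<^esub> r N"] QEd nr Q EC False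
            lead_coeff_nonzero[OF EC False]
          unfolding kde by (auto simp: UP.minus_eq)
      qed
      then show "degree ?s < ?d" "lead_coeff ?s = (if E = [] then \<ominus> lead_coeff (r N) else lead_coeff E)"
        by auto
    qed
    have "Q \<otimes>\<^bsub>poly_ring R\<^esub> \<phi> N E = Q \<otimes>\<^bsub>poly_ring R\<^esub> t N \<oplus>\<^bsub>poly_ring R\<^esub> Q \<otimes>\<^bsub>poly_ring R\<^esub> E"
      unfolding \<phi>_def using Q EC tC m by (simp add: UP.r_distr)
    also have "\<dots> = P \<otimes>\<^bsub>poly_ring R\<^esub> N \<oplus>\<^bsub>poly_ring R\<^esub> ?s"
      using Qt[OF m(1), symmetric] P m Q EC nr(1) by (simp add: UP.minus_eq UP.a_ac)
    finally have "long_divides (Q \<otimes>\<^bsub>poly_ring R\<^esub> \<phi> N E) P (N, ?s)"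
      using long_dividesI m(1) s by blast
    then have "(N, ?s) = ((Q \<otimes>\<^bsub>poly_ring R\<^esub> \<phi> N E) pdiv P, (Q \<otimes>\<^bsub>poly_ring R\<^esub> \<phi> N E) pmod P)"
      using long_divisionI[OF carrier_is_subfield _ P(1) ne(1)] Q tC m EC by (simp add: \<phi>_def)
    then show ?thesis using s(3) by (simp add: g_def)
  qed
  have cover: "\<exists>N\<in>monics ?e. \<exists>E\<in>?small. M = \<phi> N E" if M: "M \<in> monics ?d" "k \<le> degree M" for M
  proof -
    note m = mon[OF M(1)]
    define N where "N = (Q \<otimes>\<^bsub>poly_ring R\<^esub> M) pdiv P"
    define s where "s = (Q \<otimes>\<^bsub>poly_ring R\<^esub> M) pmod P"
    have QMC: "Q \<otimes>\<^bsub>poly_ring R\<^esub> M \<in> ?C" using Q m by simp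
    note QMd = pmult_degree[OF Q(1) m(1) ne(2) m(2)]
    have NC: "N \<in> ?C" and sC: "s \<in> ?C"
      unfolding N_def s_def using long_division_closed[OF carrier_is_subfield QMC P(1)] by auto
    have QM: "Q \<otimes>\<^bsub>poly_ring R\<^esub> M = P \<otimes>\<^bsub>poly_ring R\<^esub> N \<oplus>\<^bsub>poly_ring R\<^esub> s"
      unfolding N_def s_def by (rule pdiv_pmod[OF carrier_is_subfield QMC P(1)])
    have sd: "s = [] \<or> degree s < ?d"
      unfolding s_def by (rule pmod_degree[OF carrier_is_subfield QMC P(1) ne(1)])
    have ns: "\<ominus>\<^bsub>poly_ring R\<^esub> s \<in> ?C" "\<ominus>\<^bsub>poly_ring R\<^esub> s = [] \<or> degree (\<ominus>\<^bsub>poly_ring R\<^esub> s) < degree (Q \<otimes>\<^bsub>poly_ring R\<^esub> M)"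
      using pminus_degree[OF sC] sC sd QMd M(2) unfolding kde by auto
    have "Q \<otimes>\<^bsub>poly_ring R\<^esub> M \<ominus>\<^bsub>poly_ring R\<^esub> s = P \<otimes>\<^bsub>poly_ring R\<^esub> N"
      by (rule UP.add_eq_imp_minus_eq[OF QM]) (use P NC sC in auto)
    then have PNd: "P \<otimes>\<^bsub>poly_ring R\<^esub> N \<noteq> []" "degree (P \<otimes>\<^bsub>poly_ring R\<^esub> N) = ?e + degree M"
      "lead_coeff (P \<otimes>\<^bsub>poly_ring R\<^esub> N) = \<one>"
      using padd_degree[OF QMC ns(1) QMd(1) ns(2)] QMd m Q by (auto simp: UP.minus_eq)
    have Nne: "N \<noteq> []"
    proof
      assume "N = []"
      then have "P \<otimes>\<^bsub>poly_ring R\<^esub> N = \<zero>\<^bsub>poly_ring R\<^esub>" using P by (simp add: univ_poly_zero[symmetric, of R "carrier R"])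
      then show False using PNd(1) by (simp add: univ_poly_zero)
    qed
    note PNd' = pmult_degree[OF P(1) NC ne(1) Nne]
    have "degree N < ?e" using PNd'(2) PNd(2) m(4) by linarith
    then have N: "N \<in> monics ?e"
      using PNd'(3) PNd(3) P(3) lead_coeff_nonzero[OF NC Nne] NC Nne unfolding monics_iff by simp
    define E where "E = M \<ominus>\<^bsub>poly_ring R\<^esub> t N"
    have EC: "E \<in> ?C" unfolding E_def using m tC[OF NC] by simp
    have M\<phi>: "M = \<phi> N E"
      unfolding \<phi>_def E_def using m tC[OF NC] by (simp add: UP.minus_eq UP.a_lcomm UP.r_neg)
    have "Q \<otimes>\<^bsub>poly_ring R\<^esub> E = s \<oplus>\<^bsub>poly_ring R\<^esub> r N"
    proof -
      have "Q \<otimes>\<^bsub>poly_ring R\<^esub> E = Q \<otimes>\<^bsub>poly_ring R\<^esub> M \<ominus>\<^bsub>poly_ring R\<^esub> Q \<otimes>\<^bsub>poly_ring R\<^esub> t N"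
        unfolding E_def using Q m tC[OF NC] by (simp add: UP.minus_eq UP.r_distr UP.r_minus)
      also have "\<dots> = (P \<otimes>\<^bsub>poly_ring R\<^esub> N \<oplus>\<^bsub>poly_ring R\<^esub> s) \<ominus>\<^bsub>poly_ring R\<^esub> (P \<otimes>\<^bsub>poly_ring R\<^esub> N \<ominus>\<^bsub>poly_ring R\<^esub> r N)"
        by (simp only: QM Qt[OF NC])
      also have "\<dots> = s \<oplus>\<^bsub>poly_ring R\<^esub> r N"
        using P NC sC rC[OF NC] by (simp add: UP.minus_eq UP.minus_add UP.a_ac UP.r_neg)
      finally show ?thesis .
    qed
    moreover have "length (s \<oplus>\<^bsub>poly_ring R\<^esub> r N) \<le> ?d"
    proof -
      have "length s \<le> ?d" using sd by (cases s) auto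
      moreover have "length (r N) \<le> ?d" using rN(3)[OF N] le by (cases "r N") auto
      ultimately show ?thesis using poly_add_length_le[of s "r N"] by (simp add: univ_poly_add)
    qed
    ultimately have len: "length (Q \<otimes>\<^bsub>poly_ring R\<^esub> E) \<le> ?d" by simp
    have "length E \<le> k"
    proof (cases "E = []")
      case False
      note QEd = pmult_degree[OF Q(1) EC ne(2) False]
      have "length (Q \<otimes>\<^bsub>poly_ring R\<^esub> E) > 0" "length E > 0" using QEd(1) False by auto
      then show ?thesis using QEd(2) len kde by linarith
    qed simp
    then have "E \<in> ?small" using EC by simp
    then show ?thesis using N M\<phi> by blast
  qed
  have finS: "finite ?small"
    by (rule finite_subset[OF _ finite_lists_length_le[OF fin, of k]])
      (auto simp: univ_poly_carrier[symmetric] polynomial_def)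
  have finM: "finite (monics m)" for m by (rule finite_polys_with_lead[OF fin])
  have split: "monics ?d = monics k \<union> (\<Union>N\<in>monics ?e. \<phi> N ` ?small)"
  proof
    have "k \<le> ?d" using kde by linarith
    then have "monics k \<subseteq> monics ?d" by (auto simp: polys_with_lead_def)
    then show "monics k \<union> (\<Union>N\<in>monics ?e. \<phi> N ` ?small) \<subseteq> monics ?d" by (intro Un_least UN_least image_subsetI \<phi>(1))
    show "monics ?d \<subseteq> monics k \<union> (\<Union>N\<in>monics ?e. \<phi> N ` ?small)"
    proof
      fix M assume M: "M \<in> monics ?d"
      then have "M \<in> monics k \<or> k \<le> degree M"
        using mon(1-3)[OF M] unfolding monics_iff by auto
      then show "M \<in> monics k \<union> (\<Union>N\<in>monics ?e. \<phi> N ` ?small)" using cover[OF M] by blast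
    qed
  qed
  have gC: "g M \<in> carrier R" if "M \<in> monics ?d" for M using gN(4)[OF that] by simp
  have "gauss_symbol Q P = finprod R g (monics ?d)"
    unfolding gauss_symbol_def g_def ..
  also have "\<dots> = finprod R g (monics k) \<otimes> finprod R g (\<Union>N\<in>monics ?e. \<phi> N ` ?small)"
    unfolding split
  proof (rule finprod_Un_disjoint)
    show "monics k \<inter> (\<Union>N\<in>monics ?e. \<phi> N ` ?small) = {}"
      using \<phi>(2) by (force simp: monics_iff)
    show "g \<in> monics k \<rightarrow> carrier R" "g \<in> (\<Union>N\<in>monics ?e. \<phi> N ` ?small) \<rightarrow> carrier R"
      using gC split by auto
  qed (use finM finS in auto)
  \<comment> \<open>If \<open>deg M < k\<close>, then \<open>Q M\<close> is its own remainder modulo \<open>P\<close>, and it is monic.\<close>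
  also have "finprod R g (monics k) = \<one>"
  proof (rule finprod_one_eqI)
    fix M assume M: "M \<in> monics k"
    note m = mon[OF M]
    note QMd = pmult_degree[OF Q(1) m(1) ne(2) m(2)]
    have "(Q \<otimes>\<^bsub>poly_ring R\<^esub> M) pmod P = Q \<otimes>\<^bsub>poly_ring R\<^esub> M"
    proof (rule pmod_const(2)[OF carrier_is_subfield _ P(1)])
      show "degree (Q \<otimes>\<^bsub>poly_ring R\<^esub> M) < ?d" using QMd(2) m(4) kde by linarith
    qed (use m Q in simp)
    then show "g M = \<one>" using QMd m Q by (simp add: g_def)
  qed
  also have "finprod R g (\<Union>N\<in>monics ?e. \<phi> N ` ?small) = finprod R (\<lambda>N. finprod R g (\<phi> N ` ?small)) (monics ?e)"
  proof (rule finprod_UN_disjoint)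
    show "pairwise (\<lambda>N N'. disjnt (\<phi> N ` ?small) (\<phi> N' ` ?small)) (monics ?e)"
    proof (rule pairwiseI)
      fix N N' assume N: "N \<in> monics ?e" "N' \<in> monics ?e" "N \<noteq> N'"
      have "\<phi> N E \<noteq> \<phi> N' E'" if "E \<in> ?small" "E' \<in> ?small" for E E'
        using div\<phi>[OF N(1) that(1)] div\<phi>[OF N(2) that(2)] N(3) by auto
      then show "disjnt (\<phi> N ` ?small) (\<phi> N' ` ?small)" unfolding disjnt_iff by blast
    qed
    show "g x \<in> carrier R" if "N \<in> monics ?e" "x \<in> \<phi> N ` ?small" for N x
      using that(2) gC[OF \<phi>(1)[OF that(1)]] by blast
  qed (use finM finS in auto)
  also have "\<dots> = finprod R (\<lambda>N. (\<ominus> \<one> \<otimes> (\<ominus> \<one>) [^] k) \<otimes> lead_coeff (r N)) (monics ?e)"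
  proof (rule finprod_cong')
    fix N assume N: "N \<in> monics ?e"
    note m = mon[OF N]
    have inj: "inj_on (\<phi> N) ?small"
      unfolding \<phi>_def using UP.add.l_cancel tC[OF m(1)] by (intro inj_onI) blast
    have lr: "lead_coeff (r N) \<in> carrier R" using rN(4)[OF N] by simp
    have lcE: "lead_coeff E \<in> carrier R" if "E \<in> carrier (poly_ring R)" "E \<noteq> []" for E
      using lead_coeff_nonzero[OF that] by simp
    have "finprod R g (\<phi> N ` ?small) = finprod R (\<lambda>E. g (\<phi> N E)) ?small"
      by (rule finprod_reindex[OF _ inj]) (use gC[OF \<phi>(1)[OF N]] in blast)
    also have "\<dots> = finprod R (\<lambda>E. if E = [] then \<ominus> lead_coeff (r N) else lead_coeff E) (insert [] (?small - {[]}))"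
      by (rule finprod_cong') (use div\<phi>[OF N] lr lcE in \<open>auto simp: univ_poly_zero_closed\<close>)
    also have "\<dots> = \<ominus> lead_coeff (r N) \<otimes> finprod R (\<lambda>E. if E = [] then \<ominus> lead_coeff (r N) else lead_coeff E) (?small - {[]})"
      by (subst finprod_insert) (use finS lr lcE in auto)
    also have "finprod R (\<lambda>E. if E = [] then \<ominus> lead_coeff (r N) else lead_coeff E) (?small - {[]}) = finprod R lead_coeff (?small - {[]})"
      by (rule finprod_cong') (use lcE in auto)
    also have "\<dots> = (\<ominus> \<one>) [^] k" by (rule finprod_lead_coeff_small[OF fin])
    finally show "finprod R g (\<phi> N ` ?small) = (\<ominus> \<one> \<otimes> (\<ominus> \<one>) [^] k) \<otimes> lead_coeff (r N)"
      using lr by (simp add: l_minus r_minus m_comm)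
  qed (use rN(4) in auto)
  also have "\<dots> = (\<ominus> \<one> \<otimes> (\<ominus> \<one>) [^] k) [^] (\<Sum>i<?e. card (carrier R) ^ i) \<otimes> gauss_symbol P Q"
  proof -
    have "\<ominus> \<one> \<otimes> (\<ominus> \<one>) [^] k \<in> carrier R" by simp
    moreover have "(\<lambda>N. lead_coeff (r N)) \<in> monics ?e \<rightarrow> carrier R" using rN(4) by auto
    ultimately show ?thesis
      unfolding gauss_symbol_def r_def[symmetric] card_polys_with_lead[OF fin, of \<one>, symmetric]
      by (rule finprod_scale)
  qed
  also have "(\<ominus> \<one> \<otimes> (\<ominus> \<one>) [^] k) [^] (\<Sum>i<?e. card (carrier R) ^ i) = ((\<ominus> \<one>) [^] Suc k) [^] ?e"
    by (subst pow_geometric_eq[OF fin]) (simp_all add: m_comm)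
  also have "\<dots> = (\<ominus> \<one>) [^] (?d * ?e)"
  proof -
    \<comment> \<open>\<open>(d - e + 1) e\<close> and \<open>d e\<close> have the same parity because \<open>e\<^sup>2\<close> and \<open>e\<close> do.\<close>
    have "even (Suc k * ?e) \<longleftrightarrow> even (?d * ?e)" unfolding kde by auto
    moreover have "((\<ominus> \<one>) [^] Suc k) [^] ?e = (\<ominus> \<one>) [^] (Suc k * ?e)"
      by (rule nat_pow_pow) simp
    ultimately show ?thesis by (simp only: minus_one_pow)
  qed
  finally show ?thesis using gauss_symbol_nonzero[OF Q(1,2) P(1) nQP] by simp
qed

lemma gauss_symbol_reciprocity:
  assumes fin: "finite (carrier R)"
    and P: "P \<in> carrier (poly_ring R)" "pirreducible (carrier R) P" "lead_coeff P = \<one>"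
    and Q: "Q \<in> carrier (poly_ring R)" "pirreducible (carrier R) Q" "lead_coeff Q = \<one>"
    and nPQ: "\<not> P pdivides Q" and nQP: "\<not> Q pdivides P"
  shows "gauss_symbol Q P = (\<ominus> \<one>) [^] (degree P * degree Q) \<otimes> gauss_symbol P Q"
proof (cases "degree Q \<le> degree P")
  case True
  then show ?thesis using gauss_symbol_reciprocity_aux[OF assms] by blast
next
  case False
  let ?s = "(\<ominus> \<one>) [^] (degree P * degree Q)"
  have "gauss_symbol P Q = ?s \<otimes> gauss_symbol Q P"
    using gauss_symbol_reciprocity_aux[OF fin Q P nQP nPQ] False by (simp add: mult.commute)
  moreover have "?s \<otimes> ?s = \<one>"
    by (simp add: minus_one_pow minus_one_square)
  moreover have "gauss_symbol Q P \<in> carrier R"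
    using gauss_symbol_nonzero[OF P(1,2) Q(1) nPQ] by simp
  ultimately show ?thesis by (simp add: m_assoc[symmetric])
qed

text \<open>
  As constants are determined modulo \<open>P\<close>, the congruence in Gauss's lemma characterizes the Gauss symbol. This
  gives multiplicativity and the value at constants.
\<close>

lemma gauss_symbol_mult:
  assumes fin: "finite (carrier R)"
    and P: "P \<in> carrier (poly_ring R)" "pirreducible (carrier R) P"
    and \<alpha>: "\<alpha> \<in> carrier (poly_ring R)" "\<not> P pdivides \<alpha>"
    and \<beta>: "\<beta> \<in> carrier (poly_ring R)" "\<not> P pdivides \<beta>"
  shows "gauss_symbol (\<alpha> \<otimes>\<^bsub>poly_ring R\<^esub> \<beta>) P = gauss_symbol \<alpha> P \<otimes> gauss_symbol \<beta> P"
proof -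
  interpret UP: domain "poly_ring R" by (rule univ_poly_is_domain[OF carrier_is_subring])
  let ?h = "rupture_surj (carrier R) P"
  interpret h: ring_hom_ring "poly_ring R" "Rupt (carrier R) P" ?h
    by (rule rupture_surj_hom(2)[OF carrier_is_subring P(1)])
  interpret c: ring_hom_ring R "poly_ring R" poly_of_const by (rule pconst_hom)
  let ?m = "\<Sum>i<degree P. card (carrier R) ^ i"
  have ab: "\<alpha> \<otimes>\<^bsub>poly_ring R\<^esub> \<beta> \<in> carrier (poly_ring R)" "\<not> P pdivides (\<alpha> \<otimes>\<^bsub>poly_ring R\<^esub> \<beta>)"
    using pprime_mult[OF P \<alpha>(1) \<beta>(1)] \<alpha> \<beta> by auto
  have G: "?h (x [^]\<^bsub>poly_ring R\<^esub> ?m) = ?h (poly_of_const (gauss_symbol x P))"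
    "gauss_symbol x P \<in> carrier R"
    if "x \<in> carrier (poly_ring R)" "\<not> P pdivides x" for x
    using rupture_eq_iff[OF P(1)] gauss_symbol_cong[OF fin P that] gauss_symbol_nonzero[OF P that] pconst_closed that
    by auto
  have "?h (poly_of_const (gauss_symbol (\<alpha> \<otimes>\<^bsub>poly_ring R\<^esub> \<beta>) P)) = 
    ?h (poly_of_const (gauss_symbol \<alpha> P \<otimes> gauss_symbol \<beta> P))"
    using G(1)[OF ab] G[OF \<alpha>] G[OF \<beta>] \<alpha>(1) \<beta>(1) pconst_closed by (simp add: UP.nat_pow_distrib del: h.hom_nat_pow)
  then have "P pdivides (poly_of_const (gauss_symbol (\<alpha> \<otimes>\<^bsub>poly_ring R\<^esub> \<beta>) P) \<ominus>\<^bsub>poly_ring R\<^esub>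
      poly_of_const (gauss_symbol \<alpha> P \<otimes> gauss_symbol \<beta> P))"
    using rupture_eq_iff[OF P(1)] G(2)[OF ab] G(2)[OF \<alpha>] G(2)[OF \<beta>] pconst_closed m_closed by blast
  moreover have "degree P > 0" using pirreducible_degree[OF carrier_is_subfield P] by simp
  ultimately show ?thesis
    using pconst_cong_imp_eq[OF P(1)] G(2)[OF ab] G(2)[OF \<alpha>] G(2)[OF \<beta>] by simp
qed

lemma gauss_symbol_const:
  assumes fin: "finite (carrier R)"
    and P: "P \<in> carrier (poly_ring R)" "pirreducible (carrier R) P"
    and a: "a \<in> carrier R - {\<zero>}"
  shows "\<not> P pdivides (poly_of_const a)" "gauss_symbol (poly_of_const a) P = a [^] degree P"
proof -
  interpret UP: domain "poly_ring R" by (rule univ_poly_is_domain[OF carrier_is_subring])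
  interpret c: ring_hom_cring R "poly_ring R" poly_of_const
    using ring_hom_ring.homh[OF pconst_hom] by unfold_locales
  have deg: "degree P > 0" using pirreducible_degree[OF carrier_is_subfield P] by simp
  show nd: "\<not> P pdivides (poly_of_const a)"
    using not_pdivides_small[OF P(1) pconst(2)[OF a]] deg pconst[OF a] by simp
  note ca = pconst_closed[of a]
  have "P pdivides (poly_of_const (a [^] (\<Sum>i<degree P. card (carrier R) ^ i))
           \<ominus>\<^bsub>poly_ring R\<^esub> poly_of_const (gauss_symbol (poly_of_const a) P))"
    using gauss_symbol_cong[OF fin P ca nd] a by (simp add: c.ring.hom_nat_pow)
  then have "a [^] (\<Sum>i<degree P. card (carrier R) ^ i) = gauss_symbol (poly_of_const a) P"
    using pconst_cong_imp_eq[OF P(1) deg] gauss_symbol_nonzero[OF P ca nd] a by simp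
  then show "gauss_symbol (poly_of_const a) P = a [^] degree P"
    using pow_geometric_eq[OF fin] a by simp
qed

end

section \<open>Extending symbols along prime factorizations\<close>

text \<open>The monic irreducible polynomials.\<close>

definition (in ring) monic_primes :: "'a list set" where
  "monic_primes = {P \<in> carrier (poly_ring R). pirreducible (carrier R) P \<and> lead_coeff P = \<one>}"

text \<open>
  \<open>\<beta> = a \<Prod> P^(d P)\<close> with a unit \<open>a\<close> and positive exponents, where \<open>P\<close> runs over the finite set \<open>Ps\<close>
  of monic irreducible polynomials.
\<close>

definition (in ring) factorization :: "'a \<Rightarrow> 'a list set \<Rightarrow> ('a list \<Rightarrow> nat) \<Rightarrow> 'a list \<Rightarrow> bool" where
  "factorization a Ps d \<beta> \<longleftrightarrow> a \<in> Units R \<and> finite Ps \<and> (\<forall>P\<in>Ps. P \<in> monic_primes \<and> d P \<ge> 1) \<and>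
     \<beta> = poly_of_const a \<otimes>\<^bsub>poly_ring R\<^esub> finprod (poly_ring R) (\<lambda>P. P [^]\<^bsub>poly_ring R\<^esub> d P) Ps"

text \<open>
  The completely multiplicative extension, to all nonzero polynomials, of a function \<open>f\<close> on the monic irreducible
  polynomials; it sends nonzero constants to \<open>1\<close>. The value does not depend on the factorization (\<open>extend_primes_eq\<close>).
\<close>

definition (in ring) extend_primes :: "('a list \<Rightarrow> 'a) \<Rightarrow> 'a list \<Rightarrow> 'a" where
  "extend_primes f \<beta> = (THE v. \<exists>a Ps d. factorization a Ps d \<beta> \<and> v = finprod R (\<lambda>P. f P [^] d P) Ps)"

context field
begin

lemma monic_primesD:
  assumes "P \<in> monic_primes"
  shows "P \<in> carrier (poly_ring R)" "pirreducible (carrier R) P" "lead_coeff P = \<one>" "P \<noteq> []" "degree P \<ge> 1"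
  using assms pirreducibleE(1)[OF carrier_is_subring] pirreducible_degree[OF carrier_is_subfield]
  by (auto simp: monic_primes_def)

lemma monic_primes_dvd_eq:
  assumes P: "P \<in> monic_primes" and Q: "Q \<in> monic_primes" and dvd: "P pdivides Q"
  shows "P = Q"
proof -
  note p = monic_primesD[OF P] and q = monic_primesD[OF Q]
  have "P \<in> Units (poly_ring R) \<or> P \<sim>\<^bsub>poly_ring R\<^esub> Q"
    using divides_pirreducible_condition[OF q(2) p(1)] dvd by (simp add: pdivides_def)
  then have "P \<sim>\<^bsub>poly_ring R\<^esub> Q" using pirreducibleE(2)[OF carrier_is_subring p(1,2)] by blast
  then obtain k where k: "k \<in> carrier R - {\<zero>}" "P = [k] \<otimes>\<^bsub>poly_ring R\<^esub> Q"
    using associated_polynomials_iff[OF carrier_is_subfield p(1) q(1)] by blast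
  have "lead_coeff P = k"
    using pmult_degree(3)[OF pconst(2)[OF k(1)] q(1) _ q(4)] k q(3) by simp
  then have "[k] = \<one>\<^bsub>poly_ring R\<^esub>" using p(3) by (simp add: univ_poly_one)
  interpret UP: domain "poly_ring R" by (rule univ_poly_is_domain[OF carrier_is_subring])
  show ?thesis using k(2) \<open>[k] = \<one>\<^bsub>poly_ring R\<^esub>\<close> q(1) by simp
qed

lemma not_dvd_const:
  assumes "P \<in> monic_primes" "a \<in> carrier R - {\<zero>}"
  shows "\<not> P pdivides poly_of_const a"
  using not_pdivides_small[OF monic_primesD(1)[OF assms(1)] pconst(2)[OF assms(2)]]
    monic_primesD(5)[OF assms(1)] pconst(1)[OF assms(2)] by simp

lemma monic_primes_dvd_pow:
  assumes P: "P \<in> monic_primes" and "a \<in> carrier (poly_ring R)" and "P pdivides a [^]\<^bsub>poly_ring R\<^esub> (k :: nat)"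
  shows "P pdivides a"
  using assms(3)
proof (induction k)
  case 0
  have "\<one>\<^bsub>poly_ring R\<^esub> = poly_of_const \<one>" using pconst(1)[of \<one>] by (simp add: univ_poly_one)
  then show ?case using 0 not_dvd_const[OF P, of \<one>] by simp
next
  case (Suc k)
  interpret UP: domain "poly_ring R" by (rule univ_poly_is_domain[OF carrier_is_subring])
  show ?case using Suc pprime_mult[OF monic_primesD(1,2)[OF P]] assms(2) by auto
qed

lemma monic_primes_dvd_finprod:
  assumes P: "P \<in> monic_primes" and "finite Ps" and "Ps \<subseteq> monic_primes"
    and "P pdivides finprod (poly_ring R) (\<lambda>P. P [^]\<^bsub>poly_ring R\<^esub> (d P :: nat)) Ps"
  shows "P \<in> Ps"
  using assms(2-4)
proof (induction Ps rule: finite_induct)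
  case empty
  interpret UP: domain "poly_ring R" by (rule univ_poly_is_domain[OF carrier_is_subring])
  have "\<one>\<^bsub>poly_ring R\<^esub> = poly_of_const \<one>" using pconst(1)[of \<one>] by (simp add: univ_poly_one)
  then show ?case using empty not_dvd_const[OF P, of \<one>] by simp
next
  case (insert Q Ps)
  interpret UP: domain "poly_ring R" by (rule univ_poly_is_domain[OF carrier_is_subring])
  have carr: "(\<lambda>P. P [^]\<^bsub>poly_ring R\<^esub> d P) \<in> Ps \<rightarrow> carrier (poly_ring R)" "Q \<in> carrier (poly_ring R)"
    using insert.prems monic_primesD(1) by auto
  then have "P pdivides (Q [^]\<^bsub>poly_ring R\<^esub> d Q \<otimes>\<^bsub>poly_ring R\<^esub> finprod (poly_ring R) (\<lambda>P. P [^]\<^bsub>poly_ring R\<^esub> d P) Ps)"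
    using insert by simp
  then have "P pdivides Q [^]\<^bsub>poly_ring R\<^esub> d Q \<or> P pdivides finprod (poly_ring R) (\<lambda>P. P [^]\<^bsub>poly_ring R\<^esub> d P) Ps"
    using pprime_mult[OF monic_primesD(1,2)[OF P]] carr by simp
  then show ?case
    using insert monic_primes_dvd_pow[OF P carr(2)] monic_primes_dvd_eq[OF P, of Q] by auto
qed

text \<open>The exponents in a factorization are the multiplicities of the irreducible polynomials as divisors.\<close>

lemma factorization_prime_power_dvd:
  assumes fac: "factorization a Ps d \<beta>" and P: "P \<in> monic_primes"
  shows "(P [^]\<^bsub>poly_ring R\<^esub> (k :: nat)) pdivides \<beta> \<longleftrightarrow> k \<le> (if P \<in> Ps then d P else 0)"
proof -
  interpret UP: domain "poly_ring R" by (rule univ_poly_is_domain[OF carrier_is_subring])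
  note p = monic_primesD[OF P]
  have a: "a \<in> carrier R - {\<zero>}" and fin: "finite Ps" and Ps: "Ps \<subseteq> monic_primes"
    using fac by (auto simp: factorization_def field_Units)
  define m where "m = (if P \<in> Ps then d P else 0)"
  define F where "F = finprod (poly_ring R) (\<lambda>P. P [^]\<^bsub>poly_ring R\<^esub> d P) (Ps - {P})"
  define C where "C = poly_of_const a \<otimes>\<^bsub>poly_ring R\<^esub> F"
  have PsC: "(\<lambda>P. P [^]\<^bsub>poly_ring R\<^esub> d P) \<in> Ps \<rightarrow> carrier (poly_ring R)" using Ps monic_primesD(1) by auto
  have FC: "F \<in> carrier (poly_ring R)" unfolding F_def using PsC by (intro UP.finprod_closed) auto
  have ca: "poly_of_const a \<in> carrier (poly_ring R)" using pconst_closed a by simp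
  have "finprod (poly_ring R) (\<lambda>P. P [^]\<^bsub>poly_ring R\<^esub> d P) Ps = P [^]\<^bsub>poly_ring R\<^esub> m \<otimes>\<^bsub>poly_ring R\<^esub> F"
  proof (cases "P \<in> Ps")
    case True
    have "finprod (poly_ring R) (\<lambda>P. P [^]\<^bsub>poly_ring R\<^esub> d P) (insert P (Ps - {P})) = P [^]\<^bsub>poly_ring R\<^esub> d P \<otimes>\<^bsub>poly_ring R\<^esub> F"
      unfolding F_def by (rule UP.finprod_insert) (use fin PsC True in auto)
    then show ?thesis using True by (simp add: m_def insert_absorb)
  next
    case False
    then show ?thesis using FC by (simp add: m_def F_def)
  qed
  then have \<beta>: "\<beta> = C \<otimes>\<^bsub>poly_ring R\<^esub> P [^]\<^bsub>poly_ring R\<^esub> m"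
    using fac FC ca p(1) by (simp add: factorization_def C_def UP.m_ac)
  have nF: "\<not> P pdivides F"
    using monic_primes_dvd_finprod[OF P, of "Ps - {P}" d] fin Ps by (auto simp: F_def)
  have nC: "\<not> P pdivides C"
    unfolding C_def using pprime_mult[OF p(1,2) ca FC] not_dvd_const[OF P a] nF by blast
  have "(P [^]\<^bsub>poly_ring R\<^esub> k) pdivides \<beta> \<longleftrightarrow> (P [^]\<^bsub>poly_ring R\<^esub> k) pdivides (P [^]\<^bsub>poly_ring R\<^esub> m)"
    unfolding \<beta> using pirreducible_pow_pdivides_iff[OF carrier_is_subfield p(1) _ _ p(2) nC] FC ca p(1)
    by (simp add: C_def)
  also have "\<dots> \<longleftrightarrow> k \<le> m"
  proof
    assume "(P [^]\<^bsub>poly_ring R\<^esub> k) pdivides (P [^]\<^bsub>poly_ring R\<^esub> m)"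
    then have "k * degree P \<le> m * degree P"
      using pdivides_imp_degree_le[OF carrier_is_subring _ _ polynomial_pow_not_zero[OF p(1,4)]] p(1)
        polynomial_pow_degree[OF p(1)] by (metis UP.nat_pow_closed)
    then show "k \<le> m" using p(5) by simp
  qed (rule polynomial_pow_division[OF p(1)])
  finally show ?thesis unfolding m_def .
qed

lemma factorization_unique:
  assumes "factorization a Ps d \<beta>" "factorization a' Ps' d' \<beta>"
  shows "Ps = Ps'" "\<And>P. P \<in> Ps \<Longrightarrow> d P = d' P"
proof -
  have m: "Ps \<subseteq> monic_primes" "Ps' \<subseteq> monic_primes" "\<And>P. P \<in> Ps \<Longrightarrow> d P \<ge> 1" "\<And>P. P \<in> Ps' \<Longrightarrow> d' P \<ge> 1"
    using assms by (auto simp: factorization_def)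
  have *: "(if P \<in> Ps then d P else 0) = (if P \<in> Ps' then d' P else 0)" (is "?x = ?y")
    if "P \<in> monic_primes" for P
  proof -
    have "k \<le> ?x \<longleftrightarrow> k \<le> ?y" for k
      using factorization_prime_power_dvd[OF assms(1) that] factorization_prime_power_dvd[OF assms(2) that]
      by blast
    from this[of ?x] this[of ?y] show ?thesis by linarith
  qed
  have "P \<in> Ps \<longleftrightarrow> P \<in> Ps'" for P
  proof (cases "P \<in> monic_primes")
    case True
    then show ?thesis using *[OF True] m(3,4)[of P] by (auto split: if_splits)
  qed (use m in auto)
  then show "Ps = Ps'" by blast
  then show "d P = d' P" if "P \<in> Ps" for P using *[of P] that m(1) by auto
qed

lemma factorization_const: "a \<in> carrier R - {\<zero>} \<Longrightarrow> factorization a {} d (poly_of_const a)"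
proof -
  interpret UP: domain "poly_ring R" by (rule univ_poly_is_domain[OF carrier_is_subring])
  assume "a \<in> carrier R - {\<zero>}"
  then show ?thesis using pconst_closed by (simp add: factorization_def field_Units)
qed

lemma factorization_mult:
  assumes fac: "factorization a Ps d \<gamma>" and P: "P \<in> monic_primes"
  shows "factorization a (insert P Ps) (d(P := if P \<in> Ps then Suc (d P) else 1)) (P \<otimes>\<^bsub>poly_ring R\<^esub> \<gamma>)"
proof -
  interpret UP: domain "poly_ring R" by (rule univ_poly_is_domain[OF carrier_is_subring])
  have a: "a \<in> carrier R" and fin: "finite Ps" and Ps: "Ps \<subseteq> monic_primes"
    using fac by (auto simp: factorization_def field_Units)
  have "(\<lambda>P. P) \<in> insert P Ps \<rightarrow> carrier (poly_ring R)" using Ps P monic_primesD(1) by auto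
  from UP.finprod_pow_update[OF fin this, of d]
  have "finprod (poly_ring R) (\<lambda>Q. Q [^]\<^bsub>poly_ring R\<^esub> (d(P := if P \<in> Ps then Suc (d P) else 1)) Q) (insert P Ps) =
    P \<otimes>\<^bsub>poly_ring R\<^esub> finprod (poly_ring R) (\<lambda>P. P [^]\<^bsub>poly_ring R\<^esub> d P) Ps" .
  moreover have "finprod (poly_ring R) (\<lambda>P. P [^]\<^bsub>poly_ring R\<^esub> d P) Ps \<in> carrier (poly_ring R)"
    using Ps monic_primesD(1) by (intro UP.finprod_closed) auto
  ultimately show ?thesis
    using fac P pconst_closed[OF a] monic_primesD(1)[OF P]
    by (auto simp: factorization_def UP.m_lcomm)
qed

lemma exists_monic_prime_divisor:
  assumes "\<beta> \<in> carrier (poly_ring R)" "degree \<beta> \<ge> 1"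
  shows "\<exists>P\<in>monic_primes. P pdivides \<beta>"
  using assms
proof (induction "degree \<beta>" arbitrary: \<beta> rule: less_induct)
  case less
  interpret UP: domain "poly_ring R" by (rule univ_poly_is_domain[OF carrier_is_subring])
  note \<beta> = less.prems
  have ne: "\<beta> \<noteq> []" using \<beta> by auto
  show ?case
  proof (cases "pirreducible (carrier R) \<beta>")
    case True
    define c where "c = inv (lead_coeff \<beta>)"
    have l: "lead_coeff \<beta> \<in> Units R" using lead_coeff_nonzero[OF \<beta>(1) ne] field_Units by simp
    then have c: "c \<in> carrier R - {\<zero>}" "c \<otimes> lead_coeff \<beta> = \<one>"
      using Units_inv_Units[OF l] field_Units by (auto simp: c_def)
    let ?P = "[c] \<otimes>\<^bsub>poly_ring R\<^esub> \<beta>"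
    have PC: "?P \<in> carrier (poly_ring R)" using pconst(2)[OF c(1)] \<beta> by simp
    have u: "[c] \<in> Units (poly_ring R)" using univ_poly_carrier_units c by auto
    have as: "?P \<sim>\<^bsub>poly_ring R\<^esub> \<beta>"
      using associated_polynomials_iff[OF carrier_is_subfield PC \<beta>(1)] c by blast
    have "Divisibility.irreducible (poly_ring R) ?P"
      using UP.irreducible_prod_lI[of \<beta> "[c]"] True u pconst(2)[OF c(1)] \<beta> by (simp add: ring_irreducible_def)
    then have "?P \<in> monic_primes"
      using PC pmult_degree(1,3)[OF pconst(2)[OF c(1)] \<beta>(1) _ ne] c
      by (simp add: monic_primes_def ring_irreducible_def univ_poly_zero)
    moreover have "?P pdivides \<beta>" using as by (simp add: pdivides_def associated_def)
    ultimately show ?thesis by blast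
  next
    case False
    have nu: "\<beta> \<notin> Units (poly_ring R)" using \<beta> univ_poly_units'[OF carrier_is_subfield, of \<beta>] by linarith
    then obtain q r where qr: "q \<in> carrier (poly_ring R)" "r \<in> carrier (poly_ring R)"
      "\<beta> = q \<otimes>\<^bsub>poly_ring R\<^esub> r" "q \<notin> Units (poly_ring R)" "r \<notin> Units (poly_ring R)"
      using pirreducibleI[OF carrier_is_subring \<beta>(1) ne nu] False by metis
    have nz: "q \<noteq> []" "r \<noteq> []"
      using qr(1-3) ne UP.l_null[of r] UP.r_null[of q] by (auto simp: univ_poly_zero)
    have "degree q \<noteq> 0" "degree r \<noteq> 0"
      using univ_poly_units'[OF carrier_is_subfield] qr nz by auto
    moreover have "degree \<beta> = degree q + degree r" using pmult_degree(2)[OF qr(1,2) nz] qr(3) by simp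
    ultimately have "degree q < degree \<beta>" "1 \<le> degree q" by linarith+
    then obtain P where P: "P \<in> monic_primes" "P pdivides q"
      using less.hyps[of q] qr(1) by blast
    then have "P pdivides \<beta>"
      using pprime_mult[OF monic_primesD(1,2)[OF P(1)] qr(1,2)] qr(3) by simp
    then show ?thesis using P by blast
  qed
qed

lemma poly_prime_induct [consumes 2, case_names const mult]:
  assumes "\<beta> \<in> carrier (poly_ring R)" "\<beta> \<noteq> []"
    and const: "\<And>a. a \<in> carrier R - {\<zero>} \<Longrightarrow> S (poly_of_const a)"
    and mult: "\<And>P \<gamma>. P \<in> monic_primes \<Longrightarrow> \<gamma> \<in> carrier (poly_ring R) \<Longrightarrow> \<gamma> \<noteq> [] \<Longrightarrow> S \<gamma> \<Longrightarrow>
      S (P \<otimes>\<^bsub>poly_ring R\<^esub> \<gamma>)"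
  shows "S \<beta>"
  using assms(1,2)
proof (induction "degree \<beta>" arbitrary: \<beta> rule: less_induct)
  case less
  interpret UP: domain "poly_ring R" by (rule univ_poly_is_domain[OF carrier_is_subring])
  show ?case
  proof (cases "degree \<beta> = 0")
    case True
    then obtain a where "\<beta> = [a]" using less.prems(2) by (cases \<beta>) auto
    then show ?thesis using const[of a] lead_coeff_nonzero[OF less.prems] pconst(1)[of a] by simp
  next
    case False
    then obtain P \<gamma> where P: "P \<in> monic_primes" "\<gamma> \<in> carrier (poly_ring R)" "\<beta> = P \<otimes>\<^bsub>poly_ring R\<^esub> \<gamma>"
      using exists_monic_prime_divisor[OF less.prems(1)] unfolding pdivides_def factor_def by force
    have "\<gamma> \<noteq> []" using P monic_primesD(1) less.prems(2) by (auto simp: univ_poly_zero[symmetric, of R "carrier R"])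
    then show ?thesis
      using mult[OF P(1,2)] less.hyps[of \<gamma>] P pmult_degree(2)[OF monic_primesD(1)[OF P(1)] P(2) monic_primesD(4)[OF P(1)]]
        monic_primesD(5)[OF P(1)] by simp
  qed
qed

lemma factorization_exists:
  assumes "\<beta> \<in> carrier (poly_ring R)" "\<beta> \<noteq> []"
  shows "\<exists>a Ps d. factorization a Ps d \<beta>"
  using assms
proof (induction \<beta> rule: poly_prime_induct)
  case (const a)
  then show ?case using factorization_const by blast
next
  case (mult P \<gamma>)
  then show ?case using factorization_mult by blast
qed

lemma extend_primes_eq:
  assumes f: "f \<in> monic_primes \<rightarrow> carrier R" and fac: "factorization a Ps d \<beta>"
  shows "extend_primes f \<beta> = finprod R (\<lambda>P. f P [^] d P) Ps"
  unfolding extend_primes_def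
proof (rule the_equality)
  show "\<exists>a Ps' d'. factorization a Ps' d' \<beta> \<and> finprod R (\<lambda>P. f P [^] d P) Ps = finprod R (\<lambda>P. f P [^] d' P) Ps'"
    using fac by blast
next
  fix v assume "\<exists>a Ps d. factorization a Ps d \<beta> \<and> v = finprod R (\<lambda>P. f P [^] d P) Ps"
  then obtain a' Ps' d' where *: "factorization a' Ps' d' \<beta>" "v = finprod R (\<lambda>P. f P [^] d' P) Ps'" by blast
  have "Ps \<subseteq> monic_primes" using fac by (auto simp: factorization_def)
  then have "finprod R (\<lambda>P. f P [^] d P) Ps = finprod R (\<lambda>P. f P [^] d' P) Ps'"
    using factorization_unique[OF fac *(1)] f by (intro finprod_cong') auto
  then show "v = finprod R (\<lambda>P. f P [^] d P) Ps" using * by simp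
qed

lemma extend_primes_const:
  assumes "f \<in> monic_primes \<rightarrow> carrier R" "a \<in> carrier R - {\<zero>}"
  shows "extend_primes f (poly_of_const a) = \<one>"
  using extend_primes_eq[OF assms(1) factorization_const[OF assms(2)]] by simp

lemma extend_primes_mult:
  assumes f: "f \<in> monic_primes \<rightarrow> carrier R" and P: "P \<in> monic_primes"
    and \<gamma>: "\<gamma> \<in> carrier (poly_ring R)" "\<gamma> \<noteq> []"
  shows "extend_primes f (P \<otimes>\<^bsub>poly_ring R\<^esub> \<gamma>) = f P \<otimes> extend_primes f \<gamma>"
proof -
  obtain a Ps d where fac: "factorization a Ps d \<gamma>" using factorization_exists[OF \<gamma>] by blast
  have fin: "finite Ps" and Ps: "Ps \<subseteq> monic_primes" using fac by (auto simp: factorization_def)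
  show ?thesis
    unfolding extend_primes_eq[OF f factorization_mult[OF fac P]] extend_primes_eq[OF f fac]
    by (rule finprod_pow_update[OF fin]) (use f P Ps in auto)
qed

lemma extend_primes_closed:
  assumes f: "f \<in> monic_primes \<rightarrow> carrier R" and "\<beta> \<in> carrier (poly_ring R)" "\<beta> \<noteq> []"
  shows "extend_primes f \<beta> \<in> carrier R"
  using assms(2,3)
proof (induction \<beta> rule: poly_prime_induct)
  case (const a)
  then show ?case using extend_primes_const[OF f] by simp
next
  case (mult P \<gamma>)
  then show ?case using extend_primes_mult[OF f] f by auto
qed

lemma extend_primes_nonzero:
  assumes f: "f \<in> monic_primes \<rightarrow> carrier R" and \<beta>: "\<beta> \<in> carrier (poly_ring R)" "\<beta> \<noteq> []"
    and nz: "\<And>P. P \<in> monic_primes \<Longrightarrow> P pdivides \<beta> \<Longrightarrow> f P \<noteq> \<zero>"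
  shows "extend_primes f \<beta> \<in> carrier R - {\<zero>}"
proof -
  obtain a Ps d where fac: "factorization a Ps d \<beta>" using factorization_exists[OF \<beta>] by blast
  have "P \<in> monic_primes \<and> P pdivides \<beta>" if "P \<in> Ps" for P
  proof -
    interpret UP: domain "poly_ring R" by (rule univ_poly_is_domain[OF carrier_is_subring])
    have P: "P \<in> monic_primes" "d P \<ge> 1" using fac that by (auto simp: factorization_def)
    then show ?thesis
      using factorization_prime_power_dvd[OF fac P(1), of 1] that monic_primesD(1)[OF P(1)] by simp
  qed
  then show ?thesis
    unfolding extend_primes_eq[OF f fac] using nz f by (intro nonzero_finprod funcsetI nonzero_pow) auto
qed

lemma extend_primes_cong:
  assumes f: "f \<in> monic_primes \<rightarrow> carrier R" and fg: "\<And>P. P \<in> monic_primes \<Longrightarrow> f P = g P"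
    and "\<beta> \<in> carrier (poly_ring R)" "\<beta> \<noteq> []"
  shows "extend_primes f \<beta> = extend_primes g \<beta>"
  using assms(3,4)
proof (induction \<beta> rule: poly_prime_induct)
  case (const a)
  have g: "g \<in> monic_primes \<rightarrow> carrier R" using f fg by (auto simp: Pi_iff)
  show ?case using extend_primes_const[OF f const] extend_primes_const[OF g const] by simp
next
  case (mult P \<gamma>)
  have g: "g \<in> monic_primes \<rightarrow> carrier R" using f fg by (auto simp: Pi_iff)
  show ?case using extend_primes_mult[OF f mult(1-3)] extend_primes_mult[OF g mult(1-3)] mult fg by simp
qed

lemma extend_primes_multf:
  assumes f: "f \<in> monic_primes \<rightarrow> carrier R" and g: "g \<in> monic_primes \<rightarrow> carrier R"
    and "\<beta> \<in> carrier (poly_ring R)" "\<beta> \<noteq> []"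
  shows "extend_primes (\<lambda>P. f P \<otimes> g P) \<beta> = extend_primes f \<beta> \<otimes> extend_primes g \<beta>"
  using assms(3,4)
proof (induction \<beta> rule: poly_prime_induct)
  case (const a)
  have "(\<lambda>P. f P \<otimes> g P) \<in> monic_primes \<rightarrow> carrier R" using f g by auto
  then show ?case using extend_primes_const[OF _ const] f g by simp
next
  case (mult P \<gamma>)
  have fg: "(\<lambda>P. f P \<otimes> g P) \<in> monic_primes \<rightarrow> carrier R" using f g by auto
  show ?case
    using extend_primes_mult[OF fg mult(1-3)] extend_primes_mult[OF f mult(1-3)] extend_primes_mult[OF g mult(1-3)] mult
      extend_primes_closed[OF f mult(2,3)] extend_primes_closed[OF g mult(2,3)] f g by (simp add: Pi_iff m_ac)
qed

text \<open>
  Reciprocity passes from monic irreducible polynomials to all nonzero polynomials, one irreducible factor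
  at a time, first in \<open>\<alpha>\<close> and then in \<open>\<beta>\<close>. The hypothesis on reciprocity includes the trivial case \<open>P = Q\<close>, in
  which the symbols vanish in the application. Therefore the identity, written without inverses, requires no
  coprimality.
\<close>

lemma extend_primes_reciprocity:
  assumes ps: "\<And>\<alpha> P. \<alpha> \<in> carrier (poly_ring R) \<Longrightarrow> P \<in> monic_primes \<Longrightarrow> ps \<alpha> P \<in> carrier R"
    and ps_mult: "\<And>\<alpha> \<beta> P. \<alpha> \<in> carrier (poly_ring R) \<Longrightarrow> \<beta> \<in> carrier (poly_ring R) \<Longrightarrow> P \<in> monic_primes \<Longrightarrow>
      ps (\<alpha> \<otimes>\<^bsub>poly_ring R\<^esub> \<beta>) P = ps \<alpha> P \<otimes> ps \<beta> P"
    and sg: "\<And>a. a \<in> carrier R - {\<zero>} \<Longrightarrow> sg a \<in> carrier R"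
    and ps_const: "\<And>a P. a \<in> carrier R - {\<zero>} \<Longrightarrow> P \<in> monic_primes \<Longrightarrow>
      ps (poly_of_const a) P = sg a [^] degree P"
    and eps: "\<epsilon> \<in> carrier R"
    and recip: "\<And>P Q. P \<in> monic_primes \<Longrightarrow> Q \<in> monic_primes \<Longrightarrow>
      ps P Q = \<epsilon> [^] (degree P * degree Q) \<otimes> ps Q P"
    and \<alpha>: "\<alpha> \<in> carrier (poly_ring R)" "\<alpha> \<noteq> []" and \<beta>: "\<beta> \<in> carrier (poly_ring R)" "\<beta> \<noteq> []"
  shows "extend_primes (ps \<alpha>) \<beta> \<otimes> sg (lead_coeff \<beta>) [^] degree \<alpha> =
    \<epsilon> [^] (degree \<alpha> * degree \<beta>) \<otimes> sg (lead_coeff \<alpha>) [^] degree \<beta> \<otimes> extend_primes (ps \<beta>) \<alpha>"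
proof -
  interpret UP: domain "poly_ring R" by (rule univ_poly_is_domain[OF carrier_is_subring])
  let ?C = "carrier (poly_ring R)"
  have psF: "ps \<alpha> \<in> monic_primes \<rightarrow> carrier R" if "\<alpha> \<in> ?C" for \<alpha> using ps that by auto
  have md: "P \<otimes>\<^bsub>poly_ring R\<^esub> \<gamma> \<in> ?C" "degree (P \<otimes>\<^bsub>poly_ring R\<^esub> \<gamma>) = degree P + degree \<gamma>"
    "lead_coeff (P \<otimes>\<^bsub>poly_ring R\<^esub> \<gamma>) = lead_coeff \<gamma>" "lead_coeff \<gamma> \<in> carrier R - {\<zero>}" "P \<in> ?C"
    if "P \<in> monic_primes" "\<gamma> \<in> ?C" "\<gamma> \<noteq> []" for P \<gamma>
    using pmult_degree[OF monic_primesD(1)[OF that(1)] that(2) monic_primesD(4)[OF that(1)] that(3)]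
      lead_coeff_nonzero[OF that(2,3)] monic_primesD(1,3)[OF that(1)] that by auto
  have const_num: "extend_primes (ps (poly_of_const b)) \<alpha> = sg b [^] degree \<alpha>"
    if b: "b \<in> carrier R - {\<zero>}" and "\<alpha> \<in> ?C" "\<alpha> \<noteq> []" for b \<alpha>
    using that(2,3)
  proof (induction \<alpha> rule: poly_prime_induct)
    case (const a)
    have "poly_of_const b \<in> ?C" using pconst[OF b] by simp
    then show ?case using extend_primes_const[OF psF const] pconst(1)[OF const] by simp
  next
    case (mult P \<gamma>)
    have "poly_of_const b \<in> ?C" using pconst[OF b] by simp
    then show ?case
      using extend_primes_mult[OF psF mult(1-3)] mult ps_const[OF b mult(1)] md(2)[OF mult(1-3)] sg[OF b]
      by (simp only: nat_pow_mult)
  qed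
  have prime: "ps \<alpha> P = \<epsilon> [^] (degree \<alpha> * degree P) \<otimes> sg (lead_coeff \<alpha>) [^] degree P \<otimes> extend_primes (ps P) \<alpha>"
    if P: "P \<in> monic_primes" and "\<alpha> \<in> ?C" "\<alpha> \<noteq> []" for \<alpha> P
    using that(2,3)
  proof (induction \<alpha> rule: poly_prime_induct)
    case (const a)
    then show ?case
      using ps_const[OF const P] extend_primes_const[OF psF[OF monic_primesD(1)[OF P]] const] pconst(1)[OF const] sg[OF const]
      by simp
  next
    case (mult Q \<gamma>)
    note m = md[OF mult(1-3)]
    have c: "ps P Q \<in> carrier R" "extend_primes (ps P) \<gamma> \<in> carrier R" "sg (lead_coeff \<gamma>) \<in> carrier R"
      using ps[OF monic_primesD(1)[OF P] mult(1)] extend_primes_closed[OF psF[OF monic_primesD(1)[OF P]] mult(2,3)] sg[OF m(4)] by auto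
    have "ps (Q \<otimes>\<^bsub>poly_ring R\<^esub> \<gamma>) P = (\<epsilon> [^] (degree Q * degree P) \<otimes> ps P Q) \<otimes>
      (\<epsilon> [^] (degree \<gamma> * degree P) \<otimes> sg (lead_coeff \<gamma>) [^] degree P \<otimes> extend_primes (ps P) \<gamma>)"
      using ps_mult[OF m(5) mult(2) P] recip[OF mult(1) P] mult(4) by simp
    also have "\<dots> = (\<epsilon> [^] (degree Q * degree P) \<otimes> \<epsilon> [^] (degree \<gamma> * degree P)) \<otimes>
      sg (lead_coeff \<gamma>) [^] degree P \<otimes> (ps P Q \<otimes> extend_primes (ps P) \<gamma>)"
      using c eps by (simp add: m_ac del: One_nat_def)
    also have "\<epsilon> [^] (degree Q * degree P) \<otimes> \<epsilon> [^] (degree \<gamma> * degree P) = \<epsilon> [^] ((degree Q + degree \<gamma>) * degree P)"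
      using eps by (simp only: nat_pow_mult distrib_right)
    finally show ?case
      using extend_primes_mult[OF psF[OF monic_primesD(1)[OF P]] mult(1-3)] m by simp
  qed
  from \<beta> show ?thesis
  proof (induction \<beta> rule: poly_prime_induct)
    case (const b)
    then show ?case
      using extend_primes_const[OF psF[OF \<alpha>(1)] const] const_num[OF const \<alpha>] pconst(1)[OF const] sg[OF const]
      by simp
  next
    case (mult P \<gamma>)
    note m = md[OF mult(1-3)]
    have la: "lead_coeff \<alpha> \<in> carrier R - {\<zero>}" by (rule lead_coeff_nonzero[OF \<alpha>])
    have c: "extend_primes (ps P) \<alpha> \<in> carrier R" "extend_primes (ps \<gamma>) \<alpha> \<in> carrier R" "extend_primes (ps \<alpha>) \<gamma> \<in> carrier R"
       "sg (lead_coeff \<gamma>) \<in> carrier R" "sg (lead_coeff \<alpha>) \<in> carrier R" "ps \<alpha> P \<in> carrier R"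
      using extend_primes_closed[OF psF[OF m(5)] \<alpha>] extend_primes_closed[OF psF[OF mult(2)] \<alpha>]
        extend_primes_closed[OF psF[OF \<alpha>(1)] mult(2,3)] sg[OF m(4)] sg[OF la] ps[OF \<alpha>(1) mult(1)] by auto
    have "extend_primes (ps (P \<otimes>\<^bsub>poly_ring R\<^esub> \<gamma>)) \<alpha> = extend_primes (\<lambda>Q. ps P Q \<otimes> ps \<gamma> Q) \<alpha>"
      by (rule extend_primes_cong[OF psF[OF m(1)] _ \<alpha>]) (rule ps_mult[OF m(5) mult(2)])
    then have split: "extend_primes (ps (P \<otimes>\<^bsub>poly_ring R\<^esub> \<gamma>)) \<alpha> = extend_primes (ps P) \<alpha> \<otimes> extend_primes (ps \<gamma>) \<alpha>"
      using extend_primes_multf[OF psF[OF m(5)] psF[OF mult(2)] \<alpha>] by simp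
    have "extend_primes (ps \<alpha>) (P \<otimes>\<^bsub>poly_ring R\<^esub> \<gamma>) \<otimes> sg (lead_coeff \<gamma>) [^] degree \<alpha> =
      ps \<alpha> P \<otimes> (extend_primes (ps \<alpha>) \<gamma> \<otimes> sg (lead_coeff \<gamma>) [^] degree \<alpha>)"
      using extend_primes_mult[OF psF[OF \<alpha>(1)] mult(1-3)] c by (simp add: m_assoc)
    also have "\<dots> = (\<epsilon> [^] (degree \<alpha> * degree P) \<otimes> sg (lead_coeff \<alpha>) [^] degree P \<otimes> extend_primes (ps P) \<alpha>) \<otimes>
      (\<epsilon> [^] (degree \<alpha> * degree \<gamma>) \<otimes> sg (lead_coeff \<alpha>) [^] degree \<gamma> \<otimes> extend_primes (ps \<gamma>) \<alpha>)"
      using mult(4) prime[OF mult(1) \<alpha>] by simp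
    also have "\<dots> = (\<epsilon> [^] (degree \<alpha> * degree P) \<otimes> \<epsilon> [^] (degree \<alpha> * degree \<gamma>)) \<otimes>
      (sg (lead_coeff \<alpha>) [^] degree P \<otimes> sg (lead_coeff \<alpha>) [^] degree \<gamma>) \<otimes>
      (extend_primes (ps P) \<alpha> \<otimes> extend_primes (ps \<gamma>) \<alpha>)"
      using c eps by (simp add: m_ac del: One_nat_def)
    also have "\<epsilon> [^] (degree \<alpha> * degree P) \<otimes> \<epsilon> [^] (degree \<alpha> * degree \<gamma>) = \<epsilon> [^] (degree \<alpha> * (degree P + degree \<gamma>))"
      using eps by (simp only: nat_pow_mult distrib_left)
    also have "sg (lead_coeff \<alpha>) [^] degree P \<otimes> sg (lead_coeff \<alpha>) [^] degree \<gamma> = sg (lead_coeff \<alpha>) [^] (degree P + degree \<gamma>)"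
      using c by (simp only: nat_pow_mult)
    finally show ?case using split m by simp
  qed
qed

end

section \<open>Ultraproducts of rings\<close>

lemma ulim_eq_iff: "ulim D a = ulim D b \<longleftrightarrow> (\<forall>\<^sub>F s in D. a s = b s)"
proof
  assume "ulim D a = ulim D b"
  moreover have "a \<in> ulim D a" by (simp add: ulim_def)
  ultimately have "a \<in> ulim D b" by simp
  then show "\<forall>\<^sub>F s in D. a s = b s" by (simp add: ulim_def)
next
  assume *: "\<forall>\<^sub>F s in D. a s = b s"
  have "(\<forall>\<^sub>F s in D. c s = a s) \<longleftrightarrow> (\<forall>\<^sub>F s in D. c s = b s)" for c
    by (auto elim!: eventually_elim2[OF *])
  then show "ulim D a = ulim D b" by (simp add: ulim_def)
qed

lemma eventually_rep_ulim: "\<forall>\<^sub>F s in D. rep (ulim D a) s = a s"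
proof -
  have "a \<in> ulim D a" by (simp add: ulim_def)
  then have "rep (ulim D a) \<in> ulim D a" unfolding rep_def by (rule someI[of "\<lambda>b. b \<in> ulim D a"])
  then show ?thesis by (simp add: ulim_def)
qed

lemma ulim_in_carrier_iff:
  "ulim D a \<in> carrier (ultraring D R) \<longleftrightarrow> (\<forall>\<^sub>F s in D. a s \<in> carrier (R s))"
proof
  assume "ulim D a \<in> carrier (ultraring D R)"
  then obtain b where "ulim D a = ulim D b" "\<forall>\<^sub>F s in D. b s \<in> carrier (R s)"
    by (auto simp: ultraring_def ultraproduct_def)
  then show "\<forall>\<^sub>F s in D. a s \<in> carrier (R s)"
    unfolding ulim_eq_iff by (auto elim: eventually_elim2)
qed (auto simp: ultraring_def ultraproduct_def)

lemma ultraring_carrierE: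
  assumes "x \<in> carrier (ultraring D R)"
  obtains a where "x = ulim D a" "\<forall>\<^sub>F s in D. a s \<in> carrier (R s)"
  using assms by (auto simp: ultraring_def ultraproduct_def)

lemma ulim_rep: "x \<in> carrier (ultraring D R) \<Longrightarrow> ulim D (rep x) = x"
  by (erule ultraring_carrierE) (simp add: ulim_eq_iff eventually_rep_ulim)

lemma eventually_rep_carrier: "x \<in> carrier (ultraring D R) \<Longrightarrow> \<forall>\<^sub>F s in D. rep x s \<in> carrier (R s)"
  using ulim_in_carrier_iff ulim_rep by metis

lemma ultraring_one: "\<one>\<^bsub>ultraring D R\<^esub> = ulim D (\<lambda>s. \<one>\<^bsub>R s\<^esub>)"
  and ultraring_zero: "\<zero>\<^bsub>ultraring D R\<^esub> = ulim D (\<lambda>s. \<zero>\<^bsub>R s\<^esub>)"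
  by (simp_all add: ultraring_def)

lemma ulim_mult: "ulim D a \<otimes>\<^bsub>ultraring D R\<^esub> ulim D b = ulim D (\<lambda>s. a s \<otimes>\<^bsub>R s\<^esub> b s)"
  and ulim_add: "ulim D a \<oplus>\<^bsub>ultraring D R\<^esub> ulim D b = ulim D (\<lambda>s. a s \<oplus>\<^bsub>R s\<^esub> b s)"
  unfolding ultraring_def
  by (auto simp: ulim_eq_iff intro: eventually_elim2[OF eventually_rep_ulim[of D a] eventually_rep_ulim[of D b]])

lemma ulim_nat_pow: "ulim D a [^]\<^bsub>ultraring D R\<^esub> (k :: nat) = ulim D (\<lambda>s. a s [^]\<^bsub>R s\<^esub> k)"
  by (induction k) (simp_all add: ultraring_one ulim_mult)

lemma hyper_pow_ulim: "hyper_pow D R (ulim D a) (ulim D e) = ulim D (\<lambda>s. a s [^]\<^bsub>R s\<^esub> e s)"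
  unfolding hyper_pow_def
  by (auto simp: ulim_eq_iff intro: eventually_elim2[OF eventually_rep_ulim[of D a] eventually_rep_ulim[of D e]])

lemma cring_ultraring:
  assumes R: "\<forall>\<^sub>F s in D. cring (R s)"
  shows "cring (ultraring D R)"
proof -
  note defs = ulim_mult ulim_add ulim_in_carrier_iff ulim_eq_iff ultraring_one ultraring_zero
  note laws = cring.cring_simprules
  have c2: "\<forall>\<^sub>F s in D. a s \<otimes>\<^bsub>R s\<^esub> b s \<in> carrier (R s)" "\<forall>\<^sub>F s in D. a s \<oplus>\<^bsub>R s\<^esub> b s \<in> carrier (R s)"
    "\<forall>\<^sub>F s in D. a s \<otimes>\<^bsub>R s\<^esub> b s = b s \<otimes>\<^bsub>R s\<^esub> a s" "\<forall>\<^sub>F s in D. a s \<oplus>\<^bsub>R s\<^esub> b s = b s \<oplus>\<^bsub>R s\<^esub> a s"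
    if "\<forall>\<^sub>F s in D. a s \<in> carrier (R s)" "\<forall>\<^sub>F s in D. b s \<in> carrier (R s)" for a b
    using R that by (eventually_elim; simp add: laws)+
  have c3: "\<forall>\<^sub>F s in D. a s \<otimes>\<^bsub>R s\<^esub> b s \<otimes>\<^bsub>R s\<^esub> c s = a s \<otimes>\<^bsub>R s\<^esub> (b s \<otimes>\<^bsub>R s\<^esub> c s)"
    "\<forall>\<^sub>F s in D. a s \<oplus>\<^bsub>R s\<^esub> b s \<oplus>\<^bsub>R s\<^esub> c s = a s \<oplus>\<^bsub>R s\<^esub> (b s \<oplus>\<^bsub>R s\<^esub> c s)"
    "\<forall>\<^sub>F s in D. (a s \<oplus>\<^bsub>R s\<^esub> b s) \<otimes>\<^bsub>R s\<^esub> c s = a s \<otimes>\<^bsub>R s\<^esub> c s \<oplus>\<^bsub>R s\<^esub> b s \<otimes>\<^bsub>R s\<^esub> c s"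
    if "\<forall>\<^sub>F s in D. a s \<in> carrier (R s)" "\<forall>\<^sub>F s in D. b s \<in> carrier (R s)"
      "\<forall>\<^sub>F s in D. c s \<in> carrier (R s)" for a b c
    using R that by (eventually_elim; simp add: laws)+
  have c1: "\<forall>\<^sub>F s in D. \<one>\<^bsub>R s\<^esub> \<in> carrier (R s)" "\<forall>\<^sub>F s in D. \<zero>\<^bsub>R s\<^esub> \<in> carrier (R s)"
    using R by (eventually_elim; simp add: laws)+
  have c0: "(\<forall>\<^sub>F s in D. \<one>\<^bsub>R s\<^esub> \<otimes>\<^bsub>R s\<^esub> a s = a s) \<and>
    (\<forall>\<^sub>F s in D. \<zero>\<^bsub>R s\<^esub> \<oplus>\<^bsub>R s\<^esub> a s = a s) \<and> (\<forall>\<^sub>F s in D. \<ominus>\<^bsub>R s\<^esub> a s \<in> carrier (R s)) \<and> (\<forall>\<^sub>F s in D. \<ominus>\<^bsub>R s\<^esub> a s \<oplus>\<^bsub>R s\<^esub> a s = \<zero>\<^bsub>R s\<^esub>)"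
    if "\<forall>\<^sub>F s in D. a s \<in> carrier (R s)" for a
    unfolding eventually_conj_iff[symmetric] using R that by eventually_elim (auto intro: laws)
  show ?thesis
  proof (rule cringI)
    show "abelian_group (ultraring D R)"
    proof (rule abelian_groupI)
      fix x assume "x \<in> carrier (ultraring D R)"
      then obtain a where a: "x = ulim D a" "\<forall>\<^sub>F s in D. a s \<in> carrier (R s)"
        by (rule ultraring_carrierE)
      show "\<exists>y\<in>carrier (ultraring D R). y \<oplus>\<^bsub>ultraring D R\<^esub> x = \<zero>\<^bsub>ultraring D R\<^esub>"
        by (rule bexI[of _ "ulim D (\<lambda>s. \<ominus>\<^bsub>R s\<^esub> a s)"]) (simp_all add: a(1) defs c0[OF a(2)])
    qed ((elim ultraring_carrierE)?; simp add: defs c0 c1 c2 c3)+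
    show "comm_monoid (ultraring D R)"
      by (rule comm_monoidI) ((elim ultraring_carrierE)?; simp add: defs c0 c1 c2 c3)+
  qed ((elim ultraring_carrierE)?; simp add: defs c0 c1 c2 c3)+
qed

lemma ulim_uminus:
  assumes R: "\<forall>\<^sub>F s in D. cring (R s)" and a: "\<forall>\<^sub>F s in D. a s \<in> carrier (R s)"
  shows "\<ominus>\<^bsub>ultraring D R\<^esub> ulim D a = ulim D (\<lambda>s. \<ominus>\<^bsub>R s\<^esub> a s)"
proof -
  interpret U: cring "ultraring D R" by (rule cring_ultraring[OF R])
  have "\<forall>\<^sub>F s in D. \<ominus>\<^bsub>R s\<^esub> a s \<in> carrier (R s)" "\<forall>\<^sub>F s in D. \<ominus>\<^bsub>R s\<^esub> a s \<oplus>\<^bsub>R s\<^esub> a s = \<zero>\<^bsub>R s\<^esub>"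
    using R a by (eventually_elim; simp add: cring.cring_simprules)+
  then show ?thesis
    using a by (intro U.minus_equality) (simp_all add: ulim_add ultraring_zero ulim_eq_iff ulim_in_carrier_iff)
qed

lemma ulim_minus:
  assumes R: "\<forall>\<^sub>F s in D. cring (R s)" and b: "\<forall>\<^sub>F s in D. b s \<in> carrier (R s)"
  shows "ulim D a \<ominus>\<^bsub>ultraring D R\<^esub> ulim D b = ulim D (\<lambda>s. a s \<ominus>\<^bsub>R s\<^esub> b s)"
  unfolding a_minus_def by (simp add: ulim_uminus[OF R b] ulim_add)

lemma ulim_in_cgenideal_iff:
  assumes "\<forall>\<^sub>F s in D. cring (R s)"
  shows "ulim D a \<in> PIdl\<^bsub>ultraring D R\<^esub> (ulim D b) \<longleftrightarrow> (\<forall>\<^sub>F s in D. \<exists>c\<in>carrier (R s). a s = c \<otimes>\<^bsub>R s\<^esub> b s)"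
proof
  assume "ulim D a \<in> PIdl\<^bsub>ultraring D R\<^esub> (ulim D b)"
  then obtain c where "\<forall>\<^sub>F s in D. c s \<in> carrier (R s)" "\<forall>\<^sub>F s in D. a s = c s \<otimes>\<^bsub>R s\<^esub> b s"
    unfolding cgenideal_def by (auto elim!: ultraring_carrierE simp: ulim_mult ulim_eq_iff)
  then show "\<forall>\<^sub>F s in D. \<exists>c\<in>carrier (R s). a s = c \<otimes>\<^bsub>R s\<^esub> b s"
    by eventually_elim blast
next
  assume *: "\<forall>\<^sub>F s in D. \<exists>c\<in>carrier (R s). a s = c \<otimes>\<^bsub>R s\<^esub> b s"
  define c where "c s = (SOME c. c \<in> carrier (R s) \<and> a s = c \<otimes>\<^bsub>R s\<^esub> b s)" for s
  have "\<forall>\<^sub>F s in D. c s \<in> carrier (R s) \<and> a s = c s \<otimes>\<^bsub>R s\<^esub> b s"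
    using * unfolding c_def by eventually_elim (rule someI_ex, blast)
  then have "ulim D c \<in> carrier (ultraring D R)" "ulim D a = ulim D c \<otimes>\<^bsub>ultraring D R\<^esub> ulim D b"
    by (auto simp: ulim_mult ulim_eq_iff ulim_in_carrier_iff eventually_conj_iff)
  then show "ulim D a \<in> PIdl\<^bsub>ultraring D R\<^esub> (ulim D b)" unfolding cgenideal_def by blast
qed

lemma hyper_quot_ulim:
  assumes "\<forall>\<^sub>F s in D. b s \<noteq> 0 \<and> b s dvd a s"
  shows "hyper_quot D (ulim D a) (ulim D b) = ulim D (\<lambda>s. a s div b s)"
  unfolding hyper_quot_def
proof (rule the_equality)
  show "ulim D (\<lambda>s. a s div b s) \<in> carrier (hyperints D) \<and>
    ulim D a = ulim D b \<otimes>\<^bsub>hyperints D\<^esub> ulim D (\<lambda>s. a s div b s)"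
    using assms by (auto simp: ulim_in_carrier_iff ulim_mult ulim_eq_iff elim!: eventually_mono)
next
  fix x assume x: "x \<in> carrier (hyperints D) \<and> ulim D a = ulim D b \<otimes>\<^bsub>hyperints D\<^esub> x"
  then obtain c where c: "x = ulim D c" by (auto elim: ultraring_carrierE)
  with x have "\<forall>\<^sub>F s in D. a s = b s * c s" by (simp add: ulim_mult ulim_eq_iff)
  with assms have "\<forall>\<^sub>F s in D. c s = a s div b s" by eventually_elim auto
  then show "x = ulim D (\<lambda>s. a s div b s)" by (simp add: c ulim_eq_iff)
qed

text \<open>
  An ultrafilter, as a proper filter that decides every property. Consequently it also picks one of finitely
  many cases (\<open>eventually_constant\<close>).
\<close>

locale ultrafilter =
  fixes D :: "'s filter"
  assumes nonbot: "D \<noteq> bot" and decides: "eventually P D \<or> eventually (\<lambda>s. \<not> P s) D"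
begin

lemma not_eventually_iff: "\<not> eventually P D \<longleftrightarrow> eventually (\<lambda>s. \<not> P s) D"
proof
  assume "eventually (\<lambda>s. \<not> P s) D"
  then show "\<not> eventually P D"
    using nonbot eventually_conj[of P D "\<lambda>s. \<not> P s"] by (auto simp: eventually_False)
qed (use decides in blast)

lemma eventually_constant:
  fixes f :: "'s \<Rightarrow> nat"
  assumes "\<forall>\<^sub>F s in D. f s \<le> k"
  shows "\<exists>i\<le>k. \<forall>\<^sub>F s in D. f s = i"
proof (rule ccontr)
  assume "\<not> ?thesis"
  then have "\<forall>i\<in>{..k}. \<forall>\<^sub>F s in D. f s \<noteq> i" by (auto simp: not_eventually_iff[symmetric])
  then have "\<forall>\<^sub>F s in D. \<forall>i\<in>{..k}. f s \<noteq> i" by (simp add: eventually_ball_finite)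
  with assms have "\<forall>\<^sub>F s in D. False" by eventually_elim auto
  then show False using nonbot by (simp add: eventually_False)
qed

lemma ulim_neq_iff: "ulim D a \<noteq> ulim D b \<longleftrightarrow> (\<forall>\<^sub>F s in D. a s \<noteq> b s)"
  by (simp add: ulim_eq_iff not_eventually_iff)

lemma field_ultraring:
  assumes F: "\<forall>\<^sub>F s in D. field (R s)"
  shows "field (ultraring D R)"
proof -
  have R: "\<forall>\<^sub>F s in D. cring (R s)"
    using F by eventually_elim (simp add: field.axioms domain.axioms)
  interpret U: cring "ultraring D R" by (rule cring_ultraring[OF R])
  show ?thesis
  proof (rule U.field_intro2)
    have "\<forall>\<^sub>F s in D. \<zero>\<^bsub>R s\<^esub> \<noteq> \<one>\<^bsub>R s\<^esub>" using F by eventually_elim (metis field.axioms(1) domain.one_not_zero)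
    then show "\<zero>\<^bsub>ultraring D R\<^esub> \<noteq> \<one>\<^bsub>ultraring D R\<^esub>" by (simp add: ultraring_zero ultraring_one ulim_neq_iff)
  next
    fix x assume x: "x \<in> carrier (ultraring D R) - {\<zero>\<^bsub>ultraring D R\<^esub>}"
    then obtain a where a: "x = ulim D a" "\<forall>\<^sub>F s in D. a s \<in> carrier (R s)" by (auto elim: ultraring_carrierE)
    with x have "\<forall>\<^sub>F s in D. a s \<noteq> \<zero>\<^bsub>R s\<^esub>" by (auto simp: ultraring_zero ulim_neq_iff)
    with F a(2) have *: "\<forall>\<^sub>F s in D. inv\<^bsub>R s\<^esub> a s \<in> carrier (R s) \<and> inv\<^bsub>R s\<^esub> a s \<otimes>\<^bsub>R s\<^esub> a s = \<one>\<^bsub>R s\<^esub>"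
    proof eventually_elim
      case (elim s)
      then interpret field "R s" by simp
      show ?case using elim field_Units by auto
    qed
    have "ulim D (\<lambda>s. inv\<^bsub>R s\<^esub> a s) \<in> carrier (ultraring D R)"
      "ulim D (\<lambda>s. inv\<^bsub>R s\<^esub> a s) \<otimes>\<^bsub>ultraring D R\<^esub> x = \<one>\<^bsub>ultraring D R\<^esub>"
      using * by (auto simp: a(1) ulim_in_carrier_iff ulim_mult ultraring_one ulim_eq_iff elim: eventually_mono)
    then show "x \<in> Units (ultraring D R)"
      using x U.m_comm unfolding Units_def by fastforce
  qed
qed

end

section \<open>Polynomials over an ultraproduct of finite fields\<close>

lemma int_ring_nat_pow: "x [^]\<^bsub>\<Z>\<^esub> (k :: nat) = x ^ k"
  by (induction k) (simp_all add: mult.commute)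

text \<open>
  The \<open>s\<close>-th component of a polynomial over an ultraproduct, obtained by choosing representatives of the
  coefficients. No normalization is applied: on a set of \<open>D\<close> the leading coefficient does not vanish.
\<close>

definition lift :: "'s \<Rightarrow> ('s \<Rightarrow> 'a) set list \<Rightarrow> 'a list" where
  "lift s p = map (\<lambda>c. rep c s) p"

lemma lift_simps [simp]: "lift s [] = []" "lift s (c # p) = rep c s # lift s p"
  "length (lift s p) = length p" "lift s p = [] \<longleftrightarrow> p = []" "lift s (p @ q) = lift s p @ lift s q"
  by (simp_all add: lift_def)

lemma lift_hd: "p \<noteq> [] \<Longrightarrow> lead_coeff (lift s p) = rep (lead_coeff p) s"
  by (cases p) auto

text \<open>A family of rings that are finite fields on a set of \<open>D\<close>.\<close>

locale ultra_finite_field = ultrafilter D for D :: "'s filter" +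
  fixes F :: "'s \<Rightarrow> ('a, 'b) ring_scheme"
  assumes finite_fields: "\<forall>\<^sub>F s in D. field (F s) \<and> finite (carrier (F s))"
begin

lemma fields: "\<forall>\<^sub>F s in D. field (F s)"
  using finite_fields by (simp add: eventually_conj_iff)

lemma crings: "\<forall>\<^sub>F s in D. cring (F s)"
  using fields by eventually_elim (simp add: field.axioms domain.axioms)

lemma poly_crings: "\<forall>\<^sub>F s in D. cring (poly_ring (F s))"
  using fields by eventually_elim
    (metis field.axioms(1) domain.univ_poly_is_cring field.carrier_is_subfield subfieldE(1))

sublocale K: field "ultraring D F" by (rule field_ultraring[OF fields])

sublocale KX: domain "poly_ring (ultraring D F)" by (rule K.univ_poly_is_domain[OF K.carrier_is_subring])

lemma rep_add: "x \<in> carrier (ultraring D F) \<Longrightarrow> y \<in> carrier (ultraring D F) \<Longrightarrow>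
    \<forall>\<^sub>F s in D. rep (x \<oplus>\<^bsub>ultraring D F\<^esub> y) s = rep x s \<oplus>\<^bsub>F s\<^esub> rep y s"
  unfolding ultraring_def by (simp add: eventually_rep_ulim)

lemma rep_mult: "x \<in> carrier (ultraring D F) \<Longrightarrow> y \<in> carrier (ultraring D F) \<Longrightarrow>
    \<forall>\<^sub>F s in D. rep (x \<otimes>\<^bsub>ultraring D F\<^esub> y) s = rep x s \<otimes>\<^bsub>F s\<^esub> rep y s"
  unfolding ultraring_def by (simp add: eventually_rep_ulim)

lemma rep_zero: "\<forall>\<^sub>F s in D. rep \<zero>\<^bsub>ultraring D F\<^esub> s = \<zero>\<^bsub>F s\<^esub>"
  unfolding ultraring_zero by (rule eventually_rep_ulim)

lemma rep_one: "\<forall>\<^sub>F s in D. rep \<one>\<^bsub>ultraring D F\<^esub> s = \<one>\<^bsub>F s\<^esub>"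
  unfolding ultraring_one by (rule eventually_rep_ulim)

lemma rep_neq_zero:
  assumes "x \<in> carrier (ultraring D F)" "x \<noteq> \<zero>\<^bsub>ultraring D F\<^esub>"
  shows "\<forall>\<^sub>F s in D. rep x s \<noteq> \<zero>\<^bsub>F s\<^esub>"
  using assms ulim_rep[OF assms(1)] ulim_neq_iff[of "rep x" "\<lambda>s. \<zero>\<^bsub>F s\<^esub>"] by (simp add: ultraring_zero)

lemma lift_set_carrier:
  "set p \<subseteq> carrier (ultraring D F) \<Longrightarrow> \<forall>\<^sub>F s in D. set (lift s p) \<subseteq> carrier (F s)"
proof (induction p)
  case (Cons c p)
  then have "\<forall>\<^sub>F s in D. rep c s \<in> carrier (F s)" by (simp add: eventually_rep_carrier)
  then show ?case using Cons by (simp add: eventually_conj_iff)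
qed simp

lemma lift_normalize:
  "set p \<subseteq> carrier (ultraring D F) \<Longrightarrow> \<forall>\<^sub>F s in D. lift s (K.normalize p) = ring.normalize (F s) (lift s p)"
proof (induction p)
  case Nil
  show ?case using crings by eventually_elim (simp add: cring.axioms ring.normalize.simps)
next
  case (Cons c p)
  show ?case
  proof (cases "c = \<zero>\<^bsub>ultraring D F\<^esub>")
    case True
    have "\<forall>\<^sub>F s in D. lift s (K.normalize p) = ring.normalize (F s) (lift s p)" using Cons by simp
    then show ?thesis
      using rep_zero crings by eventually_elim (simp add: True cring.axioms ring.normalize.simps)
  next
    case False
    then have "\<forall>\<^sub>F s in D. rep c s \<noteq> \<zero>\<^bsub>F s\<^esub>" using Cons rep_neq_zero by simp
    then show ?thesis using crings
      by eventually_elim (simp add: False cring.axioms ring.normalize.simps)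
  qed
qed

lemma lift_map2:
  "set p \<subseteq> carrier (ultraring D F) \<Longrightarrow> set q \<subseteq> carrier (ultraring D F) \<Longrightarrow>
    \<forall>\<^sub>F s in D. lift s (map2 (\<oplus>\<^bsub>ultraring D F\<^esub>) p q) = map2 (\<oplus>\<^bsub>F s\<^esub>) (lift s p) (lift s q)"
proof (induction p arbitrary: q)
  case (Cons c p)
  show ?case
  proof (cases q)
    case (Cons b r)
    have "\<forall>\<^sub>F s in D. lift s (map2 (\<oplus>\<^bsub>ultraring D F\<^esub>) p r) = map2 (\<oplus>\<^bsub>F s\<^esub>) (lift s p) (lift s r)"
      "\<forall>\<^sub>F s in D. rep (c \<oplus>\<^bsub>ultraring D F\<^esub> b) s = rep c s \<oplus>\<^bsub>F s\<^esub> rep b s"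
      using Cons.IH[of r] Cons.prems rep_add[of c b] Cons by auto
    then show ?thesis unfolding Cons by eventually_elim simp
  qed simp
qed simp

lemma lift_replicate: "\<forall>\<^sub>F s in D. lift s (replicate k \<zero>\<^bsub>ultraring D F\<^esub>) = replicate k \<zero>\<^bsub>F s\<^esub>"
  using rep_zero by eventually_elim (simp add: lift_def)

lemma lift_poly_add_aux:
  assumes p: "set p \<subseteq> carrier (ultraring D F)" and q: "set q \<subseteq> carrier (ultraring D F)"
    and le: "length q \<le> length p"
  shows "\<forall>\<^sub>F s in D. lift s (K.poly_add p q) = ring.poly_add (F s) (lift s p) (lift s q)"
proof -
  let ?r = "replicate (length p - length q) \<zero>\<^bsub>ultraring D F\<^esub> @ q"
  have r: "set ?r \<subseteq> carrier (ultraring D F)" using q by auto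
  have m: "set (map2 (\<oplus>\<^bsub>ultraring D F\<^esub>) p ?r) \<subseteq> carrier (ultraring D F)"
  proof
    fix x assume "x \<in> set (map2 (\<oplus>\<^bsub>ultraring D F\<^esub>) p ?r)"
    then obtain a b where ab: "(a, b) \<in> set (zip p ?r)" "x = a \<oplus>\<^bsub>ultraring D F\<^esub> b"
      unfolding set_map by (elim imageE) (simp add: split_paired_all)
    have "a \<in> carrier (ultraring D F)" "b \<in> carrier (ultraring D F)"
      using set_zip_leftD[OF ab(1)] set_zip_rightD[OF ab(1)] p r by blast+
    then show "x \<in> carrier (ultraring D F)" using ab(2) by simp
  qed
  have eq: "K.poly_add p q = K.normalize (map2 (\<oplus>\<^bsub>ultraring D F\<^esub>) p ?r)"
    using le by (subst K.poly_add.simps) simp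
  show ?thesis
    unfolding eq using lift_normalize[OF m] lift_map2[OF p r] lift_replicate[of "length p - length q"] crings
  proof eventually_elim
    case (elim s)
    then show ?case using le by (subst ring.poly_add.simps) (simp_all add: cring.axioms)
  qed
qed

lemma lift_poly_add:
  assumes p: "set p \<subseteq> carrier (ultraring D F)" and q: "set q \<subseteq> carrier (ultraring D F)"
  shows "\<forall>\<^sub>F s in D. lift s (K.poly_add p q) = ring.poly_add (F s) (lift s p) (lift s q)"
proof (cases "length q \<le> length p")
  case False
  have "\<forall>\<^sub>F s in D. lift s (K.poly_add q p) = ring.poly_add (F s) (lift s q) (lift s p)"
    using lift_poly_add_aux[OF q p] False by simp
  then show ?thesis
    using lift_set_carrier[OF p] lift_set_carrier[OF q] crings
    by eventually_elim (metis K.poly_add_comm[OF p q] ring.poly_add_comm cring.axioms(1))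
qed (rule lift_poly_add_aux[OF p q])

lemma lift_poly_mult:
  assumes q: "set q \<subseteq> carrier (ultraring D F)"
  shows "set p \<subseteq> carrier (ultraring D F) \<Longrightarrow>
    \<forall>\<^sub>F s in D. lift s (K.poly_mult p q) = ring.poly_mult (F s) (lift s p) (lift s q)"
proof (induction p)
  case Nil
  show ?case using crings by eventually_elim (simp add: cring.axioms ring.poly_mult.simps)
next
  case (Cons c p)
  have c: "c \<in> carrier (ultraring D F)" "set p \<subseteq> carrier (ultraring D F)" using Cons.prems by auto
  let ?t = "map (\<lambda>a. c \<otimes>\<^bsub>ultraring D F\<^esub> a) q @ replicate (length p) \<zero>\<^bsub>ultraring D F\<^esub>"
  have t: "set ?t \<subseteq> carrier (ultraring D F)" using q c by auto
  have "\<forall>a\<in>set q. \<forall>\<^sub>F s in D. rep (c \<otimes>\<^bsub>ultraring D F\<^esub> a) s = rep c s \<otimes>\<^bsub>F s\<^esub> rep a s"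
    using rep_mult c q by blast
  then have ml: "\<forall>\<^sub>F s in D. \<forall>a\<in>set q. rep (c \<otimes>\<^bsub>ultraring D F\<^esub> a) s = rep c s \<otimes>\<^bsub>F s\<^esub> rep a s"
    by (simp add: eventually_ball_finite)
  have eq: "K.poly_mult (c # p) q = K.poly_add ?t (K.poly_mult p q)" by simp
  show ?case
    unfolding eq
    using lift_poly_add[OF t K.poly_mult_in_carrier[OF c(2) q]] Cons.IH[OF c(2)] ml
      lift_replicate[of "length p"] crings
  proof eventually_elim
    case (elim s)
    then have "lift s ?t = map (\<lambda>a. rep c s \<otimes>\<^bsub>F s\<^esub> a) (lift s q) @ replicate (length p) \<zero>\<^bsub>F s\<^esub>"
      by (simp add: lift_def)
    then show ?case using elim by (simp add: cring.axioms ring.poly_mult.simps)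
  qed
qed

lemma poly_set_carrier: "p \<in> carrier (poly_ring (ultraring D F)) \<Longrightarrow> set p \<subseteq> carrier (ultraring D F)"
  by (auto simp: univ_poly_carrier[symmetric] polynomial_def)

lemma lift_mult:
  assumes "p \<in> carrier (poly_ring (ultraring D F))" "q \<in> carrier (poly_ring (ultraring D F))"
  shows "\<forall>\<^sub>F s in D. lift s (p \<otimes>\<^bsub>poly_ring (ultraring D F)\<^esub> q) = lift s p \<otimes>\<^bsub>poly_ring (F s)\<^esub> lift s q"
  using lift_poly_mult[OF poly_set_carrier[OF assms(2)] poly_set_carrier[OF assms(1)]]
  by (simp add: univ_poly_mult)

lemma lift_carrier:
  assumes "p \<in> carrier (poly_ring (ultraring D F))"
  shows "\<forall>\<^sub>F s in D. lift s p \<in> carrier (poly_ring (F s))"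
proof (cases p)
  case (Cons c q)
  then have "c \<in> carrier (ultraring D F)" "c \<noteq> \<zero>\<^bsub>ultraring D F\<^esub>"
    using assms by (auto simp: univ_poly_carrier[symmetric] polynomial_def)
  then have "\<forall>\<^sub>F s in D. rep c s \<noteq> \<zero>\<^bsub>F s\<^esub>" by (rule rep_neq_zero)
  then show ?thesis
    using lift_set_carrier[OF poly_set_carrier[OF assms]]
    by eventually_elim (simp add: univ_poly_carrier[symmetric] polynomial_def Cons)
qed (simp add: univ_poly_zero_closed)

lemma lift_const:
  assumes "c \<in> carrier (ultraring D F)"
  shows "\<forall>\<^sub>F s in D. lift s (K.poly_of_const c) = ring.poly_of_const (F s) (rep c s)"
proof -
  have "\<forall>\<^sub>F s in D. lift s (K.normalize [c]) = ring.normalize (F s) (lift s [c])"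
    using lift_normalize[of "[c]"] assms by simp
  then show ?thesis
    using crings unfolding K.poly_of_const_def
    by eventually_elim (simp add: ring.poly_of_const_def cring.axioms(1) del: K.normalize.simps)
qed

lemma lift_inject:
  assumes "p \<in> carrier (poly_ring (ultraring D F))" "q \<in> carrier (poly_ring (ultraring D F))"
    and eq: "\<forall>\<^sub>F s in D. lift s p = lift s q"
  shows "p = q"
proof (rule nth_equalityI)
  have "\<forall>\<^sub>F s in D. length p = length q"
    using eq by eventually_elim (metis lift_simps(3))
  then show len: "length p = length q" using nonbot by simp
  fix i assume i: "i < length p"
  have pq: "p ! i \<in> carrier (ultraring D F)" "q ! i \<in> carrier (ultraring D F)"
    using poly_set_carrier assms(1,2) i len nth_mem by (metis subsetD)+
  have "\<forall>\<^sub>F s in D. rep (p ! i) s = rep (q ! i) s"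
    using eq by eventually_elim (metis i len lift_def nth_map)
  then show "p ! i = q ! i" using ulim_rep[OF pq(1)] ulim_rep[OF pq(2)] by (metis ulim_eq_iff)
qed

text \<open>
  Every family of polynomials of bounded degree comes from a polynomial over the ultraproduct, because its degree
  is constant on a set of \<open>D\<close>.
\<close>

lemma lift_surj:
  assumes l: "\<forall>\<^sub>F s in D. l s \<in> carrier (poly_ring (F s)) \<and> length (l s) \<le> k"
  shows "\<exists>p\<in>carrier (poly_ring (ultraring D F)). \<forall>\<^sub>F s in D. lift s p = l s"
proof -
  have l1: "\<forall>\<^sub>F s in D. l s \<in> carrier (poly_ring (F s))" and l2: "\<forall>\<^sub>F s in D. length (l s) \<le> k"
    using l by (auto elim: eventually_mono)
  obtain j where j: "\<forall>\<^sub>F s in D. length (l s) = j"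
    using eventually_constant[OF l2] by blast
  define p where "p = map (\<lambda>i. ulim D (\<lambda>s. l s ! i)) [0..<j]"
  have "\<forall>\<^sub>F s in D. \<forall>i\<in>{..<j}. rep (ulim D (\<lambda>s. l s ! i)) s = l s ! i"
    by (simp add: eventually_ball_finite eventually_rep_ulim)
  then have lift: "\<forall>\<^sub>F s in D. lift s p = l s"
    using j by eventually_elim (auto simp: p_def lift_def intro!: nth_equalityI)
  have "p \<in> carrier (poly_ring (ultraring D F))"
  proof (cases "j = 0")
    case True
    then show ?thesis by (simp add: p_def univ_poly_zero_closed)
  next
    case False
    have "\<forall>\<^sub>F s in D. l s ! i \<in> carrier (F s)" if "i < j" for i
      using l1 j by eventually_elim (use that nth_mem in \<open>fastforce simp: univ_poly_carrier[symmetric] polynomial_def\<close>)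
    moreover have "\<forall>\<^sub>F s in D. l s ! 0 \<noteq> \<zero>\<^bsub>F s\<^esub>"
      using l1 j by eventually_elim (use False in \<open>auto simp: univ_poly_carrier[symmetric] polynomial_def hd_conv_nth\<close>)
    ultimately show ?thesis
      using False by (auto simp: p_def univ_poly_carrier[symmetric] polynomial_def ulim_in_carrier_iff
        ultraring_zero ulim_neq_iff hd_map)
  qed
  then show ?thesis using lift by blast
qed

lemma lift_pdivides_iff:
  assumes p: "p \<in> carrier (poly_ring (ultraring D F))" and q: "q \<in> carrier (poly_ring (ultraring D F))"
  shows "p pdivides\<^bsub>ultraring D F\<^esub> q \<longleftrightarrow> (\<forall>\<^sub>F s in D. lift s p pdivides\<^bsub>F s\<^esub> lift s q)"
proof
  assume "p pdivides\<^bsub>ultraring D F\<^esub> q"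
  then obtain r where r: "r \<in> carrier (poly_ring (ultraring D F))" "q = p \<otimes>\<^bsub>poly_ring (ultraring D F)\<^esub> r"
    by (auto simp: pdivides_def factor_def)
  show "\<forall>\<^sub>F s in D. lift s p pdivides\<^bsub>F s\<^esub> lift s q"
    using lift_mult[OF p r(1)] lift_carrier[OF r(1)] unfolding r(2)
    by eventually_elim (auto simp: pdivides_def factor_def)
next
  assume *: "\<forall>\<^sub>F s in D. lift s p pdivides\<^bsub>F s\<^esub> lift s q"
  show "p pdivides\<^bsub>ultraring D F\<^esub> q"
  proof (cases "q = []")
    case True
    then show ?thesis using K.pdivides_zero[OF K.carrier_is_subring p] by simp
  next
    case False
    define c where "c s = (SOME c. c \<in> carrier (poly_ring (F s)) \<and> lift s q = lift s p \<otimes>\<^bsub>poly_ring (F s)\<^esub> c)" for s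
    have c: "\<forall>\<^sub>F s in D. c s \<in> carrier (poly_ring (F s)) \<and> lift s q = lift s p \<otimes>\<^bsub>poly_ring (F s)\<^esub> c s"
      using * unfolding c_def pdivides_def factor_def by eventually_elim (rule someI_ex, blast)
    have "\<forall>\<^sub>F s in D. c s \<in> carrier (poly_ring (F s)) \<and> length (c s) \<le> length q"
      using c fields lift_carrier[OF p] lift_carrier[OF q]
    proof eventually_elim
      case (elim s)
      interpret f: field "F s" using elim by simp
      interpret fX: domain "poly_ring (F s)" by (rule f.univ_poly_is_domain[OF f.carrier_is_subring])
      have "lift s q \<noteq> []" using False by simp
      then have ne: "lift s p \<noteq> []" "c s \<noteq> []"
        using elim fX.l_null[of "c s"] fX.r_null[of "lift s p"] by (auto simp: univ_poly_zero)
      have "degree (lift s q) = degree (lift s p) + degree (c s)" "length (c s) > 0" "length (lift s q) > 0"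
        using f.pmult_degree(2)[OF _ _ ne] elim ne \<open>lift s q \<noteq> []\<close> by (simp_all del: lift_simps)
      then have "length (c s) \<le> length (lift s q)" by linarith
      then show ?case using elim(1) unfolding lift_simps(3) by blast
    qed
    then obtain r where r: "r \<in> carrier (poly_ring (ultraring D F))" "\<forall>\<^sub>F s in D. lift s r = c s"
      using lift_surj by blast
    have "\<forall>\<^sub>F s in D. lift s q = lift s (p \<otimes>\<^bsub>poly_ring (ultraring D F)\<^esub> r)"
      using r(2) c lift_mult[OF p r(1)] by eventually_elim simp
    then have "q = p \<otimes>\<^bsub>poly_ring (ultraring D F)\<^esub> r"
      using lift_inject[OF q] p r(1) by simp
    then show ?thesis using r(1) by (auto simp: pdivides_def factor_def)
  qed
qed

text \<open>
  A factorization of the components of \<open>P\<close> on a set of \<open>D\<close> has factors of bounded degree, hence is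
  a factorization of \<open>P\<close>.
\<close>

lemma lift_monic_primes:
  assumes P: "P \<in> K.monic_primes"
  shows "\<forall>\<^sub>F s in D. lift s P \<in> ring.monic_primes (F s)"
proof (rule ccontr)
  assume "\<not> ?thesis"
  then have np: "\<forall>\<^sub>F s in D. lift s P \<notin> ring.monic_primes (F s)" by (simp add: not_eventually_iff)
  note p = K.monic_primesD[OF P]
  let ?S = "\<lambda>s (q, r). q \<in> carrier (poly_ring (F s)) \<and> r \<in> carrier (poly_ring (F s)) \<and>
    lift s P = q \<otimes>\<^bsub>poly_ring (F s)\<^esub> r \<and> length q \<le> length P \<and> length r \<le> length P \<and> degree q > 0 \<and> degree r > 0"
  define w where "w s = (SOME w. ?S s w)" for s
  have "\<forall>\<^sub>F s in D. ?S s (w s)"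
    using np fields lift_carrier[OF p(1)] rep_one
  proof eventually_elim
    case (elim s)
    interpret f: field "F s" using elim by simp
    interpret fX: domain "poly_ring (F s)" by (rule f.univ_poly_is_domain[OF f.carrier_is_subring])
    have lc: "lead_coeff (lift s P) = \<one>\<^bsub>F s\<^esub>" using elim p(3,4) by (simp add: lift_hd)
    have nu: "lift s P \<notin> Units (poly_ring (F s))"
      using f.univ_poly_units'[OF f.carrier_is_subfield, of "lift s P"] p(5) by (metis lift_simps(3) not_one_le_zero)
    have "\<not> pirreducible\<^bsub>F s\<^esub> (carrier (F s)) (lift s P)"
      using elim lc by (simp add: f.monic_primes_def)
    then obtain q r where qr: "q \<in> carrier (poly_ring (F s))" "r \<in> carrier (poly_ring (F s))"
      "lift s P = q \<otimes>\<^bsub>poly_ring (F s)\<^esub> r" "q \<notin> Units (poly_ring (F s))" "r \<notin> Units (poly_ring (F s))"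
      using f.pirreducibleI[OF f.carrier_is_subring, of "lift s P"] elim p(4) nu by auto
    have nz: "q \<noteq> []" "r \<noteq> []"
      using qr(1-3) p(4) fX.l_null[of r] fX.r_null[of q] by (auto simp: univ_poly_zero)
    have d: "degree q \<noteq> 0" "degree r \<noteq> 0"
      using f.univ_poly_units'[OF f.carrier_is_subfield] qr nz by auto
    have "degree (lift s P) = degree q + degree r" using f.pmult_degree(2)[OF qr(1,2) nz] qr(3) by simp
    then have "length q \<le> length P" "length r \<le> length P" using d by simp_all
    then have "?S s (q, r)" using qr d by simp
    then show ?case unfolding w_def by (rule someI)
  qed
  then have w: "\<forall>\<^sub>F s in D. fst (w s) \<in> carrier (poly_ring (F s)) \<and> length (fst (w s)) \<le> length P"
    "\<forall>\<^sub>F s in D. snd (w s) \<in> carrier (poly_ring (F s)) \<and> length (snd (w s)) \<le> length P"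
    "\<forall>\<^sub>F s in D. lift s P = fst (w s) \<otimes>\<^bsub>poly_ring (F s)\<^esub> snd (w s) \<and> degree (fst (w s)) > 0 \<and> degree (snd (w s)) > 0"
    by (auto elim!: eventually_mono)
  obtain q where q: "q \<in> carrier (poly_ring (ultraring D F))" "\<forall>\<^sub>F s in D. lift s q = fst (w s)"
    using lift_surj[OF w(1)] by blast
  obtain r where r: "r \<in> carrier (poly_ring (ultraring D F))" "\<forall>\<^sub>F s in D. lift s r = snd (w s)"
    using lift_surj[OF w(2)] by blast
  have "\<forall>\<^sub>F s in D. lift s P = lift s (q \<otimes>\<^bsub>poly_ring (ultraring D F)\<^esub> r)"
    using q(2) r(2) w(3) lift_mult[OF q(1) r(1)] by eventually_elim simp
  then have "P = q \<otimes>\<^bsub>poly_ring (ultraring D F)\<^esub> r" using lift_inject[OF p(1)] q(1) r(1) by simp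
  then have "q \<in> Units (poly_ring (ultraring D F)) \<or> r \<in> Units (poly_ring (ultraring D F))"
    using K.pirreducibleE(3)[OF K.carrier_is_subring p(1,2) q(1) r(1)] by blast
  then have 0: "degree q = 0 \<or> degree r = 0"
    using K.univ_poly_units'[OF K.carrier_is_subfield] by auto
  have "\<forall>\<^sub>F s in D. degree q > 0 \<and> degree r > 0"
    using q(2) r(2) w(3) by eventually_elim (metis lift_simps(3))
  with 0 show False using nonbot by auto
qed

end

section \<open>The power residue symbol\<close>

text \<open>
  The family \<open>ns\<close> represents the hypernatural \<open>n\<close>, and \<open>quot_exp\<close> represents \<open>(\<kappa> - 1)/n\<close>.
\<close>

locale ultra_power_residue = ultra_finite_field D F
  for D :: "'s filter" and F :: "'s \<Rightarrow> ('a, 'b) ring_scheme" +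
  fixes ns :: "'s \<Rightarrow> int"
  assumes ns: "\<forall>\<^sub>F s in D. ns s \<ge> 1 \<and> ns s dvd int (order (F s)) - 1"
begin

text \<open>The conversion to a natural number is harmless on a set of \<open>D\<close>, where the quotient is exact and nonnegative.\<close>

definition quot_exp :: "'s \<Rightarrow> nat" where
  "quot_exp s = nat ((int (order (F s)) - 1) div ns s)"

lemma eventually_quot_exp: "\<forall>\<^sub>F s in D. ns s \<ge> 1 \<and> int (order (F s)) - 1 = ns s * int (quot_exp s)"
  using ns finite_fields
proof eventually_elim
  case (elim s)
  interpret f: field "F s" using elim by simp
  have "order (F s) > 0" using elim by (auto simp: order_def card_gt_0_iff)
  then have "(int (order (F s)) - 1) div ns s \<ge> 0" using elim by (simp add: pos_imp_zdiv_nonneg_iff)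
  then show ?case using elim by (simp add: quot_exp_def)
qed

lemma kappa_pow_minus_one:
  "kappa D F [^]\<^bsub>hyperints D\<^esub> (d :: nat) \<ominus>\<^bsub>hyperints D\<^esub> \<one>\<^bsub>hyperints D\<^esub> =
    ulim D (\<lambda>s. int (order (F s)) ^ d - 1)"
proof -
  have "\<forall>\<^sub>F s in D. cring \<Z>" by (simp add: int_is_cring)
  from ulim_minus[OF this, of "\<lambda>_. 1" "\<lambda>s. int (order (F s)) ^ d"] show ?thesis
    unfolding kappa_def ulim_nat_pow ultraring_one by (simp add: int_ring_nat_pow int_a_minus_eq)
qed

lemma hyper_quot_kappa_pow:
  "hyper_quot D (kappa D F [^]\<^bsub>hyperints D\<^esub> (d :: nat) \<ominus>\<^bsub>hyperints D\<^esub> \<one>\<^bsub>hyperints D\<^esub>) (ulim D ns) =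
    ulim D (\<lambda>s. int ((\<Sum>i<d. order (F s) ^ i) * quot_exp s))"
proof -
  have *: "\<forall>\<^sub>F s in D. ns s \<ge> 1 \<and> int (order (F s)) ^ d - 1 = ns s * int ((\<Sum>i<d. order (F s) ^ i) * quot_exp s)"
    using eventually_quot_exp
  proof eventually_elim
    case (elim s)
    have "int (order (F s)) ^ d - 1 = (int (order (F s)) - 1) * (\<Sum>i<d. int (order (F s)) ^ i)"
      by (rule power_diff_1_eq)
    then show ?case using elim by (simp add: algebra_simps)
  qed
  then have "\<forall>\<^sub>F s in D. ns s \<noteq> 0 \<and> ns s dvd int (order (F s)) ^ d - 1" by eventually_elim simp
  then have "hyper_quot D (ulim D (\<lambda>s. int (order (F s)) ^ d - 1)) (ulim D ns) =
    ulim D (\<lambda>s. (int (order (F s)) ^ d - 1) div ns s)" by (rule hyper_quot_ulim)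
  also have "\<dots> = ulim D (\<lambda>s. int ((\<Sum>i<d. order (F s) ^ i) * quot_exp s))"
    unfolding ulim_eq_iff using * by eventually_elim simp
  finally show ?thesis unfolding kappa_pow_minus_one .
qed

lemma kappa_quot_eq: "kappa_quot D F (ulim D ns) = ulim D (\<lambda>s. int (quot_exp s))"
proof -
  have "kappa D F [^]\<^bsub>hyperints D\<^esub> (1 :: nat) = kappa D F"
    unfolding kappa_def ulim_nat_pow by (simp add: int_ring_nat_pow)
  then show ?thesis using hyper_quot_kappa_pow[of 1] by simp
qed

lemma embed_eq:
  assumes "p \<in> carrier (poly_ring (ultraring D F))"
  shows "embed D F p = ulim D (\<lambda>s. lift s p)"
  unfolding embed_def lift_def[symmetric] ulim_eq_iff
  using lift_carrier[OF assms] crings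
  by eventually_elim (metis cring.axioms(1) ring.normalize_polynomial univ_poly_carrier)

lemma embed_const:
  assumes "c \<in> carrier (ultraring D F)"
  shows "embed D F (const_poly D F c) = ulim D (\<lambda>s. ring.poly_of_const (F s) (rep c s))"
  using lift_const[OF assms] embed_eq[OF K.pconst_closed[OF assms]] by (simp add: ulim_eq_iff)

lemma not_pdivides_lift:
  assumes "P \<in> K.monic_primes" "\<alpha> \<in> carrier (poly_ring (ultraring D F))" "\<not> P pdivides\<^bsub>ultraring D F\<^esub> \<alpha>"
  shows "\<forall>\<^sub>F s in D. \<not> lift s P pdivides\<^bsub>F s\<^esub> lift s \<alpha>"
  using lift_pdivides_iff[OF K.monic_primesD(1)[OF assms(1)] assms(2)] assms(3)
  by (simp add: not_eventually_iff)

text \<open>The congruence that defines the symbol holds if and only if it holds in the factors on a set of \<open>D\<close>.\<close>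

lemma residue_cond_iff:
  assumes P: "P \<in> carrier (poly_ring (ultraring D F))" and \<alpha>: "\<alpha> \<in> carrier (poly_ring (ultraring D F))"
    and c: "c \<in> carrier (ultraring D F)"
  shows "hyper_pow D (\<lambda>s. poly_ring (F s)) (embed D F \<alpha>)
          (hyper_quot D (kappa D F [^]\<^bsub>hyperints D\<^esub> degree P \<ominus>\<^bsub>hyperints D\<^esub> \<one>\<^bsub>hyperints D\<^esub>) (ulim D ns))
        \<ominus>\<^bsub>ultra_poly D F\<^esub> embed D F (const_poly D F c) \<in> PIdl\<^bsub>ultra_poly D F\<^esub> (embed D F P) \<longleftrightarrow>
    (\<forall>\<^sub>F s in D. lift s P pdivides\<^bsub>F s\<^esub>
      (lift s \<alpha> [^]\<^bsub>poly_ring (F s)\<^esub> ((\<Sum>i<degree P. order (F s) ^ i) * quot_exp s)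
        \<ominus>\<^bsub>poly_ring (F s)\<^esub> ring.poly_of_const (F s) (rep c s)))"
proof -
  have cc: "\<forall>\<^sub>F s in D. ring.poly_of_const (F s) (rep c s) \<in> carrier (poly_ring (F s))"
    using lift_const[OF c] lift_carrier[OF K.pconst_closed[OF c]] by eventually_elim simp
  let ?x = "\<lambda>s. lift s \<alpha> [^]\<^bsub>poly_ring (F s)\<^esub> ((\<Sum>i<degree P. order (F s) ^ i) * quot_exp s)
        \<ominus>\<^bsub>poly_ring (F s)\<^esub> ring.poly_of_const (F s) (rep c s)"
  have "(\<forall>\<^sub>F s in D. \<exists>d\<in>carrier (poly_ring (F s)). ?x s = d \<otimes>\<^bsub>poly_ring (F s)\<^esub> lift s P) \<longleftrightarrow>
    (\<forall>\<^sub>F s in D. lift s P pdivides\<^bsub>F s\<^esub> ?x s)"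
  proof (rule eventually_subst)
    show "\<forall>\<^sub>F s in D. (\<exists>d\<in>carrier (poly_ring (F s)). ?x s = d \<otimes>\<^bsub>poly_ring (F s)\<^esub> lift s P) =
       lift s P pdivides\<^bsub>F s\<^esub> ?x s"
      using poly_crings lift_carrier[OF P]
    proof eventually_elim
      case (elim s)
      interpret fX: cring "poly_ring (F s)" by fact
      show ?case unfolding pdivides_def factor_def using fX.m_comm[OF _ elim(2)] by metis
    qed
  qed
  then show ?thesis
    unfolding hyper_quot_kappa_pow embed_eq[OF \<alpha>] embed_eq[OF P] embed_const[OF c] hyper_pow_ulim
      ulim_minus[OF poly_crings cc] ulim_in_cgenideal_iff[OF poly_crings] int_pow_int .
qed

text \<open>
  The symbol with irreducible denominator is the class of powers of the Gauss symbols. In each factor the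
  exponent \<open>(q^(deg P) - 1)/n\<close> of \<open>\<alpha>\<close> is the product of \<open>1 + q + \<dots> + q^(deg P - 1)\<close> and \<open>(q - 1)/n\<close>.
\<close>

lemma prime_symbol_eq:
  assumes P: "P \<in> K.monic_primes" and \<alpha>: "\<alpha> \<in> carrier (poly_ring (ultraring D F))"
    and ndvd: "\<not> P pdivides\<^bsub>ultraring D F\<^esub> \<alpha>"
  shows "prime_symbol D F (ulim D ns) \<alpha> P =
      ulim D (\<lambda>s. ring.gauss_symbol (F s) (lift s \<alpha>) (lift s P) [^]\<^bsub>F s\<^esub> quot_exp s)" (is "_ = ulim D ?g")
    and "prime_symbol D F (ulim D ns) \<alpha> P \<in> carrier (ultraring D F) - {\<zero>\<^bsub>ultraring D F\<^esub>}"
proof -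
  note p = K.monic_primesD[OF P]
  let ?Q = "\<lambda>s c. lift s P pdivides\<^bsub>F s\<^esub>
      (lift s \<alpha> [^]\<^bsub>poly_ring (F s)\<^esub> ((\<Sum>i<degree P. order (F s) ^ i) * quot_exp s)
        \<ominus>\<^bsub>poly_ring (F s)\<^esub> ring.poly_of_const (F s) c)"
  have g: "\<forall>\<^sub>F s in D. ?g s \<in> carrier (F s) - {\<zero>\<^bsub>F s\<^esub>} \<and> ?Q s (?g s) \<and>
      (\<forall>c\<in>carrier (F s). ?Q s c \<longrightarrow> c = ?g s)"
    using finite_fields lift_monic_primes[OF P] lift_carrier[OF \<alpha>] not_pdivides_lift[OF P \<alpha> ndvd]
  proof eventually_elim
    case (elim s)
    interpret f: field "F s" using elim by simp
    interpret fX: domain "poly_ring (F s)" by (rule f.univ_poly_is_domain[OF f.carrier_is_subring])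
    note fp = f.monic_primesD[OF elim(2)]
    have g: "?g s \<in> carrier (F s) - {\<zero>\<^bsub>F s\<^esub>}"
      by (rule f.nonzero_pow[OF f.gauss_symbol_nonzero[OF fp(1,2) elim(3,4)]])
    moreover have Q: "?Q s (?g s)"
      using f.gauss_symbol_pow_cong[OF _ fp(1,2) elim(3,4), of "quot_exp s"] elim(1) by (simp add: order_def)
    moreover have "c = ?g s" if "c \<in> carrier (F s)" "?Q s c" for c
      using f.pconst_cong_unique[OF fp(1) _ fX.nat_pow_closed[OF elim(3)] that(1) _ that(2) Q] g fp(5) by auto
    ultimately show ?case by blast
  qed
  have gC: "ulim D ?g \<in> carrier (ultraring D F) - {\<zero>\<^bsub>ultraring D F\<^esub>}"
    unfolding ultraring_zero using g by (auto simp: ulim_in_carrier_iff ulim_neq_iff elim!: eventually_mono)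
  have "(THE c. c \<in> Units (ultraring D F) \<and>
        hyper_pow D (\<lambda>s. poly_ring (F s)) (embed D F \<alpha>)
          (hyper_quot D (kappa D F [^]\<^bsub>hyperints D\<^esub> degree P \<ominus>\<^bsub>hyperints D\<^esub> \<one>\<^bsub>hyperints D\<^esub>) (ulim D ns))
          \<ominus>\<^bsub>ultra_poly D F\<^esub> embed D F (const_poly D F c) \<in> PIdl\<^bsub>ultra_poly D F\<^esub> (embed D F P)) = ulim D ?g"
  proof (rule the_equality)
    have "\<forall>\<^sub>F s in D. ?Q s (rep (ulim D ?g) s)"
      using g eventually_rep_ulim[of D ?g] by eventually_elim simp
    then show "ulim D ?g \<in> Units (ultraring D F) \<and>
        hyper_pow D (\<lambda>s. poly_ring (F s)) (embed D F \<alpha>)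
          (hyper_quot D (kappa D F [^]\<^bsub>hyperints D\<^esub> degree P \<ominus>\<^bsub>hyperints D\<^esub> \<one>\<^bsub>hyperints D\<^esub>) (ulim D ns))
          \<ominus>\<^bsub>ultra_poly D F\<^esub> embed D F (const_poly D F (ulim D ?g)) \<in> PIdl\<^bsub>ultra_poly D F\<^esub> (embed D F P)"
      using residue_cond_iff[OF p(1) \<alpha>] gC K.field_Units by blast
  next
    fix c assume c: "c \<in> Units (ultraring D F) \<and>
        hyper_pow D (\<lambda>s. poly_ring (F s)) (embed D F \<alpha>)
          (hyper_quot D (kappa D F [^]\<^bsub>hyperints D\<^esub> degree P \<ominus>\<^bsub>hyperints D\<^esub> \<one>\<^bsub>hyperints D\<^esub>) (ulim D ns))
          \<ominus>\<^bsub>ultra_poly D F\<^esub> embed D F (const_poly D F c) \<in> PIdl\<^bsub>ultra_poly D F\<^esub> (embed D F P)"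
    have cC: "c \<in> carrier (ultraring D F)" using c K.Units_closed by blast
    then have "\<forall>\<^sub>F s in D. ?Q s (rep c s)" using residue_cond_iff[OF p(1) \<alpha>] c by blast
    then have "\<forall>\<^sub>F s in D. rep c s = ?g s"
      using g eventually_rep_carrier[OF cC] by eventually_elim blast
    then have "ulim D (rep c) = ulim D ?g" by (simp add: ulim_eq_iff)
    then show "c = ulim D ?g" using ulim_rep[OF cC] by simp
  qed
  then show "prime_symbol D F (ulim D ns) \<alpha> P = ulim D ?g"
    using ndvd unfolding prime_symbol_def pdivides_def by simp
  then show "prime_symbol D F (ulim D ns) \<alpha> P \<in> carrier (ultraring D F) - {\<zero>\<^bsub>ultraring D F\<^esub>}"
    using gC by simp
qed

lemma prime_symbol_zero:
  "P pdivides\<^bsub>ultraring D F\<^esub> \<alpha> \<Longrightarrow> prime_symbol D F (ulim D ns) \<alpha> P = \<zero>\<^bsub>ultraring D F\<^esub>"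
  by (simp add: prime_symbol_def pdivides_def)

lemma prime_symbol_closed:
  "P \<in> K.monic_primes \<Longrightarrow> \<alpha> \<in> carrier (poly_ring (ultraring D F)) \<Longrightarrow>
    prime_symbol D F (ulim D ns) \<alpha> P \<in> carrier (ultraring D F)"
  using prime_symbol_eq(2)[of P \<alpha>] prime_symbol_zero[of P \<alpha>] K.zero_closed
  by (cases "P pdivides\<^bsub>ultraring D F\<^esub> \<alpha>") (simp, blast)

lemma prime_symbol_mult:
  assumes P: "P \<in> K.monic_primes"
    and \<alpha>: "\<alpha> \<in> carrier (poly_ring (ultraring D F))" and \<beta>: "\<beta> \<in> carrier (poly_ring (ultraring D F))"
  shows "prime_symbol D F (ulim D ns) (\<alpha> \<otimes>\<^bsub>poly_ring (ultraring D F)\<^esub> \<beta>) P =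
    prime_symbol D F (ulim D ns) \<alpha> P \<otimes>\<^bsub>ultraring D F\<^esub> prime_symbol D F (ulim D ns) \<beta> P"
proof (cases "P pdivides\<^bsub>ultraring D F\<^esub> \<alpha> \<or> P pdivides\<^bsub>ultraring D F\<^esub> \<beta>")
  case True
  then have "P pdivides\<^bsub>ultraring D F\<^esub> (\<alpha> \<otimes>\<^bsub>poly_ring (ultraring D F)\<^esub> \<beta>)"
    using K.pprime_mult[OF K.monic_primesD(1,2)[OF P] \<alpha> \<beta>] by blast
  then show ?thesis
    using True prime_symbol_zero prime_symbol_closed[OF P \<alpha>] prime_symbol_closed[OF P \<beta>] by auto
next
  case False
  then have ab: "\<not> P pdivides\<^bsub>ultraring D F\<^esub> (\<alpha> \<otimes>\<^bsub>poly_ring (ultraring D F)\<^esub> \<beta>)"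
    using K.pprime_mult[OF K.monic_primesD(1,2)[OF P] \<alpha> \<beta>] by blast
  have n: "\<not> P pdivides\<^bsub>ultraring D F\<^esub> \<alpha>" "\<not> P pdivides\<^bsub>ultraring D F\<^esub> \<beta>" using False by auto
  show ?thesis
    unfolding prime_symbol_eq(1)[OF P KX.m_closed[OF \<alpha> \<beta>] ab] prime_symbol_eq(1)[OF P \<alpha> n(1)]
      prime_symbol_eq(1)[OF P \<beta> n(2)] ulim_mult ulim_eq_iff
    using finite_fields lift_monic_primes[OF P] lift_mult[OF \<alpha> \<beta>] lift_carrier[OF \<alpha>] lift_carrier[OF \<beta>]
      not_pdivides_lift[OF P \<alpha> n(1)] not_pdivides_lift[OF P \<beta> n(2)]
  proof eventually_elim
    case (elim s)
    interpret f: field "F s" using elim by simp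
    note fp = f.monic_primesD[OF elim(2)]
    show ?case
      using f.gauss_symbol_mult[OF _ fp(1,2) elim(4,6,5,7)] f.gauss_symbol_nonzero[OF fp(1,2) elim(4,6)]
        f.gauss_symbol_nonzero[OF fp(1,2) elim(5,7)] elim(1,3) by (simp add: f.nat_pow_distrib)
  qed
qed

lemma hyper_pow_kappa_quot:
  assumes "a \<in> carrier (ultraring D F)"
  shows "hyper_pow D F a (kappa_quot D F (ulim D ns)) = ulim D (\<lambda>s. rep a s [^]\<^bsub>F s\<^esub> quot_exp s)"
  using hyper_pow_ulim[of D F "rep a" "\<lambda>s. int (quot_exp s)"] by (simp add: ulim_rep[OF assms] kappa_quot_eq int_pow_int)

lemma hyper_pow_kappa_quot_nonzero:
  assumes "a \<in> carrier (ultraring D F) - {\<zero>\<^bsub>ultraring D F\<^esub>}"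
  shows "hyper_pow D F a (kappa_quot D F (ulim D ns)) \<in> carrier (ultraring D F) - {\<zero>\<^bsub>ultraring D F\<^esub>}"
proof -
  have "\<forall>\<^sub>F s in D. rep a s [^]\<^bsub>F s\<^esub> quot_exp s \<in> carrier (F s) - {\<zero>\<^bsub>F s\<^esub>}"
  proof -
    have "\<forall>\<^sub>F s in D. rep a s \<in> carrier (F s)" "\<forall>\<^sub>F s in D. rep a s \<noteq> \<zero>\<^bsub>F s\<^esub>"
      using eventually_rep_carrier rep_neq_zero assms by blast+
    then show ?thesis using fields by eventually_elim (simp add: field.nonzero_pow[simplified])
  qed
  then have "\<forall>\<^sub>F s in D. rep a s [^]\<^bsub>F s\<^esub> quot_exp s \<in> carrier (F s)" "\<forall>\<^sub>F s in D. rep a s [^]\<^bsub>F s\<^esub> quot_exp s \<noteq> \<zero>\<^bsub>F s\<^esub>"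
    by (auto elim: eventually_mono)
  then show ?thesis
    using assms by (simp add: hyper_pow_kappa_quot ulim_in_carrier_iff ulim_neq_iff ultraring_zero)
qed

lemma prime_symbol_const:
  assumes P: "P \<in> K.monic_primes" and a: "a \<in> carrier (ultraring D F) - {\<zero>\<^bsub>ultraring D F\<^esub>}"
  shows "prime_symbol D F (ulim D ns) (const_poly D F a) P =
    hyper_pow D F a (kappa_quot D F (ulim D ns)) [^]\<^bsub>ultraring D F\<^esub> degree P"
proof -
  have aC: "a \<in> carrier (ultraring D F)" using a by simp
  have "\<forall>\<^sub>F s in D. rep a s \<noteq> \<zero>\<^bsub>F s\<^esub>" using rep_neq_zero a by simp
  note ev = finite_fields lift_monic_primes[OF P] lift_const[OF aC] eventually_rep_carrier[OF aC] this
  show ?thesis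
    unfolding prime_symbol_eq(1)[OF P K.pconst_closed[OF aC] K.not_dvd_const[OF P a]]
      hyper_pow_kappa_quot[OF aC] ulim_nat_pow ulim_eq_iff
    using ev
  proof eventually_elim
    case (elim s)
    interpret f: field "F s" using elim by simp
    note fp = f.monic_primesD[OF elim(2)]
    have "ring.gauss_symbol (F s) (lift s (const_poly D F a)) (lift s P) = rep a s [^]\<^bsub>F s\<^esub> degree P"
      using f.gauss_symbol_const(2)[OF _ fp(1,2), of "rep a s"] elim by simp
    then show ?case using elim by (simp add: f.nat_pow_pow mult.commute)
  qed
qed

lemma prime_symbol_reciprocity:
  assumes P: "P \<in> K.monic_primes" and Q: "Q \<in> K.monic_primes"
  shows "prime_symbol D F (ulim D ns) P Q =
    hyper_pow D F (\<ominus>\<^bsub>ultraring D F\<^esub> \<one>\<^bsub>ultraring D F\<^esub>) (kappa_quot D F (ulim D ns))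
        [^]\<^bsub>ultraring D F\<^esub> (degree P * degree Q)
      \<otimes>\<^bsub>ultraring D F\<^esub> prime_symbol D F (ulim D ns) Q P"
proof (cases "P = Q")
  case True
  have "prime_symbol D F (ulim D ns) P P = \<zero>\<^bsub>ultraring D F\<^esub>"
    using prime_symbol_zero K.monic_primesD(1)[OF P] by (simp add: pdivides_def)
  then show ?thesis
    using True hyper_pow_kappa_quot_nonzero[OF K.minus_one_nonzero] by simp
next
  case False
  have n: "\<not> P pdivides\<^bsub>ultraring D F\<^esub> Q" "\<not> Q pdivides\<^bsub>ultraring D F\<^esub> P"
    using K.monic_primes_dvd_eq P Q False by blast+
  note p = K.monic_primesD(1)[OF P] and q = K.monic_primesD(1)[OF Q]
  have "\<ominus>\<^bsub>ultraring D F\<^esub> \<one>\<^bsub>ultraring D F\<^esub> = ulim D (\<lambda>s. \<ominus>\<^bsub>F s\<^esub> \<one>\<^bsub>F s\<^esub>)"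
    unfolding ultraring_one by (rule ulim_uminus[OF crings])
      (use crings in \<open>eventually_elim, simp add: cring.cring_simprules\<close>)
  then have m1: "\<forall>\<^sub>F s in D. rep (\<ominus>\<^bsub>ultraring D F\<^esub> \<one>\<^bsub>ultraring D F\<^esub>) s = \<ominus>\<^bsub>F s\<^esub> \<one>\<^bsub>F s\<^esub>"
    using eventually_rep_ulim by simp
  show ?thesis
    unfolding prime_symbol_eq(1)[OF P q n(1)] prime_symbol_eq(1)[OF Q p n(2)]
      hyper_pow_kappa_quot[OF K.a_inv_closed[OF K.one_closed]] ulim_nat_pow ulim_mult ulim_eq_iff
    using finite_fields lift_monic_primes[OF P] lift_monic_primes[OF Q] m1
      not_pdivides_lift[OF P q n(1)] not_pdivides_lift[OF Q p n(2)]
  proof eventually_elim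
    case (elim s)
    interpret f: field "F s" using elim by simp
    note fp = f.monic_primesD[OF elim(2)] and fq = f.monic_primesD[OF elim(3)]
    let ?d = "degree P * degree Q" and ?m = "\<ominus>\<^bsub>F s\<^esub> \<one>\<^bsub>F s\<^esub>"
    have "ring.gauss_symbol (F s) (lift s P) (lift s Q) =
      ?m [^]\<^bsub>F s\<^esub> ?d \<otimes>\<^bsub>F s\<^esub> ring.gauss_symbol (F s) (lift s Q) (lift s P)"
      using f.gauss_symbol_reciprocity[OF _ fq(1,2,3) fp(1,2,3) elim(6,5)] elim(1) by (simp add: mult.commute)
    moreover have "(?m [^]\<^bsub>F s\<^esub> ?d) [^]\<^bsub>F s\<^esub> quot_exp s = (?m [^]\<^bsub>F s\<^esub> quot_exp s) [^]\<^bsub>F s\<^esub> ?d"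
      by (subst (1 2) f.nat_pow_pow) (simp_all add: mult.commute)
    ultimately show ?case
      using f.gauss_symbol_nonzero[OF fp(1,2) fq(1) elim(5)] elim(4) by (simp add: f.nat_pow_distrib)
  qed
qed

lemma power_residue_symbol_eq:
  assumes "\<alpha> \<in> carrier (poly_ring (ultraring D F))" "\<beta> \<in> carrier (poly_ring (ultraring D F))" "\<beta> \<noteq> []"
  shows "power_residue_symbol D F (ulim D ns) \<alpha> \<beta> = K.extend_primes (prime_symbol D F (ulim D ns) \<alpha>) \<beta>"
proof (cases "degree \<beta> = 0")
  case True
  then obtain b where "\<beta> = [b]" using assms(3) by (cases \<beta>) auto
  then have "b \<in> carrier (ultraring D F) - {\<zero>\<^bsub>ultraring D F\<^esub>}" "\<beta> = const_poly D F b"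
    using K.lead_coeff_nonzero[OF assms(2,3)] K.pconst(1)[of b] by auto
  then show ?thesis
    using K.extend_primes_const[of "prime_symbol D F (ulim D ns) \<alpha>" b] prime_symbol_closed assms(1) True
    by (simp add: power_residue_symbol_def)
next
  case False
  then show ?thesis
    unfolding power_residue_symbol_def K.extend_primes_def K.factorization_def K.monic_primes_def
    by (simp add: conj_assoc)
qed

lemma power_residue_symbol_nonzero:
  assumes \<alpha>: "\<alpha> \<in> carrier (poly_ring (ultraring D F))"
    and \<beta>: "\<beta> \<in> carrier (poly_ring (ultraring D F))" "\<beta> \<noteq> []"
    and cop: "\<And>P. P \<in> K.monic_primes \<Longrightarrow> P pdivides\<^bsub>ultraring D F\<^esub> \<beta> \<Longrightarrow> \<not> P pdivides\<^bsub>ultraring D F\<^esub> \<alpha>"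
  shows "power_residue_symbol D F (ulim D ns) \<alpha> \<beta> \<in> carrier (ultraring D F) - {\<zero>\<^bsub>ultraring D F\<^esub>}"
  unfolding power_residue_symbol_eq[OF \<alpha> \<beta>]
proof (rule K.extend_primes_nonzero[OF _ \<beta>])
  show "prime_symbol D F (ulim D ns) \<alpha> \<in> K.monic_primes \<rightarrow> carrier (ultraring D F)"
    using prime_symbol_closed \<alpha> by auto
  show "prime_symbol D F (ulim D ns) \<alpha> P \<noteq> \<zero>\<^bsub>ultraring D F\<^esub>"
    if "P \<in> K.monic_primes" "P pdivides\<^bsub>ultraring D F\<^esub> \<beta>" for P
    using prime_symbol_eq(2)[OF that(1) \<alpha> cop[OF that]] by simp
qed

end

theorem theorem5p7:
  fixes D :: "'s filter"
    and F :: "'s \<Rightarrow> ('a, 'b) ring_scheme"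
    and n :: "'s hyperint"
    and \<alpha> \<beta> :: "('s \<Rightarrow> 'a) set list"
  assumes "infinite (UNIV :: 's set)"
    and "nonprincipal_ultrafilter D"
    and "\<forall>\<^sub>F s in D. field (F s) \<and> finite (carrier (F s))"
    and "n \<in> hypernats D"
    and "n divides\<^bsub>hyperints D\<^esub> (kappa D F \<ominus>\<^bsub>hyperints D\<^esub> \<one>\<^bsub>hyperints D\<^esub>)"
    and "\<alpha> \<in> carrier (GF_poly D F)" and "\<alpha> \<noteq> \<zero>\<^bsub>GF_poly D F\<^esub>"
    and "\<beta> \<in> carrier (GF_poly D F)" and "\<beta> \<noteq> \<zero>\<^bsub>GF_poly D F\<^esub>"
    and "\<one>\<^bsub>GF_poly D F\<^esub> gcdof\<^bsub>GF_poly D F\<^esub> \<alpha> \<beta>"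
  shows "power_residue_symbol D F n \<alpha> \<beta>
           \<otimes>\<^bsub>GF D F\<^esub> inv\<^bsub>GF D F\<^esub> power_residue_symbol D F n \<beta> \<alpha> =
         hyper_pow D F (\<ominus>\<^bsub>GF D F\<^esub> \<one>\<^bsub>GF D F\<^esub>)
             (kappa_quot D F n \<otimes>\<^bsub>hyperints D\<^esub> hyper_of_int D (int (degree \<alpha>))
                \<otimes>\<^bsub>hyperints D\<^esub> hyper_of_int D (int (degree \<beta>)))
           \<otimes>\<^bsub>GF D F\<^esub> poly_sign D F n \<alpha> [^]\<^bsub>GF D F\<^esub> degree \<beta>
           \<otimes>\<^bsub>GF D F\<^esub> poly_sign D F n \<beta> [^]\<^bsub>GF D F\<^esub> (- int (degree \<alpha>))"
proof -
  interpret U: ultra_finite_field D F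
    using assms(2,3) by unfold_locales (auto simp: nonprincipal_ultrafilter_def)
  obtain ns where n: "n = ulim D ns" and ns1: "\<forall>\<^sub>F s in D. ns s \<ge> 1"
    using assms(4) by (auto simp: hypernats_def ultraproduct_def)
  have kappa1: "kappa D F \<ominus>\<^bsub>hyperints D\<^esub> \<one>\<^bsub>hyperints D\<^esub> = ulim D (\<lambda>s. int (order (F s)) - 1)"
  proof -
    have "\<forall>\<^sub>F s in D. cring \<Z>" by (simp add: int_is_cring)
    from ulim_minus[OF this, of "\<lambda>_. 1" "\<lambda>s. int (order (F s))"] show ?thesis
      unfolding kappa_def ultraring_one by (simp add: int_a_minus_eq)
  qed
  interpret V: ultra_power_residue D F ns
  proof
    obtain c where "c \<in> carrier (hyperints D)"
      "ulim D (\<lambda>s. int (order (F s)) - 1) = ulim D ns \<otimes>\<^bsub>hyperints D\<^esub> c"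
      using assms(5) unfolding kappa1 n by (auto simp: factor_def)
    then obtain c' where "\<forall>\<^sub>F s in D. int (order (F s)) - 1 = ns s * c' s"
      by (auto elim!: ultraring_carrierE simp: ulim_mult ulim_eq_iff)
    with ns1 show "\<forall>\<^sub>F s in D. ns s \<ge> 1 \<and> ns s dvd int (order (F s)) - 1"
      by eventually_elim simp
  qed
  let ?K = "ultraring D F"
  have \<alpha>: "\<alpha> \<in> carrier (poly_ring ?K)" "\<alpha> \<noteq> []" and \<beta>: "\<beta> \<in> carrier (poly_ring ?K)" "\<beta> \<noteq> []"
    using assms(6-9) by (simp_all add: univ_poly_zero)
  let ?kq = "kappa_quot D F n"
  define sg where "sg a = hyper_pow D F a ?kq" for a
  define \<epsilon> where "\<epsilon> = sg (\<ominus>\<^bsub>?K\<^esub> \<one>\<^bsub>?K\<^esub>)"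
  define A where "A = power_residue_symbol D F n \<alpha> \<beta>"
  define B where "B = power_residue_symbol D F n \<beta> \<alpha>"
  define a where "a = sg (lead_coeff \<alpha>)"
  define b where "b = sg (lead_coeff \<beta>)"
  have sg: "sg c \<in> carrier ?K - {\<zero>\<^bsub>?K\<^esub>}" if "c \<in> carrier ?K - {\<zero>\<^bsub>?K\<^esub>}" for c
    using V.hyper_pow_kappa_quot_nonzero[OF that] by (simp add: sg_def n)
  have eps: "\<epsilon> \<in> carrier ?K" unfolding \<epsilon>_def using sg[OF U.K.minus_one_nonzero] by simp
  have aK: "a \<in> carrier ?K" and bK: "b \<in> carrier ?K - {\<zero>\<^bsub>?K\<^esub>}"
    unfolding a_def b_def using sg U.K.lead_coeff_nonzero \<alpha> \<beta> by auto
  have main: "A \<otimes>\<^bsub>?K\<^esub> b [^]\<^bsub>?K\<^esub> degree \<alpha> =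
    \<epsilon> [^]\<^bsub>?K\<^esub> (degree \<alpha> * degree \<beta>) \<otimes>\<^bsub>?K\<^esub> a [^]\<^bsub>?K\<^esub> degree \<beta> \<otimes>\<^bsub>?K\<^esub> B"
    unfolding A_def B_def a_def b_def n
      V.power_residue_symbol_eq[OF \<alpha>(1) \<beta>] V.power_residue_symbol_eq[OF \<beta>(1) \<alpha>]
  proof (rule U.K.extend_primes_reciprocity[OF _ _ _ _ eps _ \<alpha> \<beta>])
    show "sg c \<in> carrier ?K" if "c \<in> carrier ?K - {\<zero>\<^bsub>?K\<^esub>}" for c using sg[OF that] by simp
    show "prime_symbol D F (ulim D ns) (const_poly D F c) P = sg c [^]\<^bsub>?K\<^esub> degree P"
      if "c \<in> carrier ?K - {\<zero>\<^bsub>?K\<^esub>}" "P \<in> U.K.monic_primes" for c P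
      unfolding sg_def n by (rule V.prime_symbol_const[OF that(2,1)])
    show "prime_symbol D F (ulim D ns) P Q =
        \<epsilon> [^]\<^bsub>?K\<^esub> (degree P * degree Q) \<otimes>\<^bsub>?K\<^esub> prime_symbol D F (ulim D ns) Q P"
      if "P \<in> U.K.monic_primes" "Q \<in> U.K.monic_primes" for P Q
      unfolding \<epsilon>_def sg_def n by (rule V.prime_symbol_reciprocity[OF that])
  qed (rule V.prime_symbol_closed V.prime_symbol_mult; assumption)+
  have cop: "\<not> (P pdivides\<^bsub>?K\<^esub> \<alpha> \<and> P pdivides\<^bsub>?K\<^esub> \<beta>)" if P: "P \<in> U.K.monic_primes" for P
  proof
    assume "P pdivides\<^bsub>?K\<^esub> \<alpha> \<and> P pdivides\<^bsub>?K\<^esub> \<beta>"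
    then have "P pdivides\<^bsub>?K\<^esub> \<one>\<^bsub>poly_ring ?K\<^esub>"
      using assms(10) U.K.monic_primesD(1)[OF P] by (simp add: isgcd_def pdivides_def)
    moreover have "\<one>\<^bsub>poly_ring ?K\<^esub> = U.K.poly_of_const \<one>\<^bsub>?K\<^esub>"
      using U.K.pconst(1)[of "\<one>\<^bsub>?K\<^esub>"] by (simp add: univ_poly_one)
    ultimately show False using U.K.not_dvd_const[OF P, of "\<one>\<^bsub>?K\<^esub>"] by simp
  qed
  have A: "A \<in> carrier ?K" and B: "B \<in> carrier ?K - {\<zero>\<^bsub>?K\<^esub>}"
    unfolding A_def B_def n
    using V.power_residue_symbol_nonzero[OF \<alpha>(1) \<beta>] V.power_residue_symbol_nonzero[OF \<beta>(1) \<alpha>] cop by blast+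
  have BU: "B \<in> Units ?K" and bU: "b [^]\<^bsub>?K\<^esub> degree \<alpha> \<in> Units ?K"
    using B bK U.K.nonzero_pow[of b "degree \<alpha>"] U.K.field_Units by auto
  have E: "hyper_pow D F (\<ominus>\<^bsub>?K\<^esub> \<one>\<^bsub>?K\<^esub>)
      (?kq \<otimes>\<^bsub>hyperints D\<^esub> hyper_of_int D (int (degree \<alpha>)) \<otimes>\<^bsub>hyperints D\<^esub> hyper_of_int D (int (degree \<beta>))) =
    \<epsilon> [^]\<^bsub>?K\<^esub> (degree \<alpha> * degree \<beta>)"
  proof -
    let ?m = "\<ominus>\<^bsub>?K\<^esub> \<one>\<^bsub>?K\<^esub>"
    have m: "?m \<in> carrier ?K" by simp
    have "\<forall>\<^sub>F s in D. rep ?m s [^]\<^bsub>F s\<^esub> (V.quot_exp s * degree \<alpha> * degree \<beta>) =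
      (rep ?m s [^]\<^bsub>F s\<^esub> V.quot_exp s) [^]\<^bsub>F s\<^esub> (degree \<alpha> * degree \<beta>)"
      using U.fields eventually_rep_carrier[OF m]
    proof eventually_elim
      case (elim s)
      interpret f: field "F s" using elim by simp
      show ?case using f.nat_pow_pow[OF elim(2)] by (simp add: mult.assoc)
    qed
    moreover have "hyper_pow D F ?m
      (?kq \<otimes>\<^bsub>hyperints D\<^esub> hyper_of_int D (int (degree \<alpha>)) \<otimes>\<^bsub>hyperints D\<^esub> hyper_of_int D (int (degree \<beta>))) =
      ulim D (\<lambda>s. rep ?m s [^]\<^bsub>F s\<^esub> (V.quot_exp s * degree \<alpha> * degree \<beta>))"
    proof -
      have "?kq \<otimes>\<^bsub>hyperints D\<^esub> hyper_of_int D (int (degree \<alpha>)) \<otimes>\<^bsub>hyperints D\<^esub> hyper_of_int D (int (degree \<beta>)) =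
        ulim D (\<lambda>s. int (V.quot_exp s * degree \<alpha> * degree \<beta>))"
        unfolding n V.kappa_quot_eq hyper_of_int_def ulim_mult by simp
      then show ?thesis
        using hyper_pow_ulim[of D F "rep ?m" "\<lambda>s. int (V.quot_exp s * degree \<alpha> * degree \<beta>)"]
        unfolding ulim_rep[OF m] int_pow_int by (simp only:)
    qed
    ultimately show ?thesis
      unfolding \<epsilon>_def sg_def n V.hyper_pow_kappa_quot[OF m] ulim_nat_pow by (simp add: ulim_eq_iff)
  qed
  let ?X = "\<epsilon> [^]\<^bsub>?K\<^esub> (degree \<alpha> * degree \<beta>) \<otimes>\<^bsub>?K\<^esub> a [^]\<^bsub>?K\<^esub> degree \<beta>"
  let ?b = "b [^]\<^bsub>?K\<^esub> degree \<alpha>"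
  have X: "?X \<in> carrier ?K" using eps aK by simp
  have "A \<otimes>\<^bsub>?K\<^esub> inv\<^bsub>?K\<^esub> B = ?X \<otimes>\<^bsub>?K\<^esub> inv\<^bsub>?K\<^esub> ?b"
    by (rule U.K.mult_inv_eq_mult_inv[OF A X bU BU main])
  also have "inv\<^bsub>?K\<^esub> (b [^]\<^bsub>?K\<^esub> k) = b [^]\<^bsub>?K\<^esub> (- int k)" for k
    by (cases "k = 0") (simp_all add: int_pow_def2)
  finally show ?thesis
    unfolding E A_def B_def a_def b_def sg_def poly_sign_def .
qed

end
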